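(* In the setting of the context, let $h\le h_0$, let the uniform ellipticity assumption (E) hold at the iterate $\bar u\in\mathbb V_h$, let $\gamma_D\ge\gamma_0$ with $\gamma_0$ the coercivity threshold described in the context, and let $\Delta u\in\mathbb V_h$, $\Delta u\ne0$, solve the quasi-Newton step $$A_h(\Delta u,v_h)=-\mathcal F_{\mathrm{Total}}(\bar u,v_h)\qquad\forall v_h\in\mathbb V_h .$$ Then $\Delta u$ is a descent direction for the iterate-frozen energy $\mathcal E_{\mathrm{Total}}(\cdot\,;\bar u)$ at $\bar u$: $$D_{\Delta u}\mathcal E_{\mathrm{Total}}(\bar u;\bar u)=-A_h(\Delta u,\Delta u)\le-c_s\,|||\Delta u|||^2<0,$$ and consequently $\mathcal E_{\mathrm{Total}}(\bar u+\beta\Delta u;\bar u)<\mathcal E_{\mathrm{Total}}(\bar u;\bar u)$ for all sufficiently small $\beta>0$. Here $D_{\Delta u}$ is the Gateaux derivative with respect to the first argument only (the weight $\eta(\bar u)$ being held fixed).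
   Context: Geometry and mesh. $\Omega\subset\mathbb R^d$ is a bounded Lipschitz domain with outward unit normal $n$; homogeneous Dirichlet conditions are imposed weakly on all of $\partial\Omega$. $\mathcal T^h$ is a quasi-uniform Cartesian background mesh generated independently of $\Omega$, $h=\max_{T}\operatorname{diam}T$. Active cells $T^h_\Omega=\{T\in\mathcal T^h:T\cap\Omega\ne\emptyset\}$, cut cells $T^h_{\partial\Omega}=\{T\in T^h_\Omega:T\cap\partial\Omega\neq\emptyset\}$, active domain $\Omega_T=\bigcup_{T\in T^h_\Omega}T$. For $p\ge1$, $\mathbb V_h=\{v\in[C^0(\Omega_T)]^d: v|_T\in[\mathcal Q_p(T)]^d\ \forall T\in T^h_\Omega\}$, with $\mathcal Q_p$ the polynomials of degree at most $p$ in each coordinate. $\|\cdot\|_D$ is the $L^2$-norm on $D$. Material. $\Psi(\mathbf F)$ is a strain-energy density, $\mathbf F(u)=I+\nabla u$, $J=\det\mathbf F$, $P=\partial\Psi/\partial\mathbf F$, $\mathbb L=\partial^2\Psi/\partial\mathbf F\otimes\partial\mathbf F$; $P(u),\mathbb L(u)$ mean evaluation at $I+\nabla u$. $f_0$ is a given body force, $\mu_e>0$ the shear modulus, $E_e>0$ Young's modulus. Notation: $M:\mathbb L:N=\sum M_{ij}L_{ijkl}N_{kl}$, $n\cdot B\cdot v=\sum v_iB_{ij}n_j$. Penalty weight: $\eta(\bar u)=\max\{2\mu_e,\tfrac12\|\mathbb L(\bar u)\|_1\}$, $\|\mathbb L\|_1=\sum|L_{ijkl}|$; $\gamma_D>0$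 is the Nitsche parameter. Ghost penalty. $\mathcal F_h$ is the set of faces $F=\overline T_+\cap\overline T_-$ of positive $(d-1)$-measure with $T_+\in T^h_{\partial\Omega}$, $T_-\in T^h_\Omega$, $T_+\ne T_-$; $h_F=\operatorname{diam}F$, $n_F$ a unit normal, $[q]$ the jump across $F$, $g_F(w,v)=\sum_{k=1}^p\frac{h_F^{2k-1}}{(k!)^2}([\partial_{n_F}^kw],[\partial_{n_F}^kv])_{L^2(F)}$, $\gamma_A=\alpha E_e>0$. Iterate-frozen energy: $$\mathcal E_{\mathrm{Total}}(u;\bar u)=\int_\Omega\Psi(I+\nabla u)\,dV-\int_\Omega f_0\cdot u\,dV-\int_{\partial\Omega}n\cdot P(u)\cdot u\,dS+\int_{\partial\Omega}\frac{\gamma_D\eta(\bar u)}{2h}|u|^2dS+\frac{\gamma_A}{2}\sum_{F\in\mathcal F_h}g_F(u,u).$$ Residual: $$\mathcal F_{\mathrm{Total}}(\bar u,v)=\int_\Omega P(\bar u):\nabla v\,dV-\int_\Omega f_0\cdot v\,dV-\int_{\partial\Omega}n\cdot P(\bar u)\cdot v\,dS-\int_{\partial\Omega}n\cdot(\mathbb L(\bar u):\nabla v)\cdot\bar u\,dS+\int_{\partial\Omega}\frac{\gamma_D\eta(\bar u)}{h}\bar u\cdot v\,dS+\gamma_A\sum_{F\in\mathcal F_h}g_F(\bar u,v).$$ Assembled symmetric tangent at $\bar u$: $$A_h(u_h,v_h)=\int_\Omega\nabla u_h:\mathbb L(\bar u):\nabla v_h\,dV-\int_{\partial\Omega}n\cdot(\mathbb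 L(\bar u):\nabla u_h)\cdot v_h\,dS-\int_{\partial\Omega}n\cdot(\mathbb L(\bar u):\nabla v_h)\cdot u_h\,dS+\int_{\partial\Omega}\frac{\gamma_D\eta(\bar u)}{h}u_h\cdot v_h\,dS+\gamma_A\sum_{F\in\mathcal F_h}g_F(u_h,v_h).$$ Norm: $|||v|||^2=\|\nabla v\|_\Omega^2+\|h^{-1/2}v\|_{\partial\Omega}^2+\gamma_A\sum_{F\in\mathcal F_h}g_F(v,v)$. Assumption (E) at $\bar u$: (a) there are $0<c_L\le C_L$ with $c_L|\operatorname{sym}M|^2\le M:\mathbb L(\bar u(X)):M\le C_L|M|^2$ for all $M\in\mathbb R^{d\times d}$, $X\in\Omega_T$; (b) $\Psi\in C^3$ in a neighbourhood of the deformation gradients attained on $\Omega_T$, $J(\bar u)\ge J_0>0$ on $\Omega_T$, and $\sup_{\Omega_T}|\partial^3\Psi|<\infty$. Coercivity threshold: $h_0>0$ is a fixed reference mesh size, and $\gamma_0>0$ is a number (independent of $h$ and of the cut) such that for $h\le h_0$ and $\gamma_D\ge\gamma_0$, under (E), $A_h(v_h,v_h)\ge c_s|||v_h|||^2$ for all $v_h\in\mathbb V_h$, with $c_s>0$ independent of $h$ and of the position of $\partial\Omega$ relative to the mesh. (Its existence is a separate result of the paper and may be used.) *)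

theory Defs
  imports "HOL-Analysis.Analysis"
begin

section \<open>Surface measure\<close>

text \<open>
  Hausdorff (outer) measure of integer dimension \<open>s\<close>, normalised so that it agrees with
  \<open>s\<close>-dimensional surface area.  Empty covering sets count 0 also for \<open>s = 0\<close>, where
  \<open>0 ^ 0 = 1\<close>; thus the 0-dimensional measure is the counting measure.
\<close>

definition hausdorff_outer :: "nat \<Rightarrow> 'a::metric_space set \<Rightarrow> ennreal" where
  "hausdorff_outer s A =
     (SUP \<delta>\<in>{0::real<..}.
        INF U\<in>{U :: nat \<Rightarrow> 'a set. A \<subseteq> (\<Union>i. U i) \<and> (\<forall>i. bounded (U i) \<and> diameter (U i) \<le> \<delta>)}.
          (\<Sum>i. if U i = {} then 0
                else ennreal (unit_ball_vol (real s) * (diameter (U i) / 2) ^ s)))"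

definition hausdorff_measure :: "nat \<Rightarrow> 'a::metric_space measure" where
  "hausdorff_measure s = measure_of UNIV (sets borel) (hausdorff_outer s)"

abbreviation surf :: "(real ^ 'd) measure" where
  "surf \<equiv> hausdorff_measure (CARD('d) - 1)"


section \<open>Lipschitz domains and the outward normal\<close>

text \<open>
  Near every boundary point, \<open>\<Omega>\<close> is the strict epigraph of a Lipschitz function \<open>\<phi>\<close> over the
  hyperplane orthogonal to some unit vector \<open>e\<close>.
\<close>

definition lipschitz_domain :: "(real ^ 'd) set \<Rightarrow> bool" where
  "lipschitz_domain \<Omega> \<longleftrightarrow>
     open \<Omega> \<and> connected \<Omega> \<and> bounded \<Omega> \<and> \<Omega> \<noteq> {} \<and>
     (\<forall>x\<in>frontier \<Omega>. \<exists>e r L. \<exists>\<phi> :: real ^ 'd \<Rightarrow> real.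
        norm e = 1 \<and> r > 0 \<and> L-lipschitz_on {z. z \<bullet> e = 0} \<phi> \<and>
        (\<forall>y\<in>ball x r. y \<in> \<Omega> \<longleftrightarrow> \<phi> (y - (y \<bullet> e) *\<^sub>R e) < y \<bullet> e))"

text \<open>
  \<open>\<nu>\<close> is the outward unit normal at \<open>x\<close> if outside every double cone around the plane orthogonal
  to \<open>\<nu>\<close> the set \<open>\<Omega>\<close> lies, near \<open>x\<close>, exactly on the side opposite to \<open>\<nu>\<close>.  For a Lipschitz
  graph this holds for at most one \<open>\<nu>\<close>, and exactly where the graph function is differentiable,
  hence at almost every boundary point.
\<close>

definition is_outer_normal :: "(real ^ 'd) set \<Rightarrow> real ^ 'd \<Rightarrow> real ^ 'd \<Rightarrow> bool" where
  "is_outer_normal \<Omega> x \<nu> \<longleftrightarrow> norm \<nu> = 1 \<and>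
     (\<forall>\<epsilon>>0. \<exists>r>0. \<forall>y\<in>ball x r.
        ((y - x) \<bullet> \<nu> > \<epsilon> * norm (y - x) \<longrightarrow> y \<notin> \<Omega>) \<and>
        ((y - x) \<bullet> \<nu> < - \<epsilon> * norm (y - x) \<longrightarrow> y \<in> \<Omega>))"

text \<open>The value is 0 where no normal exists, in particular at all points of an open \<open>\<Omega>\<close>.\<close>

definition outer_normal :: "(real ^ 'd) set \<Rightarrow> real ^ 'd \<Rightarrow> real ^ 'd" where
  "outer_normal \<Omega> x = (if \<exists>\<nu>. is_outer_normal \<Omega> x \<nu> then SOME \<nu>. is_outer_normal \<Omega> x \<nu> else 0)"


section \<open>Background mesh and discrete space\<close>

text \<open>Cells are closed boxes of a finite tensor-product grid.\<close>

definition cartesian_mesh :: "(real ^ 'd) set set \<Rightarrow> bool" where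
  "cartesian_mesh \<T> \<longleftrightarrow>
     (\<exists>(g :: 'd \<Rightarrow> nat \<Rightarrow> real) (N :: 'd \<Rightarrow> nat).
        (\<forall>i. N i \<ge> 1 \<and> (\<forall>j<N i. g i j < g i (Suc j))) \<and>
        \<T> = {cbox (\<chi> i. g i (k i)) (\<chi> i. g i (Suc (k i))) | k. \<forall>i. k i < N i})"

definition mesh_size :: "(real ^ 'd) set set \<Rightarrow> real" where
  "mesh_size \<T> = Max (diameter ` \<T>)"

definition quasi_uniform :: "real \<Rightarrow> (real ^ 'd) set set \<Rightarrow> bool" where
  "quasi_uniform \<kappa> \<T> \<longleftrightarrow> \<kappa> > 0 \<and> (\<forall>T\<in>\<T>. \<exists>x. cball x (mesh_size \<T> / \<kappa>) \<subseteq> T)"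

definition background_mesh :: "real \<Rightarrow> (real ^ 'd) set \<Rightarrow> (real ^ 'd) set set \<Rightarrow> bool" where
  "background_mesh \<kappa> \<Omega> \<T> \<longleftrightarrow> cartesian_mesh \<T> \<and> quasi_uniform \<kappa> \<T> \<and> \<Omega> \<subseteq> \<Union>\<T>"

definition active_cells :: "(real ^ 'd) set \<Rightarrow> (real ^ 'd) set set \<Rightarrow> (real ^ 'd) set set" where
  "active_cells \<Omega> \<T> = {T \<in> \<T>. T \<inter> \<Omega> \<noteq> {}}"

definition cut_cells :: "(real ^ 'd) set \<Rightarrow> (real ^ 'd) set set \<Rightarrow> (real ^ 'd) set set" where
  "cut_cells \<Omega> \<T> = {T \<in> active_cells \<Omega> \<T>. T \<inter> frontier \<Omega> \<noteq> {}}"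

definition active_domain :: "(real ^ 'd) set \<Rightarrow> (real ^ 'd) set set \<Rightarrow> (real ^ 'd) set" where
  "active_domain \<Omega> \<T> = \<Union>(active_cells \<Omega> \<T>)"

definition Q_poly :: "nat \<Rightarrow> (real ^ 'd \<Rightarrow> real) set" where
  "Q_poly p = {q. \<exists>c :: ('d \<Rightarrow> nat) \<Rightarrow> real.
     q = (\<lambda>x. \<Sum>k\<in>{k. \<forall>i. k i \<le> p}. c k * (\<Prod>i\<in>UNIV. (x $ i) ^ k i))}"

text \<open>
  Members of \<open>V_h\<close> are total functions; their values off the active domain are arbitrary and
  enter none of the quantities below.
\<close>

definition V_h :: "(real ^ 'd) set \<Rightarrow> (real ^ 'd) set set \<Rightarrow> nat \<Rightarrow> (real ^ 'd \<Rightarrow> real ^ 'd) set" where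
  "V_h \<Omega> \<T> p = {v. continuous_on (active_domain \<Omega> \<T>) v \<and>
     (\<forall>T\<in>active_cells \<Omega> \<T>. \<forall>i. \<exists>q\<in>Q_poly p. \<forall>x\<in>T. v x $ i = q x)}"


section \<open>Piecewise gradients\<close>

text \<open>Gradient \<open>(\<partial>\<^sub>j u\<^sub>i)\<^sub>i\<^sub>j\<close> of the restriction of \<open>u\<close> to the cell \<open>T\<close>, up to the boundary of \<open>T\<close>.\<close>

definition cell_grad :: "(real ^ 'd) set \<Rightarrow> (real ^ 'd \<Rightarrow> real ^ 'd) \<Rightarrow> real ^ 'd \<Rightarrow> real ^ 'd ^ 'd" where
  "cell_grad T u X = jacobian u (at X within T)"

text \<open>
  The cell from which gradients are evaluated at a point \<open>X\<close> of \<open>\<Omega>\<close> or its boundary.  At a boundary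
  point it is an active cell entered from \<open>X\<close> along the inward normal, so that boundary integrals
  see the trace from inside \<open>\<Omega>\<close> even where the boundary runs along mesh faces.  Where the normal
  is 0, in particular in \<open>\<Omega>\<close>, it is any active cell containing \<open>X\<close>.  Since the choice depends on
  \<open>X\<close> only, \<open>grad\<close> is linear in \<open>u\<close>.
\<close>

definition trace_cell :: "(real ^ 'd) set \<Rightarrow> (real ^ 'd) set set \<Rightarrow> real ^ 'd \<Rightarrow> (real ^ 'd) set" where
  "trace_cell \<Omega> \<T> X =
     (SOME T. T \<in> active_cells \<Omega> \<T> \<and>
        (\<forall>\<^sub>F s in at_right 0. X - s *\<^sub>R outer_normal \<Omega> X \<in> T))"

definition grad ::
  "(real ^ 'd) set \<Rightarrow> (real ^ 'd) set set \<Rightarrow> (real ^ 'd \<Rightarrow> real ^ 'd) \<Rightarrow> real ^ 'd \<Rightarrow> real ^ 'd ^ 'd"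
  where "grad \<Omega> \<T> u X = cell_grad (trace_cell \<Omega> \<T> X) u X"


section \<open>Tensors and the constitutive law\<close>

definition ddot :: "real ^ 'd ^ 'd \<Rightarrow> real ^ 'd ^ 'd \<Rightarrow> real" where
  "ddot M N = (\<Sum>i\<in>UNIV. \<Sum>j\<in>UNIV. M $ i $ j * N $ i $ j)"

definition nBv :: "real ^ 'd \<Rightarrow> real ^ 'd ^ 'd \<Rightarrow> real ^ 'd \<Rightarrow> real" where
  "nBv n B v = (\<Sum>i\<in>UNIV. \<Sum>j\<in>UNIV. v $ i * B $ i $ j * n $ j)"

definition sym_part :: "real ^ 'd ^ 'd \<Rightarrow> real ^ 'd ^ 'd" where
  "sym_part M = (1 / 2) *\<^sub>R (M + transpose M)"

text \<open>Partial derivative with respect to the matrix entry \<open>(i, j)\<close>.\<close>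

definition entry_deriv :: "'d \<Rightarrow> 'd \<Rightarrow> (real ^ 'd ^ 'd \<Rightarrow> real) \<Rightarrow> real ^ 'd ^ 'd \<Rightarrow> real" where
  "entry_deriv i j W F = frechet_derivative W (at F) (axis i (axis j 1))"

definition stress :: "(real ^ 'd ^ 'd \<Rightarrow> real) \<Rightarrow> real ^ 'd ^ 'd \<Rightarrow> real ^ 'd ^ 'd" where
  "stress \<Psi> F = (\<chi> i j. entry_deriv i j \<Psi> F)"

definition elast :: "(real ^ 'd ^ 'd \<Rightarrow> real) \<Rightarrow> real ^ 'd ^ 'd \<Rightarrow> 'd \<Rightarrow> 'd \<Rightarrow> 'd \<Rightarrow> 'd \<Rightarrow> real" where
  "elast \<Psi> F i j k l = entry_deriv k l (\<lambda>G. stress \<Psi> G $ i $ j) F"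

definition third_deriv ::
  "(real ^ 'd ^ 'd \<Rightarrow> real) \<Rightarrow> real ^ 'd ^ 'd \<Rightarrow> 'd \<Rightarrow> 'd \<Rightarrow> 'd \<Rightarrow> 'd \<Rightarrow> 'd \<Rightarrow> 'd \<Rightarrow> real" where
  "third_deriv \<Psi> F i j k l m n = entry_deriv m n (\<lambda>G. elast \<Psi> G i j k l) F"

definition elast_app :: "(real ^ 'd ^ 'd \<Rightarrow> real) \<Rightarrow> real ^ 'd ^ 'd \<Rightarrow> real ^ 'd ^ 'd \<Rightarrow> real ^ 'd ^ 'd"
  where "elast_app \<Psi> F N = (\<chi> i j. \<Sum>k\<in>UNIV. \<Sum>l\<in>UNIV. elast \<Psi> F i j k l * N $ k $ l)"

definition elast_norm1 :: "(real ^ 'd ^ 'd \<Rightarrow> real) \<Rightarrow> real ^ 'd ^ 'd \<Rightarrow> real" where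
  "elast_norm1 \<Psi> F = (\<Sum>i\<in>UNIV. \<Sum>j\<in>UNIV. \<Sum>k\<in>UNIV. \<Sum>l\<in>UNIV. \<bar>elast \<Psi> F i j k l\<bar>)"

definition defgrad ::
  "(real ^ 'd) set \<Rightarrow> (real ^ 'd) set set \<Rightarrow> (real ^ 'd \<Rightarrow> real ^ 'd) \<Rightarrow> real ^ 'd \<Rightarrow> real ^ 'd ^ 'd"
  where "defgrad \<Omega> \<T> u X = mat 1 + grad \<Omega> \<T> u X"

text \<open>\<open>k\<close> times continuously differentiable on an open set.\<close>

primrec Ck_on :: "nat \<Rightarrow> 'a::euclidean_space set \<Rightarrow> ('a \<Rightarrow> real) \<Rightarrow> bool" where
  "Ck_on 0 S W \<longleftrightarrow> continuous_on S W"
| "Ck_on (Suc k) S W \<longleftrightarrow>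
     W differentiable_on S \<and> (\<forall>b\<in>Basis. Ck_on k S (\<lambda>x. frechet_derivative W (at x) b))"

text \<open>Deformation gradients attained on the active domain; on interfaces from each adjacent cell.\<close>

definition attained ::
  "(real ^ 'd) set \<Rightarrow> (real ^ 'd) set set \<Rightarrow> (real ^ 'd \<Rightarrow> real ^ 'd) \<Rightarrow> (real ^ 'd ^ 'd) set" where
  "attained \<Omega> \<T> u = {mat 1 + cell_grad T u X | T X. T \<in> active_cells \<Omega> \<T> \<and> X \<in> T}"

definition uniformly_elliptic ::
  "(real ^ 'd) set \<Rightarrow> (real ^ 'd) set set \<Rightarrow> (real ^ 'd ^ 'd \<Rightarrow> real) \<Rightarrow> real \<Rightarrow> real \<Rightarrow> real
    \<Rightarrow> (real ^ 'd \<Rightarrow> real ^ 'd) \<Rightarrow> bool" where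
  "uniformly_elliptic \<Omega> \<T> \<Psi> c\<^sub>L C\<^sub>L J\<^sub>0 u \<longleftrightarrow>
     0 < c\<^sub>L \<and> c\<^sub>L \<le> C\<^sub>L \<and> 0 < J\<^sub>0 \<and>
     (\<forall>F\<in>attained \<Omega> \<T> u. \<forall>M.
        c\<^sub>L * (norm (sym_part M))\<^sup>2 \<le> ddot M (elast_app \<Psi> F M) \<and>
        ddot M (elast_app \<Psi> F M) \<le> C\<^sub>L * (norm M)\<^sup>2) \<and>
     (\<exists>U. open U \<and> attained \<Omega> \<T> u \<subseteq> U \<and> Ck_on 3 U \<Psi>) \<and>
     (\<forall>F\<in>attained \<Omega> \<T> u. J\<^sub>0 \<le> det F) \<and>
     (\<exists>B. \<forall>F\<in>attained \<Omega> \<T> u. \<forall>i j k l m n. \<bar>third_deriv \<Psi> F i j k l m n\<bar> \<le> B)"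


section \<open>Ghost penalty\<close>

definition ghost_faces :: "(real ^ 'd) set \<Rightarrow> (real ^ 'd) set set \<Rightarrow> (real ^ 'd) set set" where
  "ghost_faces \<Omega> \<T> = {F. \<exists>T1\<in>cut_cells \<Omega> \<T>. \<exists>T2\<in>active_cells \<Omega> \<T>.
     T1 \<noteq> T2 \<and> F = T1 \<inter> T2 \<and> emeasure surf F > 0}"

text \<open>
  The two cells of a face and its unit normal are fixed up to order and sign, respectively;
  the ghost penalty does not depend on these choices.
\<close>

definition face_cells ::
  "(real ^ 'd) set \<Rightarrow> (real ^ 'd) set set \<Rightarrow> (real ^ 'd) set \<Rightarrow> (real ^ 'd) set \<times> (real ^ 'd) set" where
  "face_cells \<Omega> \<T> F = (SOME (T1, T2). T1 \<in> cut_cells \<Omega> \<T> \<and> T2 \<in> active_cells \<Omega> \<T> \<and>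
     T1 \<noteq> T2 \<and> F = T1 \<inter> T2)"

definition face_normal :: "(real ^ 'd) set \<Rightarrow> real ^ 'd" where
  "face_normal F = (SOME n. norm n = 1 \<and> (\<forall>x\<in>F. \<forall>y\<in>F. (x - y) \<bullet> n = 0))"

definition cell_dir_deriv ::
  "(real ^ 'd) set \<Rightarrow> real ^ 'd \<Rightarrow> (real ^ 'd \<Rightarrow> real ^ 'd) \<Rightarrow> real ^ 'd \<Rightarrow> real ^ 'd" where
  "cell_dir_deriv T n w = (\<lambda>x. frechet_derivative w (at x within T) n)"

definition normal_jump ::
  "(real ^ 'd) set \<Rightarrow> (real ^ 'd) set set \<Rightarrow> (real ^ 'd) set \<Rightarrow> nat \<Rightarrow> (real ^ 'd \<Rightarrow> real ^ 'd)
    \<Rightarrow> real ^ 'd \<Rightarrow> real ^ 'd" where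
  "normal_jump \<Omega> \<T> F k w x =
     (cell_dir_deriv (fst (face_cells \<Omega> \<T> F)) (face_normal F) ^^ k) w x
   - (cell_dir_deriv (snd (face_cells \<Omega> \<T> F)) (face_normal F) ^^ k) w x"

definition ghost_face_form ::
  "(real ^ 'd) set \<Rightarrow> (real ^ 'd) set set \<Rightarrow> nat \<Rightarrow> (real ^ 'd) set
    \<Rightarrow> (real ^ 'd \<Rightarrow> real ^ 'd) \<Rightarrow> (real ^ 'd \<Rightarrow> real ^ 'd) \<Rightarrow> real" where
  "ghost_face_form \<Omega> \<T> p F w v =
     (\<Sum>k = 1..p. diameter F ^ (2 * k - 1) / (fact k)\<^sup>2 *
        (LINT x:F|surf. normal_jump \<Omega> \<T> F k w x \<bullet> normal_jump \<Omega> \<T> F k v x))"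

definition ghost_form ::
  "(real ^ 'd) set \<Rightarrow> (real ^ 'd) set set \<Rightarrow> nat
    \<Rightarrow> (real ^ 'd \<Rightarrow> real ^ 'd) \<Rightarrow> (real ^ 'd \<Rightarrow> real ^ 'd) \<Rightarrow> real" where
  "ghost_form \<Omega> \<T> p w v = (\<Sum>F\<in>ghost_faces \<Omega> \<T>. ghost_face_form \<Omega> \<T> p F w v)"


section \<open>Energy, residual, tangent and norm\<close>

definition penalty_weight ::
  "(real ^ 'd) set \<Rightarrow> (real ^ 'd) set set \<Rightarrow> (real ^ 'd ^ 'd \<Rightarrow> real) \<Rightarrow> real
    \<Rightarrow> (real ^ 'd \<Rightarrow> real ^ 'd) \<Rightarrow> real ^ 'd \<Rightarrow> real" where
  "penalty_weight \<Omega> \<T> \<Psi> \<mu>\<^sub>e ub X = max (2 * \<mu>\<^sub>e) (1 / 2 * elast_norm1 \<Psi> (defgrad \<Omega> \<T> ub X))"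

definition E_total ::
  "(real ^ 'd) set \<Rightarrow> (real ^ 'd) set set \<Rightarrow> nat \<Rightarrow> (real ^ 'd ^ 'd \<Rightarrow> real) \<Rightarrow> real \<Rightarrow> real \<Rightarrow> real
    \<Rightarrow> (real ^ 'd \<Rightarrow> real ^ 'd) \<Rightarrow> (real ^ 'd \<Rightarrow> real ^ 'd) \<Rightarrow> (real ^ 'd \<Rightarrow> real ^ 'd) \<Rightarrow> real" where
  "E_total \<Omega> \<T> p \<Psi> \<mu>\<^sub>e \<gamma>\<^sub>D \<gamma>\<^sub>A f\<^sub>0 ub u =
     (LINT X:\<Omega>|lebesgue. \<Psi> (defgrad \<Omega> \<T> u X))
   - (LINT X:\<Omega>|lebesgue. f\<^sub>0 X \<bullet> u X)
   - (LINT X:frontier \<Omega>|surf. nBv (outer_normal \<Omega> X) (stress \<Psi> (defgrad \<Omega> \<T> u X)) (u X))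
   + (LINT X:frontier \<Omega>|surf.
        \<gamma>\<^sub>D * penalty_weight \<Omega> \<T> \<Psi> \<mu>\<^sub>e ub X / (2 * mesh_size \<T>) * (norm (u X))\<^sup>2)
   + \<gamma>\<^sub>A / 2 * ghost_form \<Omega> \<T> p u u"

definition F_total ::
  "(real ^ 'd) set \<Rightarrow> (real ^ 'd) set set \<Rightarrow> nat \<Rightarrow> (real ^ 'd ^ 'd \<Rightarrow> real) \<Rightarrow> real \<Rightarrow> real \<Rightarrow> real
    \<Rightarrow> (real ^ 'd \<Rightarrow> real ^ 'd) \<Rightarrow> (real ^ 'd \<Rightarrow> real ^ 'd) \<Rightarrow> (real ^ 'd \<Rightarrow> real ^ 'd) \<Rightarrow> real" where
  "F_total \<Omega> \<T> p \<Psi> \<mu>\<^sub>e \<gamma>\<^sub>D \<gamma>\<^sub>A f\<^sub>0 ub v =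
     (LINT X:\<Omega>|lebesgue. ddot (stress \<Psi> (defgrad \<Omega> \<T> ub X)) (grad \<Omega> \<T> v X))
   - (LINT X:\<Omega>|lebesgue. f\<^sub>0 X \<bullet> v X)
   - (LINT X:frontier \<Omega>|surf. nBv (outer_normal \<Omega> X) (stress \<Psi> (defgrad \<Omega> \<T> ub X)) (v X))
   - (LINT X:frontier \<Omega>|surf.
        nBv (outer_normal \<Omega> X) (elast_app \<Psi> (defgrad \<Omega> \<T> ub X) (grad \<Omega> \<T> v X)) (ub X))
   + (LINT X:frontier \<Omega>|surf.
        \<gamma>\<^sub>D * penalty_weight \<Omega> \<T> \<Psi> \<mu>\<^sub>e ub X / mesh_size \<T> * (ub X \<bullet> v X))
   + \<gamma>\<^sub>A * ghost_form \<Omega> \<T> p ub v"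

definition A_h ::
  "(real ^ 'd) set \<Rightarrow> (real ^ 'd) set set \<Rightarrow> nat \<Rightarrow> (real ^ 'd ^ 'd \<Rightarrow> real) \<Rightarrow> real \<Rightarrow> real \<Rightarrow> real
    \<Rightarrow> (real ^ 'd \<Rightarrow> real ^ 'd) \<Rightarrow> (real ^ 'd \<Rightarrow> real ^ 'd) \<Rightarrow> (real ^ 'd \<Rightarrow> real ^ 'd) \<Rightarrow> real" where
  "A_h \<Omega> \<T> p \<Psi> \<mu>\<^sub>e \<gamma>\<^sub>D \<gamma>\<^sub>A ub u v =
     (LINT X:\<Omega>|lebesgue.
        ddot (grad \<Omega> \<T> u X) (elast_app \<Psi> (defgrad \<Omega> \<T> ub X) (grad \<Omega> \<T> v X)))
   - (LINT X:frontier \<Omega>|surf.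
        nBv (outer_normal \<Omega> X) (elast_app \<Psi> (defgrad \<Omega> \<T> ub X) (grad \<Omega> \<T> u X)) (v X))
   - (LINT X:frontier \<Omega>|surf.
        nBv (outer_normal \<Omega> X) (elast_app \<Psi> (defgrad \<Omega> \<T> ub X) (grad \<Omega> \<T> v X)) (u X))
   + (LINT X:frontier \<Omega>|surf.
        \<gamma>\<^sub>D * penalty_weight \<Omega> \<T> \<Psi> \<mu>\<^sub>e ub X / mesh_size \<T> * (u X \<bullet> v X))
   + \<gamma>\<^sub>A * ghost_form \<Omega> \<T> p u v"

definition L2_norm_on :: "'a measure \<Rightarrow> 'a set \<Rightarrow> ('a \<Rightarrow> 'b::real_normed_vector) \<Rightarrow> real" where
  "L2_norm_on M D g = sqrt (LINT x:D|M. (norm (g x))\<^sup>2)"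

definition triple_norm ::
  "(real ^ 'd) set \<Rightarrow> (real ^ 'd) set set \<Rightarrow> nat \<Rightarrow> real \<Rightarrow> (real ^ 'd \<Rightarrow> real ^ 'd) \<Rightarrow> real" where
  "triple_norm \<Omega> \<T> p \<gamma>\<^sub>A v = sqrt
     ((L2_norm_on lebesgue \<Omega> (grad \<Omega> \<T> v))\<^sup>2
    + (L2_norm_on surf (frontier \<Omega>) (\<lambda>X. (mesh_size \<T> powr (- 1 / 2)) *\<^sub>R v X))\<^sup>2
    + \<gamma>\<^sub>A * ghost_form \<Omega> \<T> p v v)"

text \<open>
  \<open>\<gamma>\<^sub>0\<close> and \<open>c\<^sub>s\<close> may depend on the domain, the material, the polynomial degree, the
  quasi-uniformity constant and the constants of uniform ellipticity, but not on the mesh (hence not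
  on the mesh size or on how the boundary cuts the mesh), the iterate or \<open>\<gamma>\<^sub>D\<close>.  Uniformity
  in \<open>\<gamma>\<^sub>D\<close> is no restriction, because the tangent form is nondecreasing in \<open>\<gamma>\<^sub>D\<close>.
\<close>

definition coercivity_threshold ::
  "real \<Rightarrow> (real ^ 'd) set \<Rightarrow> nat \<Rightarrow> (real ^ 'd ^ 'd \<Rightarrow> real) \<Rightarrow> real \<Rightarrow> real \<Rightarrow> real \<Rightarrow> real \<Rightarrow> real
    \<Rightarrow> real \<Rightarrow> real \<Rightarrow> real \<Rightarrow> bool" where
  "coercivity_threshold \<kappa> \<Omega> p \<Psi> \<mu>\<^sub>e \<gamma>\<^sub>A c\<^sub>L C\<^sub>L J\<^sub>0 h\<^sub>0 \<gamma>\<^sub>0 c\<^sub>s \<longleftrightarrow>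
     0 < h\<^sub>0 \<and> 0 < \<gamma>\<^sub>0 \<and> 0 < c\<^sub>s \<and>
     (\<forall>\<T> ub \<gamma>\<^sub>D. background_mesh \<kappa> \<Omega> \<T> \<and> mesh_size \<T> \<le> h\<^sub>0 \<and> \<gamma>\<^sub>0 \<le> \<gamma>\<^sub>D \<and>
        ub \<in> V_h \<Omega> \<T> p \<and> uniformly_elliptic \<Omega> \<T> \<Psi> c\<^sub>L C\<^sub>L J\<^sub>0 ub \<longrightarrow>
        (\<forall>v\<in>V_h \<Omega> \<T> p.
           c\<^sub>s * (triple_norm \<Omega> \<T> p \<gamma>\<^sub>A v)\<^sup>2 \<le> A_h \<Omega> \<T> p \<Psi> \<mu>\<^sub>e \<gamma>\<^sub>D \<gamma>\<^sub>A ub v v))"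

definition has_gateaux_derivative ::
  "(('a \<Rightarrow> 'b::real_vector) \<Rightarrow> real) \<Rightarrow> real \<Rightarrow> ('a \<Rightarrow> 'b) \<Rightarrow> ('a \<Rightarrow> 'b) \<Rightarrow> bool" where
  "has_gateaux_derivative J D u w \<longleftrightarrow>
     ((\<lambda>t. J (\<lambda>x. u x + t *\<^sub>R w x)) has_real_derivative D) (at 0)"

end

theory Submission
  imports Defs
begin

text \<open>
  The energy with frozen penalty weight is differentiated under the integral sign; its derivative at
  the iterate is the residual, which the quasi-Newton equation turns into minus the tangent form, and
  coercivity bounds that form from below.  Dominated convergence applies because the deformation
  gradients of all small perturbations stay in one compact subset of the open set on which the
  energy density is smooth, and because the frontier of a Lipschitz domain has finite surface measure.
  The norm of a nonzero step is positive: a vanishing gradient would make the step a nonzero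
  constant, whose trace does not vanish since the frontier has positive surface measure.
\<close>

section \<open>Hausdorff measure is a Borel measure\<close>

text \<open>\<open>measure_of\<close> falls back to the zero measure when its set function is not a
  measure on the generated sets, so surface integrals mean nothing until the Hausdorff outer measure
  is known to be countably additive on Borel sets; Caratheodory's criterion for closed sets supplies
  this. A second obstacle is that the normal and the trace cell are picked by \<open>SOME\<close>.
  Their measurability is recovered from uniqueness of the normal, from compactness of the unit
  sphere, and from the fact that only finitely many sets of admissible cells can occur. Finally, a
  Bochner integral is 0 when its integrand is not integrable, so each splitting of an integral has
  to be justified. The integrands built from the energy density are therefore written as functions,
  continuous on a compact set, of a measurable tuple of point data, which gives integrability and
  uniform bounds together.\<close>

definition hausdorff_weight :: "nat \<Rightarrow> 'a::metric_space set \<Rightarrow> ennreal" where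
  "hausdorff_weight s U =
     (if U = {} then 0 else ennreal (unit_ball_vol (real s) * (diameter U / 2) ^ s))"

text \<open>The inner infimum of \<open>hausdorff_outer\<close>, isolated because covering arguments
  take place at one scale and are afterwards passed to the supremum.\<close>

definition hausdorff_content :: "nat \<Rightarrow> real \<Rightarrow> 'a::metric_space set \<Rightarrow> ennreal" where
  "hausdorff_content s \<delta> A =
     (INF U\<in>{U :: nat \<Rightarrow> 'a set. A \<subseteq> (\<Union>i. U i) \<and> (\<forall>i. bounded (U i) \<and> diameter (U i) \<le> \<delta>)}.
        (\<Sum>i. hausdorff_weight s (U i)))"

lemma hausdorff_outer_eq_SUP_content:
  "hausdorff_outer s A = (SUP \<delta>\<in>{0<..}. hausdorff_content s \<delta> A)"
  unfolding hausdorff_outer_def hausdorff_content_def hausdorff_weight_def ..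

lemma hausdorff_weight_empty [simp]: "hausdorff_weight s {} = 0"
  by (simp add: hausdorff_weight_def)

lemma hausdorff_content_le:
  assumes "A \<subseteq> (\<Union>i. U i)" "\<And>i. bounded (U i)" "\<And>i. diameter (U i) \<le> \<delta>"
  shows "hausdorff_content s \<delta> A \<le> (\<Sum>i. hausdorff_weight s (U i))"
  unfolding hausdorff_content_def using assms by (intro INF_lower) auto

lemma hausdorff_content_geI:
  assumes "\<And>U. A \<subseteq> (\<Union>i. U i) \<Longrightarrow> (\<And>i. bounded (U i)) \<Longrightarrow> (\<And>i. diameter (U i) \<le> \<delta>)
             \<Longrightarrow> c \<le> (\<Sum>i. hausdorff_weight s (U i))"
  shows "c \<le> hausdorff_content s \<delta> A"
  unfolding hausdorff_content_def using assms by (intro INF_greatest) auto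

lemma hausdorff_content_mono: "A \<subseteq> B \<Longrightarrow> hausdorff_content s \<delta> A \<le> hausdorff_content s \<delta> B"
  by (rule hausdorff_content_geI) (rule hausdorff_content_le, auto)

lemma hausdorff_content_antimono:
  "\<delta> \<le> \<delta>' \<Longrightarrow> hausdorff_content s \<delta>' A \<le> hausdorff_content s \<delta> A"
  by (rule hausdorff_content_geI) (rule hausdorff_content_le, auto intro: order_trans)

lemma hausdorff_outer_mono: "A \<subseteq> B \<Longrightarrow> hausdorff_outer s A \<le> hausdorff_outer s B"
  unfolding hausdorff_outer_eq_SUP_content by (intro SUP_mono' hausdorff_content_mono)

lemma hausdorff_content_le_outer: "0 < \<delta> \<Longrightarrow> hausdorff_content s \<delta> A \<le> hausdorff_outer s A"
  unfolding hausdorff_outer_eq_SUP_content by (intro SUP_upper) auto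

lemma hausdorff_outer_empty: "hausdorff_outer s {} = 0"
proof -
  have "hausdorff_content s \<delta> ({}::'a set) \<le> 0" if "0 < \<delta>" for \<delta>
    using hausdorff_content_le[of "{}" "\<lambda>_. {}::'a set" \<delta> s] that by simp
  then show ?thesis
    unfolding hausdorff_outer_eq_SUP_content by (intro antisym SUP_least) auto
qed

text \<open>Nearly optimal covers of the sets \<open>A i\<close>, with excess
  \<open>e * (1/2) ^ Suc i\<close>, are merged into one sequence along \<open>prod_decode\<close>;
  the excesses add up to \<open>e\<close>.\<close>

lemma hausdorff_content_UN_le:
  "hausdorff_content s \<delta> (\<Union>i::nat. A i) \<le> (\<Sum>i. hausdorff_content s \<delta> (A i))"
proof (rule ennreal_le_epsilon)
  fix e :: real assume fin: "(\<Sum>i. hausdorff_content s \<delta> (A i)) < top" and e: "0 < e"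
  have "\<exists>U. A i \<subseteq> (\<Union>j. U j) \<and> (\<forall>j. bounded (U j) \<and> diameter (U j) \<le> \<delta>) \<and>
           (\<Sum>j. hausdorff_weight s (U j)) \<le> hausdorff_content s \<delta> (A i) + ennreal (e * (1/2) ^ Suc i)" for i
  proof -
    \<comment> \<open>Only below \<open>top\<close> does adding a positive amount give a strict
      inequality, and thereby a cover beneath it.\<close>
    have "hausdorff_content s \<delta> (A i) < top"
      using fin ennreal_suminf_lessD by blast
    then have "hausdorff_content s \<delta> (A i) < hausdorff_content s \<delta> (A i) + ennreal (e * (1/2) ^ Suc i)"
      using e ennreal_add_left_cancel_less[of "hausdorff_content s \<delta> (A i)" 0 "ennreal (e * (1/2) ^ Suc i)"]
      by (auto simp: less_top)
    then show ?thesis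
      unfolding hausdorff_content_def INF_less_iff by (force intro: less_imp_le)
  qed
  then obtain U where U: "\<And>i. A i \<subseteq> (\<Union>j. U i j)" "\<And>i j. bounded (U i j)" "\<And>i j. diameter (U i j) \<le> \<delta>"
      "\<And>i. (\<Sum>j. hausdorff_weight s (U i j)) \<le> hausdorff_content s \<delta> (A i) + ennreal (e * (1/2) ^ Suc i)"
    by metis
  define V where "V = (\<lambda>n. case prod_decode n of (i, j) \<Rightarrow> U i j)"
  have "(\<Union>i. A i) \<subseteq> (\<Union>n. V n)"
  proof
    fix x assume "x \<in> (\<Union>i. A i)"
    then obtain i j where "x \<in> U i j" using U(1) by blast
    then have "x \<in> V (prod_encode (i, j))" by (simp add: V_def)
    then show "x \<in> (\<Union>n. V n)" by blast
  qed
  then have "hausdorff_content s \<delta> (\<Union>i. A i) \<le> (\<Sum>n. hausdorff_weight s (V n))"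
    by (rule hausdorff_content_le) (auto simp: V_def U split: prod.split)
  also have "\<dots> = (\<Sum>i. \<Sum>j. hausdorff_weight s (U i j))"
    using suminf_ennreal_2dimen[of "\<lambda>i. \<Sum>j. hausdorff_weight s (U i j)" "\<lambda>(i, j). hausdorff_weight s (U i j)"]
    by (simp add: V_def comp_def case_prod_beta')
  also have "\<dots> \<le> (\<Sum>i. hausdorff_content s \<delta> (A i) + ennreal (e * (1/2) ^ Suc i))"
    by (intro suminf_le U) auto
  also have "\<dots> = (\<Sum>i. hausdorff_content s \<delta> (A i)) + (\<Sum>i. ennreal (e * (1/2) ^ Suc i))"
    by (intro suminf_add[symmetric]) auto
  also have "(\<Sum>i. ennreal (e * (1/2) ^ Suc i)) = ennreal e"
    using e power_half_series by (intro suminf_ennreal_eq) (auto dest: sums_mult[of _ _ e])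
  finally show "hausdorff_content s \<delta> (\<Union>i. A i) \<le> (\<Sum>i. hausdorff_content s \<delta> (A i)) + ennreal e" .
qed

lemma hausdorff_outer_UN_le:
  "hausdorff_outer s (\<Union>i::nat. A i) \<le> (\<Sum>i. hausdorff_outer s (A i))"
proof -
  have "hausdorff_content s \<delta> (\<Union>i. A i) \<le> (\<Sum>i. hausdorff_outer s (A i))" if "0 < \<delta>" for \<delta>
    by (rule order_trans[OF hausdorff_content_UN_le])
       (use that in \<open>auto intro!: suminf_le hausdorff_content_le_outer\<close>)
  then show ?thesis
    unfolding hausdorff_outer_eq_SUP_content[of s "\<Union>i. A i"] by (intro SUP_least) auto
qed

lemma hausdorff_outer_Un_le: "hausdorff_outer s (A \<union> B) \<le> hausdorff_outer s A + hausdorff_outer s B"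
proof -
  have "hausdorff_outer s (\<Union>i. binaryset A B i) \<le> (\<Sum>i. hausdorff_outer s (binaryset A B i))"
    by (rule hausdorff_outer_UN_le)
  then show ?thesis
    by (simp add: UN_binaryset_eq suminf_binaryset_eq[of "hausdorff_outer s", OF hausdorff_outer_empty])
qed

section \<open>Caratheodory measurability of closed and Borel sets\<close>

lemma outer_measure_space_hausdorff: "outer_measure_space UNIV (hausdorff_outer s)"
  unfolding outer_measure_space_def positive_def increasing_def countably_subadditive_def
  by (auto simp: hausdorff_outer_empty intro: hausdorff_outer_mono hausdorff_outer_UN_le)

text \<open>A covering set of diameter at most \<delta> cannot meet both \<open>A\<close> and
  \<open>B\<close>, so its weight is charged to one of them only.\<close>

lemma hausdorff_content_separated:
  assumes sep: "\<And>a b. a \<in> A \<Longrightarrow> b \<in> B \<Longrightarrow> \<delta> < dist a b"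
  shows "hausdorff_content s \<delta> A + hausdorff_content s \<delta> B \<le> hausdorff_content s \<delta> (A \<union> B)"
proof (rule hausdorff_content_geI)
  fix U :: "nat \<Rightarrow> 'a set"
  assume U: "A \<union> B \<subseteq> (\<Union>i. U i)" "\<And>i. bounded (U i)" "\<And>i. diameter (U i) \<le> \<delta>"
  define V where "V C i = (if U i \<inter> C = {} then {} else U i)" for C i
  have disj: "hausdorff_weight s (V A i) + hausdorff_weight s (V B i) \<le> hausdorff_weight s (U i)" for i
  proof (cases "U i \<inter> A = {} \<or> U i \<inter> B = {}")
    case False
    then obtain a b where "a \<in> U i" "a \<in> A" "b \<in> U i" "b \<in> B" by blast
    then have "dist a b \<le> \<delta>"
      using diameter_bounded_bound[OF U(2)[of i]] U(3)[of i] by force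
    then show ?thesis using sep \<open>a \<in> A\<close> \<open>b \<in> B\<close> by fastforce
  qed (auto simp: V_def)
  have bV: "bounded (V C i)" for C i using U by (simp add: V_def)
  \<comment> \<open>Sets that miss \<open>C\<close> are replaced by the empty set, whose diameter 0
    must not exceed \<delta>; the given cover forces \<delta> to be nonnegative.\<close>
  have nn: "0 \<le> \<delta>" using U(3)[of undefined] diameter_ge_0[OF U(2)] order_trans by blast
  then have dV: "diameter (V C i) \<le> \<delta>" for C i using U by (simp add: V_def)
  have "hausdorff_content s \<delta> A \<le> (\<Sum>i. hausdorff_weight s (V A i))"
    by (rule hausdorff_content_le) (use U bV dV in \<open>auto simp: V_def\<close>, blast+)
  moreover have "hausdorff_content s \<delta> B \<le> (\<Sum>i. hausdorff_weight s (V B i))"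
    by (rule hausdorff_content_le) (use U bV dV in \<open>auto simp: V_def\<close>, blast+)
  ultimately have "hausdorff_content s \<delta> A + hausdorff_content s \<delta> B
      \<le> (\<Sum>i. hausdorff_weight s (V A i)) + (\<Sum>i. hausdorff_weight s (V B i))"
    by (rule add_mono)
  also have "\<dots> = (\<Sum>i. hausdorff_weight s (V A i) + hausdorff_weight s (V B i))"
    by (rule suminf_add) auto
  also have "\<dots> \<le> (\<Sum>i. hausdorff_weight s (U i))"
    by (intro suminf_le disj) auto
  finally show "hausdorff_content s \<delta> A + hausdorff_content s \<delta> B \<le> (\<Sum>i. hausdorff_weight s (U i))" .
qed

lemma hausdorff_outer_separated:
  assumes "0 < e" and sep: "\<And>a b. a \<in> A \<Longrightarrow> b \<in> B \<Longrightarrow> e \<le> dist a b"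
  shows "hausdorff_outer s (A \<union> B) = hausdorff_outer s A + hausdorff_outer s B"
proof (rule antisym[OF hausdorff_outer_Un_le])
  have "hausdorff_content s \<delta> A + hausdorff_content s \<delta>' B \<le> hausdorff_outer s (A \<union> B)"
    if "0 < \<delta>" "0 < \<delta>'" for \<delta> \<delta>'
  proof -
    \<comment> \<open>Half of \<open>e\<close>, because separation at scale \<rho> has to be strict;
      below \<delta> and \<delta>' as well, because the two suprema run independently and content
      grows as the scale shrinks.\<close>
    define \<rho> where "\<rho> = min (e / 2) (min \<delta> \<delta>')"
    have "hausdorff_content s \<delta> A + hausdorff_content s \<delta>' B
        \<le> hausdorff_content s \<rho> A + hausdorff_content s \<rho> B"
      by (intro add_mono hausdorff_content_antimono) (auto simp: \<rho>_def)
    also have "\<dots> \<le> hausdorff_content s \<rho> (A \<union> B)"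
      by (rule hausdorff_content_separated) (use \<open>0 < e\<close> sep in \<open>force simp: \<rho>_def\<close>)
    also have "\<dots> \<le> hausdorff_outer s (A \<union> B)"
      using that \<open>0 < e\<close> by (intro hausdorff_content_le_outer) (auto simp: \<rho>_def)
    finally show ?thesis .
  qed
  then have "(SUP \<delta>\<in>{0<..}. hausdorff_content s \<delta> A + hausdorff_content s \<delta>' B) \<le> hausdorff_outer s (A \<union> B)"
    if "0 < \<delta>'" for \<delta>' using that by (intro SUP_least) auto
  then have "hausdorff_outer s A + hausdorff_content s \<delta>' B \<le> hausdorff_outer s (A \<union> B)" if "0 < \<delta>'" for \<delta>'
    using that by (simp add: hausdorff_outer_eq_SUP_content[of s A] ennreal_SUP_add_left)
  then have "(SUP \<delta>'\<in>{0<..}. hausdorff_outer s A + hausdorff_content s \<delta>' B) \<le> hausdorff_outer s (A \<union> B)"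
    by (intro SUP_least) auto
  then show "hausdorff_outer s A + hausdorff_outer s B \<le> hausdorff_outer s (A \<union> B)"
    by (simp add: hausdorff_outer_eq_SUP_content[of s B] ennreal_SUP_add_right)
qed

text \<open>A function that does not expand distances turns gaps between its levels into positive
  distances between the level sets, so their measures add up.\<close>

lemma hausdorff_outer_levels:
  fixes f :: "'a::metric_space \<Rightarrow> real" and l u :: "nat \<Rightarrow> real"
  assumes lip: "\<And>x y. \<bar>f x - f y\<bar> \<le> dist x y"
    and gap: "\<And>j k. j < k \<Longrightarrow> u k < l j"
  shows "(\<Sum>k<m. hausdorff_outer s {x\<in>X. l k \<le> f x \<and> f x < u k}) \<le> hausdorff_outer s X"
proof -
  let ?R = "\<lambda>k. {x\<in>X. l k \<le> f x \<and> f x < u k}"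
  have "(\<Sum>k<m. hausdorff_outer s (?R k)) = hausdorff_outer s (\<Union>k<m. ?R k)"
  proof (induction m)
    case 0 then show ?case by (simp add: hausdorff_outer_empty)
  next
    case (Suc m)
    \<comment> \<open>The smallest gap to the layers already joined. For \<open>m = 0\<close> there
      is none, and any positive number serves.\<close>
    define e where "e = (if m = 0 then 1 else Min ((\<lambda>j. l j - u m) ` {..<m}))"
    have "0 < e" using gap[of _ m] by (auto simp: e_def lessThan_empty_iff Min_gr_iff)
    have "hausdorff_outer s ((\<Union>k<m. ?R k) \<union> ?R m) = hausdorff_outer s (\<Union>k<m. ?R k) + hausdorff_outer s (?R m)"
    proof (rule hausdorff_outer_separated[OF \<open>0 < e\<close>])
      fix a b assume "a \<in> (\<Union>k<m. ?R k)" "b \<in> ?R m"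
      then obtain k where k: "k < m" "l k \<le> f a" "f b < u m" by blast
      then have "e \<le> l k - u m" by (auto simp: e_def)
      then show "e \<le> dist a b" using lip[of a b] k by linarith
    qed
    then show ?case using Suc by (simp add: lessThan_Suc Un_commute)
  qed
  also have "\<dots> \<le> hausdorff_outer s X" by (intro hausdorff_outer_mono) auto
  finally show ?thesis .
qed

text \<open>
  The shells \<open>R k\<close> around \<open>C\<close> have finite total measure, because every second one is separated
  from the others; hence the part of \<open>X - C\<close> close to \<open>C\<close> is negligible.
\<close>

lemma closed_in_lambda_system_hausdorff:
  fixes C :: "'a::metric_space set"
  assumes "closed C"
  shows "C \<in> lambda_system UNIV UNIV (hausdorff_outer s)"
proof (cases "C = {}")
  case True
  then show ?thesis by (simp add: lambda_system_def hausdorff_outer_empty)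
next
  case False
  have "hausdorff_outer s (C \<inter> X) + hausdorff_outer s (X - C) \<le> hausdorff_outer s X" for X
  proof (cases "hausdorff_outer s X = top")
    case True then show ?thesis by simp
  next
    case fin: False
    define f where "f = (\<lambda>x. infdist x C)"
    have lip: "\<bar>f x - f y\<bar> \<le> dist x y" for x y
      using infdist_triangle[of x C y] infdist_triangle[of y C x] by (auto simp: f_def dist_commute abs_le_iff)
    define R where "R k = {x\<in>X. 1 / (real k + 2) \<le> f x \<and> f x < 1 / (real k + 1)}" for k
    define N where "N n = {x\<in>X. 1 / (real n + 1) \<le> f x}" for n
    let ?H = "hausdorff_outer s"
    have pair: "(\<Sum>k<m. ?H (R k)) \<le> ?H X + ?H X" for m
    proof -
      have "(\<Sum>k<m. ?H (R k)) \<le> (\<Sum>k<2*m. ?H (R k))"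
        by (intro sum_mono2) auto
      also have "\<dots> = (\<Sum>k<m. ?H (R (2*k))) + (\<Sum>k<m. ?H (R (2*k+1)))"
        by (induction m) (auto simp: algebra_simps)
      also have "\<dots> \<le> ?H X + ?H X"
      proof (intro add_mono)
        show "(\<Sum>k<m. ?H (R (2*k))) \<le> ?H X"
          unfolding R_def by (intro hausdorff_outer_levels lip) (auto simp: field_simps)
        show "(\<Sum>k<m. ?H (R (2*k+1))) \<le> ?H X"
          unfolding R_def by (intro hausdorff_outer_levels lip) (auto simp: field_simps)
      qed
      finally show ?thesis .
    qed
    define S where "S = (\<Sum>k. ?H (R k))"
    have "S \<le> ?H X + ?H X"
      unfolding S_def by (intro suminf_le_const pair) auto
    then have Sfin: "S \<noteq> top" using fin by (auto simp: top_unique)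
    \<comment> \<open>The partial sum is kept on the left instead of subtracting a tail on the
      right: in \<open>ennreal\<close> the finite \<open>S\<close> can be cancelled once, after the
      limit.\<close>
    have "?H (C \<inter> X) + ?H (X - C) + (\<Sum>k<n. ?H (R k)) \<le> ?H X + S" for n
    proof -
      have "X - C \<subseteq> N n \<union> (\<Union>k. R (k + n))"
      proof
        fix x assume x: "x \<in> X - C"
        then have pos: "0 < f x"
          using \<open>closed C\<close> False by (simp add: f_def infdist_pos_not_in_closed)
        show "x \<in> N n \<union> (\<Union>k. R (k + n))"
        proof (cases "x \<in> N n")
          case nN: False
          \<comment> \<open>The least index identifies the shell: minimality gives the strict upper
            bound in \<open>R\<close>, and \<open>x\<close> outside \<open>N n\<close> forces the
            index beyond \<open>n\<close>.\<close>
          define k where "k = (LEAST k. 1 / (real k + 1) \<le> f x)"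
          have ex: "\<exists>k::nat. 1 / (real k + 1) \<le> f x"
            using pos by (metis add.commute less_eq_real_def nat_approx_posE of_nat_Suc)
          have k: "1 / (real k + 1) \<le> f x" unfolding k_def using ex by (rule LeastI_ex)
          have lt: "\<not> 1 / (real j + 1) \<le> f x" if "j < k" for j
            using that not_less_Least unfolding k_def by blast
          have "n < k"
          proof (rule ccontr)
            assume "\<not> n < k"
            then have "1 / (real n + 1) \<le> 1 / (real k + 1)" by (simp add: field_simps)
            then show False using k nN x by (simp add: N_def)
          qed
          then obtain j where j: "k = Suc (j + n)"
            by (metis add.commute less_iff_Suc_add)
          have "x \<in> R (j + n)"
            using k lt[of "j + n"] x by (simp add: R_def j algebra_simps)
          then show ?thesis by blast
        qed simp
      qed
      then have "?H (X - C) \<le> ?H (N n) + ?H (\<Union>k. R (k + n))"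
        using hausdorff_outer_mono hausdorff_outer_Un_le order_trans by metis
      also have "\<dots> \<le> ?H (N n) + (\<Sum>k. ?H (R (k + n)))"
        by (intro add_left_mono hausdorff_outer_UN_le)
      finally have "?H (C \<inter> X) + ?H (X - C) + (\<Sum>k<n. ?H (R k))
          \<le> (?H (C \<inter> X) + ?H (N n)) + ((\<Sum>k. ?H (R (k + n))) + (\<Sum>k<n. ?H (R k)))"
        by (metis add_left_mono add_right_mono add.assoc)
      also have "?H (C \<inter> X) + ?H (N n) = ?H ((C \<inter> X) \<union> N n)"
      proof (rule hausdorff_outer_separated[symmetric])
        fix a b assume ab: "a \<in> C \<inter> X" "b \<in> N n"
        then have "f a = 0" by (simp add: f_def)
        then show "1 / (real n + 1) \<le> dist a b" using ab lip[of a b] unfolding N_def by force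
      qed auto
      also have "\<dots> \<le> ?H X" by (intro hausdorff_outer_mono) (auto simp: N_def)
      also have "(\<Sum>k. ?H (R (k + n))) + (\<Sum>k<n. ?H (R k)) = S"
        unfolding S_def using suminf_offset[of "\<lambda>k. ?H (R k)" n] by (simp add: add.commute)
      finally show ?thesis by (simp add: add_right_mono)
    qed
    then have "(SUP n. ?H (C \<inter> X) + ?H (X - C) + (\<Sum>k<n. ?H (R k))) \<le> ?H X + S"
      by (intro SUP_least) auto
    then have "?H (C \<inter> X) + ?H (X - C) + S \<le> ?H X + S"
      by (simp add: ennreal_SUP_add_right S_def suminf_eq_SUP)
    then show ?thesis using Sfin
      by (simp add: add.commute[of _ S] ennreal_add_left_cancel_le)
  qed
  moreover have "hausdorff_outer s X \<le> hausdorff_outer s (C \<inter> X) + hausdorff_outer s (X - C)" for X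
    by (rule order_trans[OF _ hausdorff_outer_Un_le]) (auto intro!: hausdorff_outer_mono)
  ultimately have "hausdorff_outer s (C \<inter> X) + hausdorff_outer s (X - C) = hausdorff_outer s X" for X
    by (rule antisym)
  then show ?thesis
    by (simp add: lambda_system_def Diff_eq Int_commute)
qed

text \<open>The measurable sets in Caratheodory's sense form a sigma-algebra on which the outer
  measure is a measure; containing the closed sets, it contains all Borel sets. Only then does
  \<open>measure_of\<close> return its set function.\<close>

lemma emeasure_hausdorff_measure:
  fixes A :: "'a::metric_space set"
  assumes "A \<in> sets borel"
  shows "emeasure (hausdorff_measure s) A = hausdorff_outer s A"
proof -
  interpret sigma_algebra "UNIV :: 'a set" UNIV
    using sigma_algebra_Pow[of "UNIV :: 'a set"] by simp
  let ?L = "lambda_system UNIV UNIV (hausdorff_outer s) :: 'a set set"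
  have L: "measure_space UNIV ?L (hausdorff_outer s)"
    by (rule caratheodory_lemma[OF outer_measure_space_hausdorff])
  then interpret L: sigma_algebra UNIV ?L by (simp add: measure_space_def)
  have "sigma_sets UNIV (Collect closed) \<subseteq> ?L"
    by (rule L.sigma_sets_subset) (auto intro: closed_in_lambda_system_hausdorff)
  then have sub: "sets (borel :: 'a measure) \<subseteq> ?L"
    by (simp add: borel_eq_closed)
  have "sigma_algebra UNIV (sets (borel :: 'a measure))"
    using sets.sigma_algebra_axioms[of "borel :: 'a measure"] by simp
  then have "measure_space UNIV (sets borel) (hausdorff_outer s :: 'a set \<Rightarrow> ennreal)"
    using measure_down[OF L _ sub] by blast
  then show ?thesis
    unfolding hausdorff_measure_def using assms
    by (intro emeasure_measure_of_sigma) (auto simp: measure_space_def)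
qed

lemma sets_hausdorff_measure [simp, measurable_cong]: "sets (hausdorff_measure s) = sets borel"
  unfolding hausdorff_measure_def
  by (metis UNIV_I borel_comp sets.sigma_sets_eq sets_measure_of space_borel subset_UNIV top_greatest PowI subsetI)

lemma space_hausdorff_measure [simp]: "space (hausdorff_measure s) = UNIV"
  by (simp add: hausdorff_measure_def space_measure_of_conv)

section \<open>Surface measure of the frontier\<close>

text \<open>Covers are sequences, so a finite one is padded with empty sets, which count 0 even for
  \<open>s = 0\<close>. The family and the radius may depend on \<delta>, the bound \<open>c\<close>
  may not.\<close>

lemma hausdorff_outer_le_finite_covers:
  assumes "\<And>\<delta>. 0 < \<delta> \<Longrightarrow> \<exists>(I :: 'i set) W r. finite I \<and> A \<subseteq> (\<Union>k\<in>I. W k) \<and>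
      (\<forall>k\<in>I. bounded (W k) \<and> diameter (W k) \<le> r) \<and> r \<le> \<delta> \<and>
      real (card I) * (unit_ball_vol (real s) * (r / 2) ^ s) \<le> c"
  shows "hausdorff_outer s (A :: 'a::metric_space set) \<le> ennreal c"
  unfolding hausdorff_outer_eq_SUP_content
proof (rule SUP_least)
  fix \<delta> :: real assume "\<delta> \<in> {0<..}"
  then have \<delta>: "0 < \<delta>" by simp
  from assms[OF \<delta>] obtain I :: "'i set" and W r where W: "finite I" "A \<subseteq> (\<Union>k\<in>I. W k)"
    "\<And>k. k \<in> I \<Longrightarrow> bounded (W k)" "\<And>k. k \<in> I \<Longrightarrow> diameter (W k) \<le> r" "r \<le> \<delta>"
    "real (card I) * (unit_ball_vol (real s) * (r / 2) ^ s) \<le> c" by blast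
  obtain f where f: "bij_betw f {..<card I} I"
    using ex_bij_betw_nat_finite[OF W(1)] by (auto simp: atLeast0LessThan)
  define U where "U = (\<lambda>n. if n < card I then W (f n) else {})"
  have fI: "f n \<in> I" if "n < card I" for n
    using bij_betwE[OF f] that by auto
  have "A \<subseteq> (\<Union>n. U n)"
  proof
    fix x assume "x \<in> A"
    then obtain k where "k \<in> I" "x \<in> W k" using W(2) by blast
    moreover then obtain n where "n < card I" "f n = k"
      using f unfolding bij_betw_def by force
    ultimately have "x \<in> U n" by (simp add: U_def)
    then show "x \<in> (\<Union>n. U n)" by blast
  qed
  then have "hausdorff_content s \<delta> A \<le> (\<Sum>n. hausdorff_weight s (U n))"
    by (rule hausdorff_content_le) (use W fI \<delta> in \<open>auto simp: U_def intro: order_trans[OF W(4) W(5)]\<close>)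
  also have "\<dots> = (\<Sum>n<card I. hausdorff_weight s (U n))"
    by (rule suminf_finite) (auto simp: U_def)
  also have "\<dots> \<le> (\<Sum>n<card I. ennreal (unit_ball_vol (real s) * (r / 2) ^ s))"
  proof (rule sum_mono)
    fix n assume "n \<in> {..<card I}"
    then have "bounded (U n)" "diameter (U n) \<le> r" using W fI by (auto simp: U_def)
    then show "hausdorff_weight s (U n) \<le> ennreal (unit_ball_vol (real s) * (r / 2) ^ s)"
      unfolding hausdorff_weight_def
      by (auto intro!: ennreal_leI mult_left_mono power_mono diameter_ge_0)
  qed
  \<comment> \<open>An empty \<open>I\<close> says nothing about the sign of \<open>r\<close>; a
    nonempty one makes \<open>r\<close> nonnegative, since it bounds a diameter.\<close>
  also have "\<dots> = ennreal (real (card I) * (unit_ball_vol (real s) * (r / 2) ^ s))"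
  proof (cases "card I = 0")
    case False
    then have "I \<noteq> {}" by auto
    then have "0 \<le> r" using W(3,4) diameter_ge_0 order_trans by blast
    then show ?thesis by (simp add: ennreal_mult ennreal_of_nat_eq_real_of_nat)
  qed simp
  also have "\<dots> \<le> ennreal c" using W(6) by (rule ennreal_leI)
  finally show "hausdorff_content s \<delta> A \<le> ennreal c" .
qed

text \<open>The shadow of the graph in the hyperplane is cut by a grid of side \<open>1 / n\<close>.
  There are of the order of \<open>n ^ ?s\<close> pieces, each of diameter at most
  \<open>C / n\<close>, so the total weight stays bounded as \<open>n\<close> grows.\<close>

lemma hausdorff_outer_lipschitz_graph_finite:
  fixes A :: "(real ^ 'd) set"
  assumes "bounded A" and e: "norm e = 1" and lip: "L-lipschitz_on {z. z \<bullet> e = 0} \<phi>"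
    and graph: "\<And>y. y \<in> A \<Longrightarrow> \<phi> (y - (y \<bullet> e) *\<^sub>R e) = y \<bullet> e"
  shows "hausdorff_outer (CARD('d) - 1) A < top"
proof -
  let ?s = "CARD('d) - 1"
  define i :: 'd where "i = undefined"
  \<comment> \<open>Turning \<open>e\<close> into a coordinate axis makes the \<open>i\<close>-th
    coordinate of the shadow vanish, so only the other \<open>CARD('d) - 1\<close> coordinates need
    a grid.\<close>
  obtain f where f: "orthogonal_transformation f" "f e = axis i (1::real)"
    using orthogonal_transformation_exists[of e "axis i (1::real)"] e by auto
  have linf: "linear f" using f(1) by (simp add: orthogonal_transformation_def)
  define P where "P y = y - (y \<bullet> e) *\<^sub>R e" for y
  have Pe: "P y \<bullet> e = 0" for y
    using e by (simp add: P_def inner_diff_left norm_eq_1)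
  define g where "g y = f (P y)" for y
  have gi: "g y $ i = 0" for y
    using f Pe[of y] by (metis cart_eq_inner_axis g_def orthogonal_transformation_def)
  have norm_g: "norm (g y - g y') = norm (P y - P y')" for y y'
    using f(1) linf by (metis g_def linear_diff orthogonal_transformation_norm)
  obtain B where B: "0 < B" "\<And>y. y \<in> A \<Longrightarrow> norm y \<le> B"
    using \<open>bounded A\<close> by (auto simp: bounded_pos)
  define b where "b = 2 * B"
  have gb: "\<bar>g y $ j\<bar> \<le> b" if "y \<in> A" for y j
  proof -
    have "\<bar>g y $ j\<bar> \<le> norm (g y)" by (rule component_le_norm_cart)
    also have "\<dots> = norm (P y)" using f(1) by (simp add: g_def orthogonal_transformation_norm)
    also have "\<dots> \<le> norm y + \<bar>y \<bullet> e\<bar>" unfolding P_def using norm_triangle_ineq4[of y "(y \<bullet> e) *\<^sub>R e"] e by simp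
    also have "\<dots> \<le> norm y + norm y" using Cauchy_Schwarz_ineq2[of y e] e by simp
    also have "\<dots> \<le> b" using B(2)[OF that] by (simp add: b_def)
    finally show ?thesis .
  qed
  have "0 \<le> L" using lip lipschitz_on_nonneg by blast
  \<comment> \<open>Shadows in one grid cell differ by at most \<open>CARD('d) / n\<close>, the sum
    of the coordinate differences; the Lipschitz height brings in the factor
    \<open>1 + L\<close>.\<close>
  define C where "C = (1 + L) * real CARD('d)"
  have "0 < C" using \<open>0 \<le> L\<close> by (simp add: C_def)
  have "hausdorff_outer ?s A \<le> ennreal (unit_ball_vol (real ?s) * ((2 * b + 1) * C / 2) ^ ?s)"
  proof (rule hausdorff_outer_le_finite_covers)
    fix \<delta> :: real assume "0 < \<delta>"
    obtain n :: nat where n0: "C / \<delta> < real n" using reals_Archimedean2 by blast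
    have "0 < C / \<delta>" using \<open>0 < C\<close> \<open>0 < \<delta>\<close> by simp
    then have n: "0 < real n" using n0 by linarith
    \<comment> \<open>The shifted coordinates \<open>g y $ j + b\<close> lie in
      \<open>[0, 2 * b]\<close>; the added 1 admits the floor belonging to the right end
      point.\<close>
    define m where "m = nat \<lfloor>2 * b * real n\<rfloor> + 1"
    define I where "I = (\<Pi>\<^sub>E j\<in>UNIV - {i}. {..<m})"
    define W where "W k = {y\<in>A. \<forall>j\<in>UNIV - {i}. nat \<lfloor>(g y $ j + b) * real n\<rfloor> = k j}" for k
    have "finite I" unfolding I_def by (intro finite_PiE) auto
    have cardI: "card I = m ^ ?s" unfolding I_def by (simp add: card_PiE)
    have cover: "A \<subseteq> (\<Union>k\<in>I. W k)"
    proof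
      fix y assume y: "y \<in> A"
      have "(g y $ j + b) * real n \<le> 2 * b * real n" for j
        using gb[OF y, of j] n by (intro mult_right_mono) auto
      then have "nat \<lfloor>(g y $ j + b) * real n\<rfloor> \<le> nat \<lfloor>2 * b * real n\<rfloor>" for j
        by (intro nat_mono floor_mono)
      then have "nat \<lfloor>(g y $ j + b) * real n\<rfloor> < m" for j by (simp add: m_def less_Suc_eq_le)
      then have "restrict (\<lambda>j. nat \<lfloor>(g y $ j + b) * real n\<rfloor>) (UNIV - {i}) \<in> I"
        "y \<in> W (restrict (\<lambda>j. nat \<lfloor>(g y $ j + b) * real n\<rfloor>) (UNIV - {i}))"
        using y by (auto simp: I_def W_def)
      then show "y \<in> (\<Union>k\<in>I. W k)" by blast
    qed
    have diam: "diameter (W k) \<le> C / real n" for k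
    proof (rule diameter_le)
      show "W k \<noteq> {} \<or> 0 \<le> C / real n" using \<open>0 < C\<close> n by simp
      fix y y' assume y: "y \<in> W k" "y' \<in> W k"
      have comp: "\<bar>(g y - g y') $ j\<bar> \<le> 1 / real n" for j
      proof (cases "j = i")
        case False
        have yA: "y \<in> A" "y' \<in> A" using y by (auto simp: W_def)
        have "nat \<lfloor>(g y $ j + b) * real n\<rfloor> = nat \<lfloor>(g y' $ j + b) * real n\<rfloor>"
          using y False by (auto simp: W_def)
        moreover have "0 \<le> (g y $ j + b) * real n" "0 \<le> (g y' $ j + b) * real n"
          using gb[OF yA(1), of j] gb[OF yA(2), of j] n by auto
        ultimately have "\<lfloor>(g y $ j + b) * real n\<rfloor> = \<lfloor>(g y' $ j + b) * real n\<rfloor>"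
          by (simp add: eq_nat_nat_iff)
        then have "\<bar>(g y $ j + b) * real n - (g y' $ j + b) * real n\<bar> \<le> 1" by linarith
        also have "(g y $ j + b) * real n - (g y' $ j + b) * real n = (g y - g y') $ j * real n"
          by (simp add: algebra_simps)
        finally have "\<bar>(g y - g y') $ j\<bar> * real n \<le> 1" by (simp only: abs_mult abs_of_nat)
        then show ?thesis using n by (simp add: pos_le_divide_eq)
      qed (simp add: gi)
      have "norm (P y - P y') \<le> (\<Sum>j\<in>UNIV. \<bar>(g y - g y') $ j\<bar>)"
        unfolding norm_g[symmetric] by (rule norm_le_l1_cart)
      also have "\<dots> \<le> (\<Sum>j\<in>(UNIV :: 'd set). 1 / real n)" by (intro sum_mono comp)
      finally have nP: "norm (P y - P y') \<le> real CARD('d) / real n" by simp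
      have "y \<bullet> e = \<phi> (P y)" "y' \<bullet> e = \<phi> (P y')" using y graph by (auto simp: W_def P_def)
      then have "y - y' = (P y - P y') + (\<phi> (P y) - \<phi> (P y')) *\<^sub>R e"
        by (simp add: P_def algebra_simps)
      then have "norm (y - y') \<le> norm (P y - P y') + \<bar>\<phi> (P y) - \<phi> (P y')\<bar>"
        using norm_triangle_ineq[of "P y - P y'" "(\<phi> (P y) - \<phi> (P y')) *\<^sub>R e"] e by simp
      also have "\<bar>\<phi> (P y) - \<phi> (P y')\<bar> \<le> L * norm (P y - P y')"
        using lipschitz_onD[OF lip, of "P y" "P y'"] Pe by (simp add: dist_norm)
      also have "norm (P y - P y') + L * norm (P y - P y') = (1 + L) * norm (P y - P y')"
        by (simp add: algebra_simps)
      also have "\<dots> \<le> (1 + L) * (real CARD('d) / real n)"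
        using nP \<open>0 \<le> L\<close> by (intro mult_left_mono) auto
      finally show "norm (y - y') \<le> C / real n" by (simp add: C_def)
    qed
    have "real (card I) * (unit_ball_vol (real ?s) * (C / real n / 2) ^ ?s)
        = unit_ball_vol (real ?s) * (real m * (C / real n / 2)) ^ ?s"
      unfolding cardI power_mult_distrib by (simp add: mult.left_commute)
    also have "\<dots> \<le> unit_ball_vol (real ?s) * ((2 * b + 1) * C / 2) ^ ?s"
    proof (intro mult_left_mono power_mono)
      have "0 \<le> 2 * b * real n" using B by (simp add: b_def)
      then have "real m \<le> 2 * b * real n + 1" unfolding m_def by linarith
      \<comment> \<open>Absorbs the extra grid interval:
        \<open>2 * b * n + 1 \<le> (2 * b + 1) * n\<close>.\<close>
      moreover have "1 \<le> real n" using n by simp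
      ultimately have "real m \<le> (2 * b + 1) * real n" by (simp add: algebra_simps)
      then have "real m * (C / real n / 2) \<le> ((2 * b + 1) * real n) * (C / real n / 2)"
        using \<open>0 < C\<close> by (intro mult_right_mono) auto
      then show "real m * (C / real n / 2) \<le> (2 * b + 1) * C / 2" using n by (simp add: field_simps)
      show "0 \<le> real m * (C / real n / 2)" using \<open>0 < C\<close> by simp
    qed auto
    finally have bound: "real (card I) * (unit_ball_vol (real ?s) * (C / real n / 2) ^ ?s)
      \<le> unit_ball_vol (real ?s) * ((2 * b + 1) * C / 2) ^ ?s" .
    have "C / real n \<le> \<delta>" using n0 n \<open>0 < \<delta>\<close> by (simp add: field_simps)
    moreover have "bounded (W k)" for k
      by (rule bounded_subset[OF \<open>bounded A\<close>]) (auto simp: W_def)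
    ultimately show "\<exists>(I :: ('d \<Rightarrow> nat) set) W r. finite I \<and> A \<subseteq> (\<Union>k\<in>I. W k) \<and>
      (\<forall>k\<in>I. bounded (W k) \<and> diameter (W k) \<le> r) \<and> r \<le> \<delta> \<and>
      real (card I) * (unit_ball_vol (real ?s) * (r / 2) ^ ?s)
        \<le> unit_ball_vol (real ?s) * ((2 * b + 1) * C / 2) ^ ?s"
      using \<open>finite I\<close> cover diam bound by blast
  qed
  then show ?thesis using order_le_less_trans by fastforce
qed

text \<open>A flat set is the graph of a constant. This is what bounds the measure of the faces that
  carry the ghost penalty.\<close>

lemma emeasure_surf_hyperplane_finite:
  fixes A :: "(real ^ 'd) set"
  assumes "bounded A" "A \<in> sets borel" "\<And>y. y \<in> A \<Longrightarrow> y $ i = a"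
  shows "emeasure surf A < top"
  unfolding emeasure_hausdorff_measure[OF assms(2)]
proof (rule hausdorff_outer_lipschitz_graph_finite[OF assms(1)])
  show "norm (axis i (1::real)) = 1" by simp
  show "0-lipschitz_on {z. z \<bullet> axis i (1::real) = 0} (\<lambda>_. a)" by (rule lipschitz_on_constant)
qed (simp add: assms(3) inner_axis)

text \<open>The height above the graph is continuous, so points strictly above are interior to
  \<Omega> and points strictly below are exterior to it; a frontier point is neither.\<close>

lemma frontier_of_epigraph_subset_graph:
  fixes \<Omega> :: "(real ^ 'd) set"
  assumes "norm e = 1" "L-lipschitz_on {z. z \<bullet> e = 0} \<phi>"
    and epi: "\<forall>y\<in>ball x r. y \<in> \<Omega> \<longleftrightarrow> \<phi> (y - (y \<bullet> e) *\<^sub>R e) < y \<bullet> e"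
    and y: "y \<in> frontier \<Omega> \<inter> ball x r"
  shows "\<phi> (y - (y \<bullet> e) *\<^sub>R e) = y \<bullet> e"
proof -
  define F where "F = (\<lambda>y. y \<bullet> e - \<phi> (y - (y \<bullet> e) *\<^sub>R e))"
  have cF: "continuous_on UNIV F"
  proof -
    have "continuous_on UNIV (\<lambda>y. \<phi> (y - (y \<bullet> e) *\<^sub>R e))"
      by (rule continuous_on_compose2[OF lipschitz_on_continuous_on[OF assms(2)]])
         (use assms(1) in \<open>force simp: inner_diff_left norm_eq_1 intro!: continuous_intros\<close>)+
    then show ?thesis unfolding F_def by (intro continuous_intros)
  qed
  have open_gt: "open (ball x r \<inter> {y. 0 < F y})" "open (ball x r \<inter> {y. F y < 0})"
    using open_Collect_less[OF continuous_on_const cF] open_Collect_less[OF cF continuous_on_const]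
    by auto
  have yc: "y \<in> closure \<Omega>" "y \<notin> interior \<Omega>" using y by (auto simp: frontier_def)
  have "\<not> 0 < F y"
  proof
    assume "0 < F y"
    then have "y \<in> ball x r \<inter> {y. 0 < F y}" using y by simp
    moreover have "ball x r \<inter> {y. 0 < F y} \<subseteq> \<Omega>"
      using epi unfolding F_def by fastforce
    ultimately show False using yc(2) interior_maximal[OF _ open_gt(1)] by blast
  qed
  moreover have "\<not> F y < 0"
  proof
    assume "F y < 0"
    then have "y \<in> ball x r \<inter> {y. F y < 0}" using y by simp
    moreover have "(ball x r \<inter> {y. F y < 0}) \<inter> \<Omega> = {}"
      using epi unfolding F_def by fastforce
    then have "(ball x r \<inter> {y. F y < 0}) \<inter> closure \<Omega> = {}"
      using open_Int_closure_eq_empty[OF open_gt(2)] by simp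
    ultimately show False using yc(1) by blast
  qed
  ultimately show ?thesis by (simp add: F_def)
qed

lemma emeasure_surf_frontier_finite:
  fixes \<Omega> :: "(real ^ 'd) set"
  assumes "lipschitz_domain \<Omega>"
  shows "emeasure surf (frontier \<Omega>) < top"
proof -
  have "\<exists>r>0. emeasure surf (frontier \<Omega> \<inter> ball x r) < top" if "x \<in> frontier \<Omega>" for x
  proof -
    obtain e r L and \<phi> :: "real ^ 'd \<Rightarrow> real" where *:
      "norm e = 1" "r > 0" "L-lipschitz_on {z. z \<bullet> e = 0} \<phi>"
      "\<forall>y\<in>ball x r. y \<in> \<Omega> \<longleftrightarrow> \<phi> (y - (y \<bullet> e) *\<^sub>R e) < y \<bullet> e"
      using assms \<open>x \<in> frontier \<Omega>\<close> unfolding lipschitz_domain_def by blast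
    have "frontier \<Omega> \<inter> ball x r \<in> sets borel" by auto
    moreover have "hausdorff_outer (CARD('d) - 1) (frontier \<Omega> \<inter> ball x r) < top"
      using frontier_of_epigraph_subset_graph[OF *(1,3,4)] *
      by (intro hausdorff_outer_lipschitz_graph_finite) (auto intro: bounded_subset[OF bounded_ball])
    ultimately show ?thesis using *(2) emeasure_hausdorff_measure by metis
  qed
  then obtain r where r: "\<And>x. x \<in> frontier \<Omega> \<Longrightarrow> 0 < r x"
    "\<And>x. x \<in> frontier \<Omega> \<Longrightarrow> emeasure surf (frontier \<Omega> \<inter> ball x (r x)) < top" by metis
  have "compact (frontier \<Omega>)" using assms by (auto simp: lipschitz_domain_def)
  then obtain K where K: "K \<subseteq> frontier \<Omega>" "finite K" "frontier \<Omega> \<subseteq> (\<Union>x\<in>K. ball x (r x))"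
    by (rule compactE_image[where f="\<lambda>x. ball x (r x)" and C="frontier \<Omega>"]) (use r(1) in force)+
  have "emeasure surf (frontier \<Omega>) \<le> emeasure surf (\<Union>x\<in>K. frontier \<Omega> \<inter> ball x (r x))"
    using K(3) by (intro emeasure_mono sets.finite_UN K(2)) auto
  also have "\<dots> \<le> (\<Sum>x\<in>K. emeasure surf (frontier \<Omega> \<inter> ball x (r x)))"
    using K by (intro emeasure_subadditive_finite) auto
  also have "\<dots> < top" using K r(2) by (auto simp: less_top[symmetric] intro!: ennreal_sum_less_top)
  finally show ?thesis .
qed

text \<open>
  Every line in direction \<open>i\<close> through a small box in \<open>\<Omega>\<close> meets the frontier, so a cover of the
  frontier yields a cover of the box by slabs in direction \<open>i\<close> of comparable volume.
\<close>

lemma emeasure_surf_frontier_pos: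
  fixes \<Omega> :: "(real ^ 'd) set"
  assumes "open \<Omega>" "bounded \<Omega>" "\<Omega> \<noteq> {}"
  shows "0 < emeasure surf (frontier \<Omega>)"
proof -
  let ?s = "CARD('d) - 1"
  define i :: 'd where "i = undefined"
  obtain x0 where "x0 \<in> \<Omega>" using assms by blast
  then obtain a b where ab: "x0 \<in> box a b" "cbox a b \<subseteq> \<Omega>"
    using open_contains_cbox[of \<Omega>] assms(1) by (metis openE)
  have lt: "a $ j < b $ j" for j using ab(1) by (auto simp: mem_box_cart intro: less_trans)
  obtain B where B: "\<And>y. y \<in> \<Omega> \<Longrightarrow> norm y \<le> B" using assms(2) by (auto simp: bounded_iff)
  have hit: "\<exists>z\<in>frontier \<Omega>. \<forall>j. j \<noteq> i \<longrightarrow> z $ j = y $ j" if "y \<in> cbox a b" for y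
  proof -
    define T where "T = (\<lambda>t. y + t *\<^sub>R axis i (1::real)) ` {0..}"
    have "connected T" unfolding T_def
      by (intro connected_continuous_image continuous_intros) auto
    moreover have "y \<in> T \<inter> \<Omega>" using that ab(2) by (auto simp: T_def image_iff intro: bexI[of _ 0])
    \<comment> \<open>Here the ray has left \<Omega>: as \<open>norm y \<le> B\<close>, the norm is
      at least \<open>2 * \<bar>B\<bar> + 1 - B\<close>, which exceeds \<open>B\<close>.\<close>
    moreover have "y + (2 * \<bar>B\<bar> + 1) *\<^sub>R axis i 1 \<notin> \<Omega>"
    proof
      assume "y + (2 * \<bar>B\<bar> + 1) *\<^sub>R axis i 1 \<in> \<Omega>"
      then have "norm (y + (2 * \<bar>B\<bar> + 1) *\<^sub>R axis i 1) \<le> B" by (rule B)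
      moreover have "norm y \<le> B" using that ab(2) B by blast
      moreover have "norm ((2 * \<bar>B\<bar> + 1) *\<^sub>R axis i (1::real) :: real ^ 'd) = 2 * \<bar>B\<bar> + 1" by simp
      ultimately show False
        using norm_triangle_ineq2[of "(2 * \<bar>B\<bar> + 1) *\<^sub>R axis i (1::real)" "- y"] by (simp add: add.commute)
    qed
    moreover have "y + (2 * \<bar>B\<bar> + 1) *\<^sub>R axis i 1 \<in> T" by (auto simp: T_def)
    ultimately have "T \<inter> frontier \<Omega> \<noteq> {}" by (intro connected_Int_frontier) auto
    then obtain t where "y + t *\<^sub>R axis i 1 \<in> frontier \<Omega>" by (auto simp: T_def)
    moreover have "(y + t *\<^sub>R axis i 1) $ j = y $ j" if "j \<noteq> i" for j
      using that by (simp add: axis_def)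
    ultimately show ?thesis by blast
  qed
  define v where "v = (\<Prod>j\<in>UNIV. b $ j - a $ j)"
  have "0 < v" unfolding v_def using lt by (intro prod_pos) auto
  \<comment> \<open>Ratio of the volume of a slab to the weight of its covering set: half-width
    \<delta> gives the cross-section
    \<open>(2 * \<delta>) ^ ?s = 4 ^ ?s * (\<delta> / 2) ^ ?s\<close>, and the length in direction
    \<open>i\<close> is \<open>b $ i - a $ i\<close>.\<close>
  define K where "K = (b $ i - a $ i) * 4 ^ ?s / unit_ball_vol (real ?s)"
  have ubv: "0 < unit_ball_vol (real ?s)" by simp
  have "0 < K" unfolding K_def using lt[of i] ubv by simp
  have content: "emeasure lborel (cbox c d) = ennreal (\<Prod>j\<in>UNIV. d $ j - c $ j)" if "\<And>j. c $ j \<le> d $ j" for c d :: "real ^ 'd"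
  proof -
    have "cbox c d \<noteq> {}" using that by (simp add: interval_ne_empty_cart)
    then show ?thesis
      using content_cbox_cart[of c d] emeasure_eq_ennreal_measure[of lborel "cbox c d"]
        emeasure_lborel_cbox_finite[of c d] by simp
  qed
  \<comment> \<open>The single scale 1 suffices, since the outer measure dominates the content at
    every scale.\<close>
  have "ennreal (v / K) \<le> hausdorff_content ?s 1 (frontier \<Omega>)"
  proof (rule hausdorff_content_geI)
    fix U :: "nat \<Rightarrow> (real ^ 'd) set"
    assume U: "frontier \<Omega> \<subseteq> (\<Union>n. U n)" "\<And>n. bounded (U n)" "\<And>n. diameter (U n) \<le> 1"
    define x where "x n = (SOME x. x \<in> U n)" for n
    \<comment> \<open>The slab spans the whole box in direction \<open>i\<close> and is otherwise
      centred at an arbitrary point of \<open>U n\<close>. For empty \<open>U n\<close> that point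
      is meaningless, and the volume has to be 0 to match the weight.\<close>
    define Z where "Z n = (if U n = {} then {} else
      cbox (\<chi> j. if j = i then a $ i else x n $ j - diameter (U n))
           (\<chi> j. if j = i then b $ i else x n $ j + diameter (U n)))" for n
    have cover: "cbox a b \<subseteq> (\<Union>n. Z n)"
    proof
      fix y assume y: "y \<in> cbox a b"
      obtain z where z: "z \<in> frontier \<Omega>" "\<And>j. j \<noteq> i \<Longrightarrow> z $ j = y $ j" using hit[OF y] by blast
      then obtain n where n: "z \<in> U n" using U(1) by blast
      then have "x n \<in> U n" unfolding x_def by (rule someI)
      then have "dist z (x n) \<le> diameter (U n)"
        using diameter_bounded_bound[OF U(2)] n by blast
      then have "\<bar>z $ j - x n $ j\<bar> \<le> diameter (U n)" for j
        using component_le_norm_cart[of "z - x n" j] by (simp add: dist_norm)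
      then have near: "\<bar>y $ j - x n $ j\<bar> \<le> diameter (U n)" if "j \<noteq> i" for j using z(2)[OF that] by metis
      have "x n $ j - diameter (U n) \<le> y $ j \<and> y $ j \<le> x n $ j + diameter (U n)" if "j \<noteq> i" for j
        using near[OF that] by linarith
      then have "y \<in> Z n" using n y by (auto simp: Z_def mem_box_cart)
      then show "y \<in> (\<Union>n. Z n)" by blast
    qed
    have vol: "emeasure lborel (Z n) = ennreal K * hausdorff_weight ?s (U n)" for n
    proof (cases "U n = {}")
      case False
      define \<delta> where "\<delta> = diameter (U n)"
      have "0 \<le> \<delta>" unfolding \<delta>_def by (rule diameter_ge_0[OF U(2)])
      have "emeasure lborel (Z n) = ennreal (\<Prod>j\<in>UNIV. (if j = i then b $ i else x n $ j + \<delta>) - (if j = i then a $ i else x n $ j - \<delta>))"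
        using False lt[of i] \<open>0 \<le> \<delta>\<close> unfolding \<delta>_def by (simp add: Z_def content)
      also have "(\<Prod>j\<in>UNIV. (if j = i then b $ i else x n $ j + \<delta>) - (if j = i then a $ i else x n $ j - \<delta>))
          = (\<Prod>j\<in>insert i (UNIV - {i}). if j = i then b $ i - a $ i else 2 * \<delta>)"
        by (intro prod.cong) auto
      also have "\<dots> = (b $ i - a $ i) * (\<Prod>j\<in>UNIV - {i}. 2 * \<delta>)"
        by (subst prod.insert) (auto intro!: prod.cong)
      also have "\<dots> = (b $ i - a $ i) * (2 * \<delta>) ^ ?s" by simp
      also have "\<dots> = (b $ i - a $ i) * 4 ^ ?s * (\<delta> / 2) ^ ?s"
      proof -
        have "(2 * \<delta>) ^ ?s = (4 * (\<delta> / 2)) ^ ?s" by simp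
        then show ?thesis by (simp only: power_mult_distrib mult.assoc)
      qed
      also have "\<dots> = K * (unit_ball_vol (real ?s) * (\<delta> / 2) ^ ?s)"
        using less_imp_neq[OF ubv] unfolding K_def by (metis (no_types, lifting) mult.assoc nonzero_eq_divide_eq times_divide_eq_left)
      finally show ?thesis
        using False \<open>0 < K\<close> by (simp add: hausdorff_weight_def \<delta>_def ennreal_mult')
    qed (simp add: Z_def)
    have "ennreal v = emeasure lborel (cbox a b)" using lt by (simp add: content v_def less_imp_le)
    also have "\<dots> \<le> emeasure lborel (\<Union>n. Z n)" by (intro emeasure_mono cover) (auto simp: Z_def)
    also have "\<dots> \<le> (\<Sum>n. emeasure lborel (Z n))"
      by (intro emeasure_subadditive_countably) (auto simp: Z_def)
    also have "\<dots> = ennreal K * (\<Sum>n. hausdorff_weight ?s (U n))" by (simp add: vol ennreal_suminf_cmult)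
    finally have "ennreal (1 / K) * ennreal v \<le> ennreal (1 / K) * (ennreal K * (\<Sum>n. hausdorff_weight ?s (U n)))"
      by (rule mult_left_mono) simp
    then show "ennreal (v / K) \<le> (\<Sum>n. hausdorff_weight ?s (U n))"
      using \<open>0 < K\<close> \<open>0 < v\<close>
      by (simp add: mult.assoc[symmetric, of "ennreal (1 / K)" "ennreal K"] ennreal_mult[symmetric])
  qed
  also have "\<dots> \<le> hausdorff_outer ?s (frontier \<Omega>)" by (rule hausdorff_content_le_outer) simp
  finally have "ennreal (v / K) \<le> emeasure surf (frontier \<Omega>)"
    by (simp add: emeasure_hausdorff_measure)
  moreover have "0 < ennreal (v / K)" using \<open>0 < v\<close> \<open>0 < K\<close> by simp
  ultimately show ?thesis by (rule less_le_trans[rotated])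
qed

section \<open>Polynomials on mesh cells\<close>

text \<open>Meant for the global polynomial that extends a function from a cell: differentiating on
  the whole space gives a polynomial again, so iterated derivatives meet no cell boundary.\<close>

definition dir_deriv :: "'a::euclidean_space \<Rightarrow> ('a \<Rightarrow> 'b::euclidean_space) \<Rightarrow> 'a \<Rightarrow> 'b" where
  "dir_deriv n q = (\<lambda>x. frechet_derivative q (at x) n)"

lemma polynomial_function_has_derivative:
  assumes "polynomial_function (q :: 'a::euclidean_space \<Rightarrow> 'b::euclidean_space)"
  shows "(q has_derivative (\<lambda>h. dir_deriv h q x)) (at x)"
  using differentiable_at_polynomial_function[OF assms, of x UNIV] frechet_derivative_works
  by (simp add: dir_deriv_def eta_contract_eq) blast

lemma real_polynomial_function_dir_deriv:
  fixes q :: "'a::euclidean_space \<Rightarrow> real"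
  assumes "real_polynomial_function q"
  shows "real_polynomial_function (dir_deriv n q)"
  using assms
proof (induction q rule: real_polynomial_function.induct)
  case (linear f)
  then have "dir_deriv n f = (\<lambda>_. f n)"
    using frechet_derivative_at[OF bounded_linear_imp_has_derivative] by (fastforce simp: dir_deriv_def)
  then show ?case by (simp add: real_polynomial_function.intros(2))
next
  case (const c)
  have "dir_deriv n (\<lambda>_::'a. c) = (\<lambda>_. 0)" by (simp add: dir_deriv_def fun_eq_iff)
  then show ?case by (simp add: real_polynomial_function.intros(2))
next
  case (add f g)
  have "dir_deriv n (\<lambda>x. f x + g x) = (\<lambda>x. dir_deriv n f x + dir_deriv n g x)"
  proof
    fix x
    have "((\<lambda>x. f x + g x) has_derivative (\<lambda>h. dir_deriv h f x + dir_deriv h g x)) (at x)"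
      using add by (intro has_derivative_add polynomial_function_has_derivative) (auto simp: real_polynomial_function_eq)
    from frechet_derivative_at[OF this]
    show "dir_deriv n (\<lambda>x. f x + g x) x = dir_deriv n f x + dir_deriv n g x"
      unfolding dir_deriv_def[of n "\<lambda>x. f x + g x"] by metis
  qed
  then show ?case using add by (simp add: real_polynomial_function.intros(3))
next
  case (mult f g)
  have "dir_deriv n (\<lambda>x. f x * g x) = (\<lambda>x. f x * dir_deriv n g x + dir_deriv n f x * g x)"
  proof
    fix x
    have "((\<lambda>x. f x * g x) has_derivative (\<lambda>h. f x * dir_deriv h g x + dir_deriv h f x * g x)) (at x)"
      using mult by (intro has_derivative_mult polynomial_function_has_derivative) (auto simp: real_polynomial_function_eq)
    from frechet_derivative_at[OF this]
    show "dir_deriv n (\<lambda>x. f x * g x) x = f x * dir_deriv n g x + dir_deriv n f x * g x"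
      unfolding dir_deriv_def[of n "\<lambda>x. f x * g x"] by metis
  qed
  then show ?case using mult by (simp add: real_polynomial_function.intros(3) real_polynomial_function.intros(4))
qed

lemma polynomial_function_dir_deriv:
  fixes q :: "'a::euclidean_space \<Rightarrow> 'b::euclidean_space"
  assumes "polynomial_function q"
  shows "polynomial_function (dir_deriv n q)"
  unfolding polynomial_function_iff_Basis_inner
proof
  fix b :: 'b assume "b \<in> Basis"
  have "dir_deriv n (\<lambda>x. q x \<bullet> b) = (\<lambda>x. dir_deriv n q x \<bullet> b)"
  proof
    fix x
    have "((\<lambda>x. q x \<bullet> b) has_derivative (\<lambda>h. dir_deriv h q x \<bullet> b)) (at x)"
      by (intro has_derivative_inner_left polynomial_function_has_derivative assms)
    from frechet_derivative_at[OF this]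
    show "dir_deriv n (\<lambda>x. q x \<bullet> b) x = dir_deriv n q x \<bullet> b"
      unfolding dir_deriv_def[of n "\<lambda>x. q x \<bullet> b"] by metis
  qed
  moreover have "real_polynomial_function (\<lambda>x. q x \<bullet> b)"
    using assms \<open>b \<in> Basis\<close> by (simp add: polynomial_function_iff_Basis_inner)
  ultimately show "real_polynomial_function (\<lambda>x. dir_deriv n q x \<bullet> b)"
    using real_polynomial_function_dir_deriv by metis
qed

lemma polynomial_function_dir_deriv_funpow:
  fixes q :: "'a::euclidean_space \<Rightarrow> 'b::euclidean_space"
  shows "polynomial_function q \<Longrightarrow> polynomial_function ((dir_deriv n ^^ k) q)"
  by (induction k) (auto intro: polynomial_function_dir_deriv)

text \<open>On the line from \<open>x0\<close> to \<open>x\<close> each component is a polynomial in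
  one variable. It has infinitely many zeros near parameter 0, so its coefficients vanish, and
  parameter 1 is the point \<open>x\<close>.\<close>

lemma polynomial_function_zero_on_open:
  fixes q :: "'a::euclidean_space \<Rightarrow> 'b::euclidean_space"
  assumes "polynomial_function q" "open S" "x0 \<in> S" and zero: "\<And>x. x \<in> S \<Longrightarrow> q x = 0"
  shows "q x = 0"
proof (rule euclidean_eqI)
  fix b :: 'b assume b: "b \<in> Basis"
  define r where "r t = q (x0 + t *\<^sub>R (x - x0)) \<bullet> b" for t :: real
  have "polynomial_function (\<lambda>t. x0 + t *\<^sub>R (x - x0))"
    by (intro polynomial_function_add polynomial_function_const polynomial_function_bounded_linear bounded_linear_scaleR_left)
  then have "polynomial_function (q \<circ> (\<lambda>t. x0 + t *\<^sub>R (x - x0)))"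
    by (rule polynomial_function_compose[OF _ assms(1)])
  then have "real_polynomial_function r"
    using b by (simp add: r_def[abs_def] polynomial_function_iff_Basis_inner o_def)
  then obtain a m where r: "r = (\<lambda>t. \<Sum>i\<le>m::nat. a i * t ^ i)"
    by (auto simp: real_polynomial_function_iff_sum)
  have "open ((\<lambda>t. x0 + t *\<^sub>R (x - x0)) -` S)"
    by (intro open_vimage assms(2) continuous_intros)
  moreover have "0 \<in> (\<lambda>t. x0 + t *\<^sub>R (x - x0)) -` S" using assms(3) by simp
  ultimately obtain d where d: "0 < d" "ball 0 d \<subseteq> (\<lambda>t. x0 + t *\<^sub>R (x - x0)) -` S"
    by (meson openE)
  have "(\<Sum>i\<le>m. a i * t ^ i) = 0" if "t \<in> {0<..<d}" for t
  proof -
    have "t \<in> ball 0 d" using that by (simp add: dist_norm)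
    then have "r t = 0" using d(2) zero by (auto simp: r_def)
    then show ?thesis by (simp add: r)
  qed
  then have "{0<..<d} \<subseteq> {t. (\<Sum>i\<le>m. a i * t ^ i) = 0}" by blast
  then have "infinite {t. (\<Sum>i\<le>m. a i * t ^ i) = 0}"
    using infinite_Ioo[OF d(1)] infinite_super by blast
  then have "\<forall>i\<le>m. a i = 0" by (simp add: polyfun_finite_roots)
  then have "r 1 = 0" by (simp add: r)
  then show "q x \<bullet> b = 0 \<bullet> b" by (simp add: r_def)
qed

text \<open>The vanishing derivative gives constancy on a ball inside \<open>S\<close>; the identity
  theorem carries it to points outside \<open>S\<close>.\<close>

lemma polynomial_function_constant_on_open:
  fixes q :: "'a::euclidean_space \<Rightarrow> 'b::euclidean_space"
  assumes q: "polynomial_function q" and S: "open S" "x0 \<in> S"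
    and zero: "\<And>x h. x \<in> S \<Longrightarrow> dir_deriv h q x = 0"
  shows "q x = q x0"
proof -
  obtain e where e: "0 < e" "ball x0 e \<subseteq> S" using S by (meson openE)
  have "(q has_derivative (\<lambda>h. 0)) (at y)" if "y \<in> ball x0 e" for y
    using polynomial_function_has_derivative[OF q, of y] zero that e by auto
  then have const: "q y - q x0 = 0" if "y \<in> ball x0 e" for y
    using has_derivative_zero_unique_connected[of "ball x0 e" q y x0] that e by auto
  have "polynomial_function (\<lambda>x. q x - q x0)" using q by auto
  then have "q x - q x0 = 0"
    by (rule polynomial_function_zero_on_open[OF _ open_ball[of x0 e] _ const, where ?x0.0 = x0]) (use e(1) in auto)
  then show ?thesis by simp
qed

section \<open>Transfer of cellwise derivatives to global polynomials\<close>

text \<open>Positive length in every direction makes derivatives within the box unique up to its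
  boundary, and makes the box the closure of its interior.\<close>

definition solid_box :: "(real ^ 'd) set \<Rightarrow> bool" where
  "solid_box T \<longleftrightarrow> (\<exists>a b. T = cbox a b \<and> (\<forall>i. a $ i < b $ i))"

lemma cartesian_mesh_solid_box: "cartesian_mesh \<T> \<Longrightarrow> T \<in> \<T> \<Longrightarrow> solid_box T"
  unfolding cartesian_mesh_def solid_box_def
  by (elim exE conjE, simp, elim exE conjE, intro exI conjI, assumption, simp)

lemma cartesian_mesh_finite:
  assumes "cartesian_mesh (\<T> :: (real ^ 'd) set set)" shows "finite \<T>"
proof -
  obtain g :: "'d \<Rightarrow> nat \<Rightarrow> real" and N :: "'d \<Rightarrow> nat" where
    T: "\<T> = {cbox (\<chi> i. g i (k i)) (\<chi> i. g i (Suc (k i))) | k. \<forall>i. k i < N i}"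
    using assms unfolding cartesian_mesh_def by blast
  have "finite (\<Pi>\<^sub>E i\<in>UNIV. {..<N i})" by (intro finite_PiE) auto
  moreover have "\<T> \<subseteq> (\<lambda>k. cbox (\<chi> i. g i (k i)) (\<chi> i. g i (Suc (k i)))) ` (\<Pi>\<^sub>E i\<in>UNIV. {..<N i})"
    unfolding T by (auto simp: PiE_def extensional_def)
  ultimately show ?thesis by (meson finite_surj)
qed

lemma solid_box_compact: "solid_box T \<Longrightarrow> compact T"
  by (auto simp: solid_box_def)

lemma solid_box_convex: "solid_box T \<Longrightarrow> convex T"
  by (auto simp: solid_box_def)

lemma solid_box_subset_closure_interior:
  assumes "solid_box T" shows "T \<subseteq> closure (interior T)"
proof -
  obtain a b where T: "T = cbox a b" "\<forall>i. a $ i < b $ i" using assms by (auto simp: solid_box_def)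
  then have "box a b \<noteq> {}" by (simp add: interval_ne_empty_cart)
  then show ?thesis using T by (simp add: interior_cbox closure_box)
qed

lemma frechet_derivative_within_solid_box:
  assumes T: "solid_box T" and x: "x \<in> T" and f: "(f has_derivative f') (at x within T)"
  shows "frechet_derivative f (at x within T) = f'"
proof -
  obtain a b where ab: "T = cbox a b" "\<forall>i. a $ i < b $ i" using T by (auto simp: solid_box_def)
  have "a \<bullet> i < b \<bullet> i" if "i \<in> Basis" for i
    using that ab(2) by (auto simp: Basis_vec_def inner_axis)
  then show ?thesis using frechet_derivative_within_cbox[of a b x f f'] x f ab(1) by blast
qed

text \<open>Discrete functions are polynomial on each closed cell only; \<open>q\<close> is the
  global witness on which derivatives are computed.\<close>

definition poly_on :: "'a set \<Rightarrow> ('a::euclidean_space \<Rightarrow> 'b::euclidean_space) \<Rightarrow> ('a \<Rightarrow> 'b) \<Rightarrow> bool" where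
  "poly_on T q w \<longleftrightarrow> polynomial_function q \<and> (\<forall>x\<in>T. w x = q x)"

lemma poly_on_has_derivative:
  assumes "poly_on T q w" "x \<in> T"
  shows "(w has_derivative (\<lambda>h. dir_deriv h q x)) (at x within T)"
proof (rule has_derivative_transform[OF assms(2)])
  show "(q has_derivative (\<lambda>h. dir_deriv h q x)) (at x within T)"
    using assms has_derivative_at_withinI polynomial_function_has_derivative poly_on_def by blast
qed (use assms in \<open>auto simp: poly_on_def\<close>)

lemma poly_on_frechet_derivative:
  assumes "solid_box T" "poly_on T q w" "x \<in> T"
  shows "frechet_derivative w (at x within T) = (\<lambda>h. dir_deriv h q x)"
  by (rule frechet_derivative_within_solid_box[OF assms(1,3) poly_on_has_derivative[OF assms(2,3)]])

lemma poly_on_cell_dir_deriv: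
  assumes "solid_box T" "poly_on T q w"
  shows "poly_on T (dir_deriv n q) (cell_dir_deriv T n w)"
  using assms polynomial_function_dir_deriv poly_on_frechet_derivative[OF assms]
  by (auto simp: poly_on_def cell_dir_deriv_def)

lemma poly_on_cell_dir_deriv_funpow:
  assumes "solid_box T" "poly_on T q w"
  shows "poly_on T ((dir_deriv n ^^ k) q) ((cell_dir_deriv T n ^^ k) w)"
  using assms by (induction k) (auto intro: poly_on_cell_dir_deriv)

lemma poly_on_add_scaleR:
  "poly_on T q u \<Longrightarrow> poly_on T r w \<Longrightarrow> poly_on T (\<lambda>x. q x + t *\<^sub>R r x) (\<lambda>x. u x + t *\<^sub>R w x)"
  by (auto simp: poly_on_def intro!: polynomial_function_add polynomial_function_cmul)

lemma dir_deriv_add_scaleR: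
  fixes q r :: "'a::euclidean_space \<Rightarrow> 'b::euclidean_space"
  assumes "polynomial_function q" "polynomial_function r"
  shows "dir_deriv n (\<lambda>x. q x + t *\<^sub>R r x) = (\<lambda>x. dir_deriv n q x + t *\<^sub>R dir_deriv n r x)"
proof
  fix x
  have "((\<lambda>x. q x + t *\<^sub>R r x) has_derivative (\<lambda>h. dir_deriv h q x + t *\<^sub>R dir_deriv h r x)) (at x)"
    by (intro has_derivative_add has_derivative_scaleR_right polynomial_function_has_derivative assms)
  from frechet_derivative_at[OF this]
  show "dir_deriv n (\<lambda>x. q x + t *\<^sub>R r x) x = dir_deriv n q x + t *\<^sub>R dir_deriv n r x"
    unfolding dir_deriv_def[of n "\<lambda>x. q x + t *\<^sub>R r x"] by metis
qed

lemma dir_deriv_funpow_add_scaleR: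
  fixes q r :: "'a::euclidean_space \<Rightarrow> 'b::euclidean_space"
  assumes "polynomial_function q" "polynomial_function r"
  shows "(dir_deriv n ^^ k) (\<lambda>x. q x + t *\<^sub>R r x)
       = (\<lambda>x. (dir_deriv n ^^ k) q x + t *\<^sub>R (dir_deriv n ^^ k) r x)"
proof (induction k)
  case (Suc k)
  then show ?case
    using dir_deriv_add_scaleR[OF polynomial_function_dir_deriv_funpow[OF assms(1)]
        polynomial_function_dir_deriv_funpow[OF assms(2)]] by simp
qed simp

lemma cell_dir_deriv_funpow_add_scaleR:
  assumes T: "solid_box T" "x \<in> T" and p: "poly_on T q u" "poly_on T r w"
  shows "(cell_dir_deriv T n ^^ k) (\<lambda>x. u x + t *\<^sub>R w x) x
       = (cell_dir_deriv T n ^^ k) u x + t *\<^sub>R (cell_dir_deriv T n ^^ k) w x"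
  using poly_on_cell_dir_deriv_funpow[OF T(1) p(1), where k=k and n=n] poly_on_cell_dir_deriv_funpow[OF T(1) p(2), where k=k and n=n]
    poly_on_cell_dir_deriv_funpow[OF T(1) poly_on_add_scaleR[OF p, of t], where k=k and n=n]
    dir_deriv_funpow_add_scaleR[of q r] p T(2)
  by (simp add: poly_on_def)

lemma cell_grad_poly_on:
  assumes "solid_box T" "poly_on T q u" "x \<in> T"
  shows "cell_grad T u x = (\<chi> i j. dir_deriv (axis j 1) q x $ i)"
  by (simp add: cell_grad_def jacobian_def matrix_def poly_on_frechet_derivative[OF assms])

lemma cell_grad_add_scaleR:
  assumes "solid_box T" "poly_on T q u" "poly_on T r w" "x \<in> T"
  shows "cell_grad T (\<lambda>x. u x + t *\<^sub>R w x) x = cell_grad T u x + t *\<^sub>R cell_grad T w x"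
  using assms(2,3)
  by (simp add: cell_grad_poly_on[OF assms(1) poly_on_add_scaleR[OF assms(2,3)] assms(4)]
      cell_grad_poly_on[OF assms(1,2,4)] cell_grad_poly_on[OF assms(1,3,4)]
      dir_deriv_add_scaleR poly_on_def vec_eq_iff)

lemma continuous_on_cell_grad:
  assumes "solid_box T" "poly_on T q u"
  shows "continuous_on T (cell_grad T u)"
proof -
  have "continuous_on T (\<lambda>x. \<chi> i j. dir_deriv (axis j 1) q x $ i)"
    using assms(2) by (intro continuous_on_vec_lambda continuous_on_component continuous_on_polymonial_function
        polynomial_function_dir_deriv) (auto simp: poly_on_def)
  then show ?thesis by (rule continuous_on_eq) (simp add: cell_grad_poly_on[OF assms])
qed

lemma dir_deriv_eq_0_of_cell_grad_eq_0:
  assumes "solid_box T" "poly_on T q u" "x \<in> T" "cell_grad T u x = 0"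
  shows "dir_deriv h q x = 0"
proof -
  have lin: "linear (\<lambda>h. dir_deriv h q x)"
    using poly_on_has_derivative[OF assms(2,3)] has_derivative_linear by blast
  have "dir_deriv (axis j 1) q x = 0" for j
    using assms(4) by (simp add: cell_grad_poly_on[OF assms(1-3)] vec_eq_iff)
  then have "dir_deriv b q x = 0" if "b \<in> Basis" for b
    using that by (auto simp: Basis_vec_def)
  then show ?thesis
    using linear_eq_stdbasis[OF lin linear_zero] by (metis)
qed

lemma Q_poly_real_polynomial_function:
  assumes "q \<in> Q_poly p" shows "real_polynomial_function (q :: real ^ 'd \<Rightarrow> real)"
proof -
  obtain c :: "('d \<Rightarrow> nat) \<Rightarrow> real" where
    q: "q = (\<lambda>x. \<Sum>k\<in>{k. \<forall>i. k i \<le> p}. c k * (\<Prod>i\<in>UNIV. (x $ i) ^ k i))"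
    using assms by (auto simp: Q_poly_def)
  have "{k :: 'd \<Rightarrow> nat. \<forall>i. k i \<le> p} = (\<Pi>\<^sub>E i\<in>UNIV. {..p})"
    by (auto simp: PiE_def extensional_def)
  then have "finite {k :: 'd \<Rightarrow> nat. \<forall>i. k i \<le> p}" by (simp add: finite_PiE)
  then show ?thesis unfolding q
    by (intro real_polynomial_function_sum real_polynomial_function.intros(4) real_polynomial_function.intros(2)
        real_polynomial_function_prod real_polynomial_function_power real_polynomial_function.intros(1)
        bounded_linear_vec_nth) auto
qed

lemma V_h_poly_on:
  assumes "v \<in> V_h \<Omega> \<T> p" "T \<in> active_cells \<Omega> \<T>"
  obtains q where "poly_on T q v"
proof -
  have "\<forall>i. \<exists>q\<in>Q_poly p. \<forall>x\<in>T. v x $ i = q x" using assms by (auto simp: V_h_def)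
  then obtain q where q: "\<And>i. q i \<in> Q_poly p" "\<And>i x. x \<in> T \<Longrightarrow> v x $ i = q i x" by metis
  have "polynomial_function (\<lambda>x. \<chi> i. q i x)"
    unfolding polynomial_function_iff_Basis_inner
    using q(1) Q_poly_real_polynomial_function by (auto simp: Basis_vec_def inner_axis)
  then have "poly_on T (\<lambda>x. \<chi> i. q i x) v" using q(2) by (simp add: poly_on_def vec_eq_iff)
  then show thesis by (rule that)
qed

section \<open>Measurability of normals and of piecewise gradients\<close>

text \<open>The condition on a normal at one aperture \<epsilon> and one radius \<open>r\<close>.
  With both fixed it is closed jointly in \<nu> and \<open>x\<close>, which is where measurability
  starts.\<close>

definition normal_test :: "(real ^ 'd) set \<Rightarrow> real \<Rightarrow> real \<Rightarrow> real ^ 'd \<Rightarrow> real ^ 'd \<Rightarrow> bool" where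
  "normal_test \<Omega> \<epsilon> r x \<nu> \<longleftrightarrow> (\<forall>y\<in>ball x r.
     ((y - x) \<bullet> \<nu> > \<epsilon> * norm (y - x) \<longrightarrow> y \<notin> \<Omega>) \<and>
     ((y - x) \<bullet> \<nu> < - \<epsilon> * norm (y - x) \<longrightarrow> y \<in> \<Omega>))"

lemma is_outer_normal_eq_test:
  "is_outer_normal \<Omega> x \<nu> \<longleftrightarrow> norm \<nu> = 1 \<and> (\<forall>\<epsilon>>0. \<exists>r>0. normal_test \<Omega> \<epsilon> r x \<nu>)"
  unfolding is_outer_normal_def normal_test_def ..

text \<open>Turning the direction changes the inner product by at most
  \<open>norm (\<nu>' - \<nu>) * norm (y - x)\<close>, which the larger aperture absorbs. This lets
  tests pass to a limit of directions.\<close>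

lemma normal_test_mono:
  assumes "normal_test \<Omega> \<epsilon> r x \<nu>" "r' \<le> r" "\<epsilon> + norm (\<nu>' - \<nu>) \<le> \<epsilon>'"
  shows "normal_test \<Omega> \<epsilon>' r' x \<nu>'"
  unfolding normal_test_def
proof
  fix y assume "y \<in> ball x r'"
  then have y: "y \<in> ball x r" using assms(2) by simp
  have "\<bar>(y - x) \<bullet> \<nu>' - (y - x) \<bullet> \<nu>\<bar> \<le> norm (y - x) * norm (\<nu>' - \<nu>)"
    using Cauchy_Schwarz_ineq2[of "y - x" "\<nu>' - \<nu>"] by (simp add: inner_diff_right)
  moreover have "\<epsilon> * norm (y - x) + norm (\<nu>' - \<nu>) * norm (y - x) \<le> \<epsilon>' * norm (y - x)"
    using assms(3) by (metis distrib_right mult_right_mono norm_ge_zero)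
  ultimately have "(y - x) \<bullet> \<nu>' > \<epsilon>' * norm (y - x) \<Longrightarrow> (y - x) \<bullet> \<nu> > \<epsilon> * norm (y - x)"
    "(y - x) \<bullet> \<nu>' < - \<epsilon>' * norm (y - x) \<Longrightarrow> (y - x) \<bullet> \<nu> < - \<epsilon> * norm (y - x)"
    by (simp_all add: mult.commute)
  then show "((y - x) \<bullet> \<nu>' > \<epsilon>' * norm (y - x) \<longrightarrow> y \<notin> \<Omega>) \<and>
      ((y - x) \<bullet> \<nu>' < - \<epsilon>' * norm (y - x) \<longrightarrow> y \<in> \<Omega>)"
    using assms(1) y unfolding normal_test_def by blast
qed

text \<open>A failed test is witnessed by one point \<open>y\<close> and strict inequalities, which
  are open in \<nu> and \<open>x\<close>; a union of open sets over all witnesses is open.\<close>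

lemma closed_normal_test: "closed {z. normal_test \<Omega> \<epsilon> r (snd z) (fst z)}"
proof -
  have "- {z. normal_test \<Omega> \<epsilon> r (snd z) (fst z)} =
     (\<Union>y\<in>\<Omega>. {z. dist (snd z) y < r} \<inter> {z. \<epsilon> * norm (y - snd z) < (y - snd z) \<bullet> fst z}) \<union>
     (\<Union>y\<in>-\<Omega>. {z. dist (snd z) y < r} \<inter> {z. (y - snd z) \<bullet> fst z < - \<epsilon> * norm (y - snd z)})"
    unfolding normal_test_def by auto
  moreover have "open \<dots>"
    by (intro open_Un open_UN ballI open_Int open_Collect_less continuous_intros)
  ultimately show ?thesis by (simp add: closed_def)
qed

text \<open>A short step from \<open>x\<close> along \<open>\<nu> - \<nu>'\<close> has positive
  inner product with \<nu> and negative inner product with \<nu>', so one test puts its end outside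
  \<Omega> and the other inside.\<close>

lemma is_outer_normal_unique:
  assumes "is_outer_normal \<Omega> x \<nu>" "is_outer_normal \<Omega> x \<nu>'"
  shows "\<nu> = \<nu>'"
proof (rule ccontr)
  assume ne: "\<nu> \<noteq> \<nu>'"
  define w where "w = \<nu> - \<nu>'"
  have n1: "norm \<nu> = 1" "norm \<nu>' = 1" using assms by (auto simp: is_outer_normal_def)
  then have n2: "\<nu> \<bullet> \<nu> = 1" "\<nu>' \<bullet> \<nu>' = 1" by (simp_all add: norm_eq_1)
  define c where "c = 1 - \<nu> \<bullet> \<nu>'"
  have ic: "\<nu>' \<bullet> \<nu> = \<nu> \<bullet> \<nu>'" by (rule inner_commute)
  have wv: "w \<bullet> \<nu> = c" "w \<bullet> \<nu>' = - c"
    by (simp_all add: w_def c_def inner_diff_left n2 ic)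
  have "0 < w \<bullet> w" using ne by (simp add: w_def)
  also have "w \<bullet> w = 2 * c" by (simp add: w_def c_def inner_diff_left inner_diff_right n2 ic)
  finally have "0 < c" by simp
  have w: "0 < norm w" using ne by (simp add: w_def)
  \<comment> \<open>Chosen so that \<open>\<epsilon> * norm (s *\<^sub>R w)\<close> is
    \<open>s * c / 2\<close>, half the inner product of the step with \<nu>; both cone conditions
    then hold strictly.\<close>
  define \<epsilon> where "\<epsilon> = c / (2 * norm w)"
  have "0 < \<epsilon>" using \<open>0 < c\<close> w by (simp add: \<epsilon>_def)
  then obtain r r' where r: "0 < r" "normal_test \<Omega> \<epsilon> r x \<nu>" "0 < r'" "normal_test \<Omega> \<epsilon> r' x \<nu>'"
    using assms unfolding is_outer_normal_eq_test by metis
  define s where "s = min r r' / (2 * norm w)"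
  have s: "0 < s" "s * norm w < r" "s * norm w < r'" using r w by (auto simp: s_def min_def)
  define y where "y = x + s *\<^sub>R w"
  have y: "y - x = s *\<^sub>R w" "norm (y - x) = s * norm w" using s by (auto simp: y_def)
  have ball: "y \<in> ball x r" "y \<in> ball x r'"
    using s y(2) by (simp_all add: dist_norm norm_minus_commute[of x y])
  have e: "\<epsilon> * norm (y - x) = s * (c / 2)" using w s(1) by (simp add: y(2) \<epsilon>_def)
  have "s * (c / 2) < s * c" using s \<open>0 < c\<close> by simp
  then have "(y - x) \<bullet> \<nu> > \<epsilon> * norm (y - x)" "(y - x) \<bullet> \<nu>' < - \<epsilon> * norm (y - x)"
    unfolding minus_mult_left[symmetric] e by (simp_all add: y(1) wv)
  then show False using r ball unfolding normal_test_def by blast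
qed

lemma outer_normal_eqI: "is_outer_normal \<Omega> x \<nu> \<Longrightarrow> outer_normal \<Omega> x = \<nu>"
  unfolding outer_normal_def using is_outer_normal_unique by (metis someI)

lemma is_outer_normal_outer_normal: "outer_normal \<Omega> x \<noteq> 0 \<Longrightarrow> is_outer_normal \<Omega> x (outer_normal \<Omega> x)"
  unfolding outer_normal_def by (metis someI_ex)

lemma norm_outer_normal_le: "norm (outer_normal \<Omega> x) \<le> 1"
  using is_outer_normal_outer_normal[of \<Omega> x]
  by (cases "outer_normal \<Omega> x = 0") (auto simp: is_outer_normal_def)

text \<open>
  By compactness the existence of approximate normals in \<open>K\<close> at every scale already yields a
  normal in \<open>K\<close>, so the set is described by countably many closed sets.
\<close>

lemma sets_is_outer_normal_in_closed:
  assumes "closed K"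
  shows "{x. \<exists>\<nu>\<in>K. is_outer_normal \<Omega> x \<nu>} \<in> sets borel"
proof -
  define K' where "K' = K \<inter> sphere 0 1"
  have K': "compact K'" using assms by (auto simp: K'_def intro: closed_Int_compact)
  \<comment> \<open>Projecting a closed set along the compact \<open>K'\<close> keeps it closed, so
    the existential over directions costs no measurability.\<close>
  define C where "C n m = {x. \<exists>\<nu>. \<nu> \<in> K' \<and> (\<nu>, x) \<in> {z. normal_test \<Omega> (1 / Suc n) (1 / Suc m) (snd z) (fst z)}}" for n m
  have "closed (C n m)" for n m
    unfolding C_def by (rule closed_compact_projection[OF K' closed_normal_test])
  then have meas: "(\<Inter>n. \<Union>m. C n m) \<in> sets borel" by auto
  have "{x. \<exists>\<nu>\<in>K. is_outer_normal \<Omega> x \<nu>} = (\<Inter>n. \<Union>m. C n m)"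
  proof (intro equalityI subsetI)
    fix x assume "x \<in> {x. \<exists>\<nu>\<in>K. is_outer_normal \<Omega> x \<nu>}"
    then obtain \<nu> where \<nu>: "\<nu> \<in> K" "is_outer_normal \<Omega> x \<nu>" by blast
    have "x \<in> (\<Union>m. C n m)" for n
    proof -
      have "0 < 1 / real (Suc n)" by simp
      then obtain r where r: "0 < r" "normal_test \<Omega> (1 / Suc n) r x \<nu>"
        using \<nu>(2) unfolding is_outer_normal_eq_test by blast
      obtain m where "1 / real (Suc m) < r" using r(1) nat_approx_posE by blast
      then have "normal_test \<Omega> (1 / Suc n) (1 / Suc m) x \<nu>"
        by (intro normal_test_mono[OF r(2)]) auto
      then show ?thesis using \<nu> by (auto simp: C_def K'_def is_outer_normal_def)
    qed
    then show "x \<in> (\<Inter>n. \<Union>m. C n m)" by blast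
  next
    fix x assume "x \<in> (\<Inter>n. \<Union>m. C n m)"
    then have "\<forall>n. \<exists>m \<nu>. \<nu> \<in> K' \<and> normal_test \<Omega> (1 / Suc n) (1 / Suc m) x \<nu>"
      by (auto simp: C_def)
    then obtain m \<nu> where \<nu>: "\<And>n. \<nu> n \<in> K'" "\<And>n. normal_test \<Omega> (1 / Suc n) (1 / Suc (m n)) x (\<nu> n)"
      by metis
    obtain l \<rho> where l: "l \<in> K'" "strict_mono \<rho>" "(\<nu> \<circ> \<rho>) \<longlonglongrightarrow> l"
      using K' \<nu>(1) unfolding compact_def by metis
    \<comment> \<open>Half of \<epsilon> pays for the aperture \<open>1 / Suc (\<rho> n)\<close>,
      the other half for the distance of the approximate normal from its limit.\<close>
    have "\<exists>r>0. normal_test \<Omega> \<epsilon> r x l" if "0 < \<epsilon>" for \<epsilon>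
    proof -
      have "\<forall>\<^sub>F n in sequentially. dist ((\<nu> \<circ> \<rho>) n) l < \<epsilon> / 2"
        by (rule tendstoD[OF l(3)]) (use that in simp)
      moreover have "\<forall>\<^sub>F n in sequentially. inverse (real (Suc n)) < \<epsilon> / 2"
        using LIMSEQ_inverse_real_of_nat that by (intro order_tendstoD) auto
      ultimately have "\<forall>\<^sub>F n in sequentially. dist ((\<nu> \<circ> \<rho>) n) l < \<epsilon> / 2 \<and> inverse (real (Suc n)) < \<epsilon> / 2"
        by (rule eventually_conj)
      then obtain n where n: "dist (\<nu> (\<rho> n)) l < \<epsilon> / 2" "inverse (real (Suc n)) < \<epsilon> / 2"
        by (auto simp: eventually_sequentially)
      have "n \<le> \<rho> n" using l(2) by (rule seq_suble)
      then have "1 / real (Suc (\<rho> n)) \<le> 1 / real (Suc n)" by (intro divide_left_mono) auto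
      then have "1 / real (Suc (\<rho> n)) + norm (l - \<nu> (\<rho> n)) \<le> \<epsilon>"
        using n by (simp add: dist_norm norm_minus_commute inverse_eq_divide)
      then have "normal_test \<Omega> \<epsilon> (1 / Suc (m (\<rho> n))) x l"
        by (intro normal_test_mono[OF \<nu>(2)]) auto
      moreover have "0 < 1 / real (Suc (m (\<rho> n)))" by simp
      ultimately show ?thesis by blast
    qed
    then have "is_outer_normal \<Omega> x l" "l \<in> K"
      using l(1) by (auto simp: is_outer_normal_eq_test K'_def)
    then show "x \<in> {x. \<exists>\<nu>\<in>K. is_outer_normal \<Omega> x \<nu>}" by blast
  qed
  then show ?thesis using meas by simp
qed

lemma borel_measurable_outer_normal [measurable]:
  fixes \<Omega> :: "(real ^ 'd) set"
  shows "outer_normal \<Omega> \<in> borel_measurable borel"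
proof (rule borel_measurableI)
  have closed: "outer_normal \<Omega> -` K \<in> sets borel" if "closed K" for K
  proof -
    \<comment> \<open>Points without a normal carry the default value 0, so they lie in the preimage
      exactly when \<open>K\<close> contains 0.\<close>
    have "outer_normal \<Omega> -` K = {x. \<exists>\<nu>\<in>K. is_outer_normal \<Omega> x \<nu>} \<union>
        (if 0 \<in> K then - {x. \<exists>\<nu>\<in>UNIV. is_outer_normal \<Omega> x \<nu>} else {})"
    proof (intro set_eqI)
      fix x
      show "x \<in> outer_normal \<Omega> -` K \<longleftrightarrow> x \<in> {x. \<exists>\<nu>\<in>K. is_outer_normal \<Omega> x \<nu>} \<union>
        (if 0 \<in> K then - {x. \<exists>\<nu>\<in>UNIV. is_outer_normal \<Omega> x \<nu>} else {})"
      proof (cases "\<exists>\<nu>. is_outer_normal \<Omega> x \<nu>")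
        case True
        then obtain \<nu> where "is_outer_normal \<Omega> x \<nu>" by blast
        then show ?thesis using outer_normal_eqI is_outer_normal_unique by auto
      next
        case False
        then have "outer_normal \<Omega> x = 0" by (simp add: outer_normal_def)
        with False show ?thesis by auto
      qed
    qed
    then show ?thesis
      using sets_is_outer_normal_in_closed[OF that, of \<Omega>]
        sets_is_outer_normal_in_closed[OF closed_UNIV, of \<Omega>] by auto
  qed
  fix S :: "(real ^ 'd) set" assume "open S"
  then have "outer_normal \<Omega> -` (- S) \<in> sets borel" using closed[of "- S"] by (simp add: closed_Compl)
  then have "- (outer_normal \<Omega> -` (- S)) \<in> sets borel" by (rule borel_comp)
  then show "outer_normal \<Omega> -` S \<inter> space borel \<in> sets borel" by (simp add: vimage_Compl)
qed

section \<open>Trace cells and piecewise gradients\<close>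

text \<open>Makes the condition behind \<open>trace_cell\<close> countable, as Borel measurability
  requires. Closedness puts the limit \<open>X\<close> into \<open>T\<close>; conversely, by
  convexity, \<open>X\<close> and one later point of the ray bring the whole segment between
  them.\<close>

lemma eventually_inward_in_convex_iff:
  fixes T :: "'a::real_normed_vector set"
  assumes "closed T" "convex T"
  shows "(\<forall>\<^sub>F s in at_right 0. X - s *\<^sub>R n \<in> T) \<longleftrightarrow> X \<in> T \<and> (\<exists>m. X - (1 / real (Suc m)) *\<^sub>R n \<in> T)"
    (is "?L \<longleftrightarrow> ?R")
proof
  assume L: ?L
  have "((\<lambda>s. X - s *\<^sub>R n) \<longlongrightarrow> X - 0 *\<^sub>R n) (at_right 0)" by (intro tendsto_intros)
  then have "X \<in> T" using Lim_in_closed_set[OF assms(1) L] by simp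
  moreover obtain b where b: "0 < b" "\<And>s. 0 < s \<Longrightarrow> s < b \<Longrightarrow> X - s *\<^sub>R n \<in> T"
    using L by (auto simp: eventually_at_right[of 0 1])
  moreover obtain m where "1 / real (Suc m) < b" using b(1) nat_approx_posE by blast
  ultimately show ?R by (intro conjI exI[of _ m] b(2)) auto
next
  assume ?R
  then obtain m where m: "X \<in> T" "X - (1 / real (Suc m)) *\<^sub>R n \<in> T" by blast
  have "X - s *\<^sub>R n \<in> T" if "0 < s" "s < 1 / real (Suc m)" for s
  proof -
    have "(1 - s * real (Suc m)) *\<^sub>R X + (s * real (Suc m)) *\<^sub>R (X - (1 / real (Suc m)) *\<^sub>R n) \<in> T"
      using that by (intro convexD_alt[OF assms(2) m]) (simp_all add: field_simps)
    also have "(1 - s * real (Suc m)) *\<^sub>R X + (s * real (Suc m)) *\<^sub>R (X - (1 / real (Suc m)) *\<^sub>R n) = X - s *\<^sub>R n"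
      by (simp add: scaleR_diff_left scaleR_diff_right)
    finally show ?thesis .
  qed
  moreover have "0 < 1 / real (Suc m)" by simp
  ultimately show ?L unfolding eventually_at_right[OF zero_less_one] by blast
qed

locale cut_mesh =
  fixes \<kappa> :: real and \<Omega> :: "(real ^ 'd) set" and \<T> :: "(real ^ 'd) set set"
  assumes domain: "lipschitz_domain \<Omega>" and mesh: "background_mesh \<kappa> \<Omega> \<T>"
begin

lemma finite_mesh: "finite \<T>"
  using mesh cartesian_mesh_finite by (auto simp: background_mesh_def)

lemma finite_active: "finite (active_cells \<Omega> \<T>)"
  using finite_mesh by (simp add: active_cells_def)

lemma solid_box_active: "T \<in> active_cells \<Omega> \<T> \<Longrightarrow> solid_box T"
  using mesh cartesian_mesh_solid_box by (auto simp: background_mesh_def active_cells_def)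

lemma compact_active_domain: "compact (active_domain \<Omega> \<T>)"
  unfolding active_domain_def
  by (rule compact_Union[OF finite_active]) (rule solid_box_compact[OF solid_box_active])

lemma domain_subset_active: "\<Omega> \<subseteq> active_domain \<Omega> \<T>"
  using mesh by (auto simp: background_mesh_def active_domain_def active_cells_def)

lemma closure_subset_active: "closure \<Omega> \<subseteq> active_domain \<Omega> \<T>"
  by (rule closure_minimal[OF domain_subset_active]) (rule compact_imp_closed[OF compact_active_domain])

lemma sets_inward_in_cell:
  assumes "solid_box T"
  shows "{X. \<forall>\<^sub>F s in at_right 0. X - s *\<^sub>R outer_normal \<Omega> X \<in> T} \<in> sets borel"
proof -
  have cl: "closed T" using assms solid_box_compact compact_imp_closed by blast
  then have [measurable]: "T \<in> sets borel" by simp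
  show ?thesis
    unfolding eventually_inward_in_convex_iff[OF cl solid_box_convex[OF assms]] by measurable
qed

text \<open>The choice is arbitrary, but depends on \<open>X\<close> only through the set of
  admissible cells. There are finitely many such sets, and each occurs on a Borel set of
  points.\<close>

lemma sets_trace_cell_eq: "{X. trace_cell \<Omega> \<T> X = T} \<in> sets borel"
proof -
  let ?A = "active_cells \<Omega> \<T>"
  define P where "P T X \<longleftrightarrow> (\<forall>\<^sub>F s in at_right 0. X - s *\<^sub>R outer_normal \<Omega> X \<in> T)" for T X
  define pat where "pat X = {T\<in>?A. P T X}" for X
  have tc: "trace_cell \<Omega> \<T> X = (SOME T. T \<in> pat X)" for X
    by (simp add: trace_cell_def pat_def P_def)
  have "{X. trace_cell \<Omega> \<T> X = T} = (\<Union>S\<in>{S\<in>Pow ?A. (SOME T. T \<in> S) = T}. {X. pat X = S})"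
    unfolding tc by (auto simp: pat_def)
  moreover have "{X. pat X = S} \<in> sets borel" if "S \<in> Pow ?A" for S
  proof -
    have "{X. pat X = S} = {X. \<forall>T\<in>?A. P T X \<longleftrightarrow> T \<in> S}" using that by (auto simp: pat_def)
    also have "\<dots> = UNIV \<inter> (\<Inter>T\<in>?A. if T \<in> S then {X. P T X} else - {X. P T X})"
      by (auto split: if_splits)
    also have "\<dots> \<in> sets borel"
    proof -
      have "(if T \<in> S then {X. P T X} else - {X. P T X}) \<in> sets borel" if "T \<in> ?A" for T
        using sets_inward_in_cell[OF solid_box_active[OF that]] by (simp add: P_def borel_comp)
      then have "(\<Inter>T\<in>?A. if T \<in> S then {X. P T X} else - {X. P T X}) \<in> sets borel" if "?A \<noteq> {}"
        by (intro sets.finite_INT finite_active that)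
      then show ?thesis by (cases "?A = {}") auto
    qed
    finally show ?thesis .
  qed
  ultimately show ?thesis using finite_active by auto
qed

text \<open>The point is that some cell is admissible. If every cell failed at a point with a
  normal, then by finiteness the points approaching \<open>X\<close> along the inward normal would
  eventually avoid all active cells and hence \<Omega>, whereas the normal places them in
  \<Omega>.\<close>

lemma trace_cell_props:
  assumes "X \<in> closure \<Omega>"
  shows "trace_cell \<Omega> \<T> X \<in> active_cells \<Omega> \<T>" "X \<in> trace_cell \<Omega> \<T> X"
proof -
  let ?n = "outer_normal \<Omega> X"
  let ?P = "\<lambda>T. \<forall>\<^sub>F s in at_right 0. X - s *\<^sub>R ?n \<in> T"
  have iff: "?P T \<longleftrightarrow> X \<in> T \<and> (\<exists>m. X - (1 / real (Suc m)) *\<^sub>R ?n \<in> T)" if "T \<in> active_cells \<Omega> \<T>" for T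
    using eventually_inward_in_convex_iff solid_box_active[OF that] solid_box_convex solid_box_compact
      compact_imp_closed by metis
  have "\<exists>T\<in>active_cells \<Omega> \<T>. ?P T"
  proof (cases "?n = 0")
    case True
    then show ?thesis using assms closure_subset_active by (auto simp: active_domain_def)
  next
    case False
    show ?thesis
    proof (rule ccontr)
      assume none: "\<not> (\<exists>T\<in>active_cells \<Omega> \<T>. ?P T)"
      let ?y = "\<lambda>m. X - (1 / real (Suc m)) *\<^sub>R ?n"
      have lim: "(\<lambda>m. 1 / real (Suc m)) \<longlonglongrightarrow> 0"
        using LIMSEQ_inverse_real_of_nat by (simp add: inverse_eq_divide)
      have "?y \<longlonglongrightarrow> X - 0 *\<^sub>R ?n" by (intro tendsto_intros lim)
      then have ylim: "?y \<longlonglongrightarrow> X" by simp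
      have "\<forall>\<^sub>F m in sequentially. ?y m \<notin> T" if T: "T \<in> active_cells \<Omega> \<T>" for T
      proof (cases "X \<in> T")
        case True
        then show ?thesis using iff[OF T] none T by auto
      next
        case False
        have "open (- T)" using solid_box_active[OF T] solid_box_compact compact_imp_closed by blast
        then show ?thesis using topological_tendstoD[OF ylim, of "- T"] False by simp
      qed
      then have "\<forall>\<^sub>F m in sequentially. \<forall>T\<in>active_cells \<Omega> \<T>. ?y m \<notin> T"
        using finite_active by (intro eventually_ball_finite) auto
      then have "\<forall>\<^sub>F m in sequentially. ?y m \<notin> \<Omega>"
        by (rule eventually_mono) (use domain_subset_active in \<open>auto simp: active_domain_def\<close>)
      moreover have "\<forall>\<^sub>F m in sequentially. ?y m \<in> \<Omega>"
      proof -
        have normal: "is_outer_normal \<Omega> X ?n" by (rule is_outer_normal_outer_normal[OF False])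
        then have n1: "norm ?n = 1" by (simp add: is_outer_normal_def)
        \<comment> \<open>Any aperture below 1 would do: along the inward normal the inner product
          equals minus the distance.\<close>
        have "(0::real) < 1/2" by simp
        then obtain r where r: "0 < r" "normal_test \<Omega> (1/2) r X ?n"
          using normal unfolding is_outer_normal_eq_test by blast
        have "\<forall>\<^sub>F m in sequentially. 1 / real (Suc m) < r" using lim r(1) by (rule order_tendstoD)
        then show ?thesis
        proof (rule eventually_mono)
          fix m assume m: "1 / real (Suc m) < r"
          have "?y m \<in> ball X r" using m n1 by (simp add: dist_norm)
          moreover have "(?y m - X) \<bullet> ?n < - (1/2) * norm (?y m - X)"
          proof -
            have "?n \<bullet> ?n = 1" using n1 by (simp add: norm_eq_1)
            then show ?thesis by (simp add: n1 field_simps)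
          qed
          ultimately show "?y m \<in> \<Omega>" using r(2) unfolding normal_test_def by blast
        qed
      qed
      ultimately have "\<forall>\<^sub>F m in sequentially. False" by eventually_elim auto
      then show False by simp
    qed
  qed
  then have "\<exists>T. T \<in> active_cells \<Omega> \<T> \<and> ?P T" by blast
  from someI_ex[OF this] have "trace_cell \<Omega> \<T> X \<in> active_cells \<Omega> \<T> \<and> ?P (trace_cell \<Omega> \<T> X)"
    unfolding trace_cell_def .
  then show "trace_cell \<Omega> \<T> X \<in> active_cells \<Omega> \<T>" "X \<in> trace_cell \<Omega> \<T> X" using iff by auto
qed

text \<open>Off the closure the trace cell is uncontrolled, hence the indicator. On it the gradient
  is a finite sum of continuous cell gradients, each cut off to the Borel set where its cell is the
  chosen one.\<close>

lemma borel_measurable_grad: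
  assumes "v \<in> V_h \<Omega> \<T> p"
  shows "(\<lambda>X. indicator (closure \<Omega>) X *\<^sub>R grad \<Omega> \<T> v X) \<in> borel_measurable borel"
proof -
  let ?B = "\<lambda>T. {X. trace_cell \<Omega> \<T> X = T} \<inter> closure \<Omega>"
  have "(\<lambda>X. indicator (closure \<Omega>) X *\<^sub>R grad \<Omega> \<T> v X) =
      (\<lambda>X. \<Sum>T\<in>active_cells \<Omega> \<T>. indicator (?B T) X *\<^sub>R cell_grad T v X)"
  proof
    fix X
    show "indicator (closure \<Omega>) X *\<^sub>R grad \<Omega> \<T> v X = (\<Sum>T\<in>active_cells \<Omega> \<T>. indicator (?B T) X *\<^sub>R cell_grad T v X)"
    proof (cases "X \<in> closure \<Omega>")
      case True
      have "(\<Sum>T\<in>active_cells \<Omega> \<T>. indicator (?B T) X *\<^sub>R cell_grad T v X) =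
        (\<Sum>T\<in>active_cells \<Omega> \<T>. if T = trace_cell \<Omega> \<T> X then cell_grad T v X else 0)"
        using True by (intro sum.cong) auto
      also have "\<dots> = grad \<Omega> \<T> v X"
        using trace_cell_props[OF True] finite_active by (simp add: grad_def)
      finally show ?thesis using True by simp
    qed simp
  qed
  moreover have "(\<lambda>X. indicator (?B T) X *\<^sub>R cell_grad T v X) \<in> borel_measurable borel"
    if T: "T \<in> active_cells \<Omega> \<T>" for T
  proof (rule borel_measurable_continuous_on_indicator)
    show "?B T \<in> sets borel" using sets_trace_cell_eq by auto
    obtain q where "poly_on T q v" using V_h_poly_on[OF assms T] .
    then have "continuous_on T (cell_grad T v)" by (rule continuous_on_cell_grad[OF solid_box_active[OF T]])
    then show "continuous_on (?B T) (cell_grad T v)"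
      by (rule continuous_on_subset) (use trace_cell_props in auto)
  qed
  ultimately show ?thesis by simp
qed

lemma compact_cell_grads:
  assumes "v \<in> V_h \<Omega> \<T> p"
  shows "compact (\<Union>T\<in>active_cells \<Omega> \<T>. cell_grad T v ` T)"
proof (intro compact_UN finite_active compact_continuous_image)
  fix T assume T: "T \<in> active_cells \<Omega> \<T>"
  obtain q where "poly_on T q v" using V_h_poly_on[OF assms T] .
  then show "continuous_on T (cell_grad T v)" by (rule continuous_on_cell_grad[OF solid_box_active[OF T]])
  show "compact T" by (rule solid_box_compact[OF solid_box_active[OF T]])
qed

lemma grad_in_cell_grads:
  "X \<in> closure \<Omega> \<Longrightarrow> grad \<Omega> \<T> v X \<in> (\<Union>T\<in>active_cells \<Omega> \<T>. cell_grad T v ` T)"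
  using trace_cell_props[of X] by (auto simp: grad_def)

lemma grad_bounded:
  assumes "v \<in> V_h \<Omega> \<T> p"
  obtains B where "\<And>X. X \<in> closure \<Omega> \<Longrightarrow> norm (grad \<Omega> \<T> v X) \<le> B"
proof -
  obtain B where B: "\<forall>M\<in>(\<Union>T\<in>active_cells \<Omega> \<T>. cell_grad T v ` T). norm M \<le> B"
    using compact_imp_bounded[OF compact_cell_grads[OF assms]] unfolding bounded_iff ..
  show thesis using that[OF bspec[OF B grad_in_cell_grads]] by metis
qed

lemma grad_add_scaleR:
  assumes "u \<in> V_h \<Omega> \<T> p" "w \<in> V_h \<Omega> \<T> p" "X \<in> closure \<Omega>"
  shows "grad \<Omega> \<T> (\<lambda>x. u x + t *\<^sub>R w x) X = grad \<Omega> \<T> u X + t *\<^sub>R grad \<Omega> \<T> w X"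
proof -
  let ?T = "trace_cell \<Omega> \<T> X"
  have T: "?T \<in> active_cells \<Omega> \<T>" "X \<in> ?T" using trace_cell_props[OF assms(3)] by auto
  obtain q r where "poly_on ?T q u" "poly_on ?T r w"
    using V_h_poly_on[OF assms(1) T(1)] V_h_poly_on[OF assms(2) T(1)] by metis
  then show ?thesis
    unfolding grad_def by (rule cell_grad_add_scaleR[OF solid_box_active[OF T(1)] _ _ T(2)])
qed

lemma defgrad_attained: "X \<in> closure \<Omega> \<Longrightarrow> defgrad \<Omega> \<T> u X \<in> attained \<Omega> \<T> u"
  unfolding defgrad_def grad_def attained_def mem_Collect_eq using trace_cell_props[of X] by metis

lemma compact_attained:
  assumes "u \<in> V_h \<Omega> \<T> p" shows "compact (attained \<Omega> \<T> u)"
proof -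
  have "attained \<Omega> \<T> u = (\<lambda>M. mat 1 + M) ` (\<Union>T\<in>active_cells \<Omega> \<T>. cell_grad T u ` T)"
    unfolding attained_def by blast
  moreover have "compact ((\<lambda>M. mat 1 + M) ` (\<Union>T\<in>active_cells \<Omega> \<T>. cell_grad T u ` T))"
    by (intro compact_continuous_image compact_cell_grads[OF assms] continuous_intros)
  ultimately show ?thesis by simp
qed

lemma V_h_continuous_on_closure: "v \<in> V_h \<Omega> \<T> p \<Longrightarrow> continuous_on (closure \<Omega>) v"
  using closure_subset_active continuous_on_subset by (auto simp: V_h_def)

lemma borel_measurable_V_h:
  "v \<in> V_h \<Omega> \<T> p \<Longrightarrow> (\<lambda>X. indicator (closure \<Omega>) X *\<^sub>R v X) \<in> borel_measurable borel"
  by (intro borel_measurable_continuous_on_indicator V_h_continuous_on_closure) auto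

lemma compact_closure_domain: "compact (closure \<Omega>)"
  using domain by (simp add: lipschitz_domain_def compact_closure)

lemma V_h_bounded:
  assumes "v \<in> V_h \<Omega> \<T> p"
  obtains B where "\<And>X. X \<in> closure \<Omega> \<Longrightarrow> norm (v X) \<le> B"
  using compact_imp_bounded[OF compact_continuous_image[OF V_h_continuous_on_closure[OF assms] compact_closure_domain]]
  unfolding bounded_iff by blast

end

section \<open>Differentiation under the integral sign and the constitutive law\<close>

text \<open>Continuity is asked on the compact \<open>Q\<close> only, since the energy density is
  smooth only near the attained deformation gradients. Factoring through a measurable map into
  \<open>Q\<close> gives measurability and boundedness at once.\<close>

lemma set_integrable_continuous_comp:
  fixes a :: "'x \<Rightarrow> 'q::{second_countable_topology, metric_space}" and \<Theta> :: "'q \<Rightarrow> real"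
  assumes D: "D \<in> sets M" "emeasure M D < \<infinity>"
    and Q: "compact Q" "continuous_on Q \<Theta>"
    and a: "a \<in> borel_measurable (restrict_space M D)" "\<And>x. x \<in> D \<Longrightarrow> a x \<in> Q"
  shows "set_integrable M D (\<lambda>x. \<Theta> (a x))"
proof -
  have sD: "space (restrict_space M D) = D" "D \<inter> space M = D" using D(1) sets.sets_into_space by (auto simp: space_restrict_space)
  have "a \<in> restrict_space M D \<rightarrow>\<^sub>M restrict_space borel Q"
    by (rule measurable_restrict_space2) (use a sD in auto)
  moreover have "\<Theta> \<in> borel_measurable (restrict_space borel Q)"
    by (rule borel_measurable_continuous_on_restrict[OF Q(2)])
  ultimately have "(\<lambda>x. \<Theta> (a x)) \<in> borel_measurable (restrict_space M D)" by (rule measurable_compose)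
  then have meas: "(\<lambda>x. indicator D x *\<^sub>R \<Theta> (a x)) \<in> borel_measurable M"
    using D sD by (simp add: borel_measurable_restrict_space_iff)
  obtain B where B: "\<And>q. q \<in> Q \<Longrightarrow> norm (\<Theta> q) \<le> B"
    using compact_imp_bounded[OF compact_continuous_image[OF Q(2,1)]] by (auto simp: bounded_iff)
  show ?thesis
    unfolding set_integrable_def
    by (rule integrableI_bounded_set[where A=D and B=B]) (use D meas B a in auto)
qed

text \<open>The bound of \<Theta>' on \<open>Q\<close> dominates the difference quotients by the
  mean value inequality; this is why the derivative is assumed at all small \<open>t\<close> and not
  at 0 alone.\<close>

lemma has_real_derivative_set_integral:
  fixes a :: "real \<Rightarrow> 'x \<Rightarrow> 'q::{second_countable_topology, metric_space}" and \<Theta> \<Theta>' :: "'q \<Rightarrow> real"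
  assumes D: "D \<in> sets M" "emeasure M D < \<infinity>" and \<epsilon>: "0 < \<epsilon>"
    and Q: "compact Q" "continuous_on Q \<Theta>" "continuous_on Q \<Theta>'"
    and a: "\<And>t. \<bar>t\<bar> < \<epsilon> \<Longrightarrow> a t \<in> borel_measurable (restrict_space M D)"
      "\<And>t x. \<bar>t\<bar> < \<epsilon> \<Longrightarrow> x \<in> D \<Longrightarrow> a t x \<in> Q"
    and deriv: "\<And>t x. \<bar>t\<bar> < \<epsilon> \<Longrightarrow> x \<in> D \<Longrightarrow>
      ((\<lambda>t. \<Theta> (a t x)) has_real_derivative \<Theta>' (a t x)) (at t)"
  shows "((\<lambda>t. LINT x:D|M. \<Theta> (a t x)) has_real_derivative (LINT x:D|M. \<Theta>' (a 0 x))) (at 0)"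
proof -
  have int: "set_integrable M D (\<lambda>x. \<Theta> (a t x))" if "\<bar>t\<bar> < \<epsilon>" for t
    using that by (intro set_integrable_continuous_comp[OF D Q(1,2)] a)
  have int': "set_integrable M D (\<lambda>x. \<Theta>' (a 0 x))"
    using \<epsilon> by (intro set_integrable_continuous_comp[OF D Q(1,3)] a) auto
  obtain B where B: "\<And>q. q \<in> Q \<Longrightarrow> norm (\<Theta>' q) \<le> B"
    using compact_imp_bounded[OF compact_continuous_image[OF Q(3,1)]] by (auto simp: bounded_iff)
  \<comment> \<open>Restricting to the interval keeps every sequence that tests the limit in the
    range where the hypotheses apply.\<close>
  have at0: "at (0::real) = at 0 within {- \<epsilon><..<\<epsilon>}"
    using \<epsilon> by (intro at_within_open[symmetric]) auto
  have "((\<lambda>h. ((LINT x:D|M. \<Theta> (a h x)) - (LINT x:D|M. \<Theta> (a 0 x))) / h) \<longlongrightarrow> (LINT x:D|M. \<Theta>' (a 0 x)))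
          (at 0 within {- \<epsilon><..<\<epsilon>})"
    unfolding tendsto_at_iff_sequentially o_def
  proof (intro allI impI)
    fix h :: "nat \<Rightarrow> real" assume h: "\<forall>i. h i \<in> {- \<epsilon><..<\<epsilon>} - {0}" "h \<longlonglongrightarrow> 0"
    then have he: "\<bar>h i\<bar> < \<epsilon>" "h i \<noteq> 0" for i using h(1) by (auto simp: abs_less_iff minus_less_iff)
    have quot: "((LINT x:D|M. \<Theta> (a (h i) x)) - (LINT x:D|M. \<Theta> (a 0 x))) / h i
        = (LINT x:D|M. (\<Theta> (a (h i) x) - \<Theta> (a 0 x)) / h i)" for i
      using set_integral_diff(2)[OF int[OF he(1)[of i]] int[of 0]] \<epsilon> by simp
    have "(\<lambda>i. LINT x|M. indicator D x *\<^sub>R ((\<Theta> (a (h i) x) - \<Theta> (a 0 x)) / h i))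
            \<longlonglongrightarrow> (LINT x|M. indicator D x *\<^sub>R \<Theta>' (a 0 x))"
    proof (rule integral_dominated_convergence[where w = "\<lambda>x. indicator D x *\<^sub>R \<bar>B\<bar>"])
      show "(\<lambda>x. indicator D x *\<^sub>R \<Theta>' (a 0 x)) \<in> borel_measurable M"
        using int' by (simp add: set_integrable_def borel_measurable_integrable)
      show "(\<lambda>x. indicator D x *\<^sub>R ((\<Theta> (a (h i) x) - \<Theta> (a 0 x)) / h i)) \<in> borel_measurable M" for i
      proof -
        have "set_integrable M D (\<lambda>x. (\<Theta> (a (h i) x) - \<Theta> (a 0 x)) / h i)"
          using \<epsilon> by (intro set_integrable_divide set_integral_diff int he) auto
        then show ?thesis by (simp add: set_integrable_def borel_measurable_integrable)
      qed
      show "integrable M (\<lambda>x. indicator D x *\<^sub>R \<bar>B\<bar>)" using D by auto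
      show "AE x in M. (\<lambda>i. indicator D x *\<^sub>R ((\<Theta> (a (h i) x) - \<Theta> (a 0 x)) / h i))
          \<longlonglongrightarrow> indicator D x *\<^sub>R \<Theta>' (a 0 x)"
      proof (intro AE_I2)
        fix x
        show "(\<lambda>i. indicator D x *\<^sub>R ((\<Theta> (a (h i) x) - \<Theta> (a 0 x)) / h i))
          \<longlonglongrightarrow> indicator D x *\<^sub>R \<Theta>' (a 0 x)"
        proof (cases "x \<in> D")
          case True
          have "((\<lambda>k. (\<Theta> (a k x) - \<Theta> (a 0 x)) / k) \<longlongrightarrow> \<Theta>' (a 0 x)) (at 0)"
            using deriv[OF _ True, of 0] \<epsilon> by (simp add: DERIV_def)
          then have "(\<lambda>i. (\<Theta> (a (h i) x) - \<Theta> (a 0 x)) / h i) \<longlonglongrightarrow> \<Theta>' (a 0 x)"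
            unfolding tendsto_at_iff_sequentially o_def using h(2) he(2) by simp
          then show ?thesis using True by simp
        qed simp
      qed
      show "AE x in M. norm (indicator D x *\<^sub>R ((\<Theta> (a (h i) x) - \<Theta> (a 0 x)) / h i)) \<le> indicator D x *\<^sub>R \<bar>B\<bar>" for i
      proof (intro AE_I2)
        fix x
        show "norm (indicator D x *\<^sub>R ((\<Theta> (a (h i) x) - \<Theta> (a 0 x)) / h i)) \<le> indicator D x *\<^sub>R \<bar>B\<bar>"
        proof (cases "x \<in> D")
          case True
          have "norm (\<Theta> (a (h i) x) - \<Theta> (a 0 x)) \<le> B * norm (h i - 0)"
          proof (rule field_differentiable_bound[of "{- \<epsilon><..<\<epsilon>}" _ "\<lambda>t. \<Theta>' (a t x)"])
            show "((\<lambda>t. \<Theta> (a t x)) has_field_derivative \<Theta>' (a t x)) (at t within {- \<epsilon><..<\<epsilon>})"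
              if "t \<in> {- \<epsilon><..<\<epsilon>}" for t
              using deriv[of t x] that True by (auto intro: has_field_derivative_at_within simp: abs_less_iff)
            show "norm (\<Theta>' (a t x)) \<le> B" if "t \<in> {- \<epsilon><..<\<epsilon>}" for t
              using B a(2) that True by (auto simp: abs_less_iff)
          qed (use \<epsilon> h(1) in auto)
          also have "\<dots> \<le> \<bar>B\<bar> * \<bar>h i\<bar>" by (simp add: mult_right_mono)
          finally show ?thesis using True he(2)[of i] by (simp add: abs_divide divide_le_eq)
        qed simp
      qed
    qed
    then show "(\<lambda>i. ((LINT x:D|M. \<Theta> (a (h i) x)) - (LINT x:D|M. \<Theta> (a 0 x))) / h i)
        \<longlonglongrightarrow> (LINT x:D|M. \<Theta>' (a 0 x))"
      unfolding quot by (simp only: set_lebesgue_integral_def)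
  qed
  then show ?thesis unfolding at0[symmetric] by (simp add: DERIV_def)
qed

section \<open>Energy density and stress along a line of deformation gradients\<close>

lemma matrix_entry_sum: "G = (\<Sum>i\<in>UNIV. \<Sum>j\<in>UNIV. (G $ i $ j) *\<^sub>R axis i (axis j (1::real)))"
proof -
  have "(\<Sum>i\<in>UNIV. \<Sum>j\<in>UNIV. (G $ i $ j) *\<^sub>R axis i (axis j (1::real))) $ a $ b = G $ a $ b" for a b
  proof -
    have "(\<Sum>i\<in>UNIV. \<Sum>j\<in>UNIV. (G $ i $ j) *\<^sub>R axis i (axis j (1::real))) $ a $ b
        = (\<Sum>i\<in>UNIV. \<Sum>j\<in>UNIV. if i = a then if j = b then G $ a $ b else 0 else 0)"
      unfolding sum_component by (intro sum.cong refl) (auto simp: axis_def)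
    also have "\<dots> = (\<Sum>i\<in>UNIV. if i = a then G $ a $ b else 0)"
      by (intro sum.cong refl) auto
    finally show ?thesis by simp
  qed
  then show ?thesis by (simp add: vec_eq_iff)
qed

lemma entry_deriv_sum:
  assumes "W differentiable (at F)"
  shows "frechet_derivative W (at F) G = (\<Sum>i\<in>UNIV. \<Sum>j\<in>UNIV. entry_deriv i j W F * G $ i $ j)"
proof -
  have lin: "linear (frechet_derivative W (at F))" using assms by (rule linear_frechet_derivative)
  show ?thesis
    by (subst matrix_entry_sum[of G])
       (simp add: linear_sum[OF lin] linear_scale[OF lin] entry_deriv_def mult.commute)
qed

lemma Ck_on_SucD:
  fixes W :: "real ^ 'd ^ 'd \<Rightarrow> real"
  assumes "Ck_on (Suc k) U W"
  shows "W differentiable_on U" "Ck_on k U (entry_deriv i j W)"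
proof -
  have "axis i (axis j (1::real)) \<in> Basis" by (auto simp: Basis_vec_def)
  then show "W differentiable_on U" "Ck_on k U (entry_deriv i j W)"
    using assms by (auto simp: entry_deriv_def[abs_def])
qed

lemma Ck_on_continuous: "Ck_on k U W \<Longrightarrow> continuous_on U W"
  by (cases k) (auto simp: differentiable_imp_continuous_on)

lemma has_real_derivative_along_line:
  fixes W :: "real ^ 'd ^ 'd \<Rightarrow> real"
  assumes "open U" "W differentiable_on U" "F + t *\<^sub>R G \<in> U"
  shows "((\<lambda>t. W (F + t *\<^sub>R G)) has_real_derivative
           (\<Sum>i\<in>UNIV. \<Sum>j\<in>UNIV. entry_deriv i j W (F + t *\<^sub>R G) * G $ i $ j)) (at t)"
proof -
  let ?X = "F + t *\<^sub>R G"
  have diff: "W differentiable (at ?X)"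
    using assms by (metis at_within_open differentiable_on_def)
  have "((\<lambda>t. F + t *\<^sub>R G) has_derivative (\<lambda>s. s *\<^sub>R G)) (at t)"
    by (auto intro!: derivative_eq_intros)
  from has_derivative_compose[OF this, of W "frechet_derivative W (at ?X)"] diff
  have "((\<lambda>t. W (F + t *\<^sub>R G)) has_derivative (\<lambda>s. frechet_derivative W (at ?X) (s *\<^sub>R G))) (at t)"
    by (simp add: frechet_derivative_works)
  moreover have "frechet_derivative W (at ?X) (s *\<^sub>R G)
      = (\<Sum>i\<in>UNIV. \<Sum>j\<in>UNIV. entry_deriv i j W ?X * G $ i $ j) * s" for s
    using linear_scale[OF linear_frechet_derivative[OF diff], of s G]
    by (simp add: entry_deriv_sum[OF diff, of G])
  ultimately show ?thesis by (simp add: has_field_derivative_def)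
qed

lemma continuous_on_ddot [continuous_intros]:
  "continuous_on S A \<Longrightarrow> continuous_on S B \<Longrightarrow> continuous_on S (\<lambda>x. ddot (A x) (B x))"
  unfolding ddot_def by (intro continuous_intros)

lemma continuous_on_nBv [continuous_intros]:
  "continuous_on S n \<Longrightarrow> continuous_on S B \<Longrightarrow> continuous_on S v \<Longrightarrow> continuous_on S (\<lambda>x. nBv (n x) (B x) (v x))"
  unfolding nBv_def by (intro continuous_intros)

locale smooth_energy =
  fixes U :: "(real ^ 'd ^ 'd) set" and \<Psi> :: "real ^ 'd ^ 'd \<Rightarrow> real"
  assumes open_U: "open U" and smooth: "Ck_on 3 U \<Psi>"
begin

lemma smooth': "Ck_on (Suc (Suc (Suc 0))) U \<Psi>"
  using smooth by (simp add: numeral_3_eq_3)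

lemma Ck_stress: "Ck_on (Suc (Suc 0)) U (\<lambda>F. stress \<Psi> F $ i $ j)"
  using Ck_on_SucD(2)[OF smooth', of i j] by (simp only: stress_def vec_lambda_beta)

lemma Ck_elast: "Ck_on (Suc 0) U (\<lambda>F. elast \<Psi> F i j k l)"
  using Ck_on_SucD(2)[OF Ck_stress, of k l i j] by (simp only: elast_def)

lemma continuous_on_energy [continuous_intros]:
  "continuous_on S F \<Longrightarrow> F ` S \<subseteq> U \<Longrightarrow> continuous_on S (\<lambda>x. \<Psi> (F x))"
  by (rule continuous_on_compose2[OF Ck_on_continuous[OF smooth]])

lemma continuous_on_elast [continuous_intros]:
  "continuous_on S F \<Longrightarrow> F ` S \<subseteq> U \<Longrightarrow> continuous_on S (\<lambda>x. elast \<Psi> (F x) i j k l)"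
  by (rule continuous_on_compose2[OF Ck_on_continuous[OF Ck_elast]])

lemma continuous_on_stress [continuous_intros]:
  assumes "continuous_on S F" "F ` S \<subseteq> U" shows "continuous_on S (\<lambda>x. stress \<Psi> (F x))"
proof -
  have "continuous_on S (\<lambda>x. stress \<Psi> (F x) $ i $ j)" for i j
    by (rule continuous_on_compose2[OF Ck_on_continuous[OF Ck_stress] assms])
  then have "continuous_on S (\<lambda>x. \<chi> i j. stress \<Psi> (F x) $ i $ j)"
    by (intro continuous_on_vec_lambda)
  then show ?thesis by simp
qed

lemma continuous_on_elast_app [continuous_intros]:
  "continuous_on S F \<Longrightarrow> F ` S \<subseteq> U \<Longrightarrow> continuous_on S G \<Longrightarrow> continuous_on S (\<lambda>x. elast_app \<Psi> (F x) (G x))"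
  unfolding elast_app_def by (intro continuous_on_vec_lambda continuous_intros)

lemma continuous_on_elast_norm1 [continuous_intros]:
  "continuous_on S F \<Longrightarrow> F ` S \<subseteq> U \<Longrightarrow> continuous_on S (\<lambda>x. elast_norm1 \<Psi> (F x))"
  unfolding elast_norm1_def by (intro continuous_intros)

lemma energy_derivative:
  assumes "F + t *\<^sub>R G \<in> U"
  shows "((\<lambda>t. \<Psi> (F + t *\<^sub>R G)) has_real_derivative ddot (stress \<Psi> (F + t *\<^sub>R G)) G) (at t)"
  using has_real_derivative_along_line[OF open_U Ck_on_SucD(1)[OF smooth'] assms]
  by (simp add: ddot_def stress_def)

lemma stress_derivative:
  assumes "F + t *\<^sub>R G \<in> U"
  shows "((\<lambda>t. stress \<Psi> (F + t *\<^sub>R G) $ i $ j) has_real_derivative elast_app \<Psi> (F + t *\<^sub>R G) G $ i $ j) (at t)"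
  using has_real_derivative_along_line[OF open_U Ck_on_SucD(1)[OF Ck_stress, of i j] assms]
  by (simp add: elast_app_def elast_def)

text \<open>Stress and displacement both vary, so the product rule leaves two terms. At
  \<open>t = 0\<close> the first pairs the linearised traction with the iterate, the symmetrising
  term of the residual; the second is its consistency term.\<close>

lemma traction_work_derivative:
  assumes "F + t *\<^sub>R G \<in> U"
  shows "((\<lambda>t. nBv n (stress \<Psi> (F + t *\<^sub>R G)) (u + t *\<^sub>R w)) has_real_derivative
     nBv n (elast_app \<Psi> (F + t *\<^sub>R G) G) (u + t *\<^sub>R w) + nBv n (stress \<Psi> (F + t *\<^sub>R G)) w) (at t)"
proof -
  let ?S = "\<lambda>t. stress \<Psi> (F + t *\<^sub>R G)" and ?L = "elast_app \<Psi> (F + t *\<^sub>R G) G"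
  have "((\<lambda>t. (u + t *\<^sub>R w) $ i * ?S t $ i $ j * n $ j) has_real_derivative
      ((u + t *\<^sub>R w) $ i * ?L $ i $ j + w $ i * ?S t $ i $ j) * n $ j) (at t)" for i j
  proof -
    have "((\<lambda>t. (u + t *\<^sub>R w) $ i) has_real_derivative w $ i) (at t)"
      by (auto intro!: derivative_eq_intros)
    from DERIV_cmult_right[OF DERIV_mult[OF this stress_derivative[OF assms, of i j]], of "n $ j"]
    show ?thesis by (simp add: algebra_simps)
  qed
  then have "((\<lambda>t. \<Sum>i\<in>UNIV. \<Sum>j\<in>UNIV. (u + t *\<^sub>R w) $ i * ?S t $ i $ j * n $ j) has_real_derivative
      (\<Sum>i\<in>UNIV. \<Sum>j\<in>UNIV. ((u + t *\<^sub>R w) $ i * ?L $ i $ j + w $ i * ?S t $ i $ j) * n $ j)) (at t)"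
    by (intro DERIV_sum)
  then show ?thesis by (simp add: nBv_def distrib_right sum.distrib)
qed

end

section \<open>Ghost penalty and positivity of the norm\<close>

text \<open>Distinct cells differ in some grid index, and in that coordinate their intervals share
  at most the lower end of the later one. Ghost faces are thus flat, hence of finite surface
  measure.\<close>

lemma cartesian_mesh_cells_meet_in_hyperplane:
  fixes \<T> :: "(real ^ 'd) set set"
  assumes "cartesian_mesh \<T>" "S \<in> \<T>" "T \<in> \<T>" "S \<noteq> T"
  shows "\<exists>i a. \<forall>x\<in>S \<inter> T. x $ i = a"
proof -
  obtain g :: "'d \<Rightarrow> nat \<Rightarrow> real" and N :: "'d \<Rightarrow> nat" where
    gN: "(\<forall>i. N i \<ge> 1 \<and> (\<forall>j<N i. g i j < g i (Suc j))) \<and>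
      \<T> = {cbox (\<chi> i. g i (k i)) (\<chi> i. g i (Suc (k i))) | k. \<forall>i. k i < N i}"
    using assms(1) unfolding cartesian_mesh_def by (elim exE)
  have g: "g i j < g i (Suc j)" if "j < N i" for i j using gN that by simp
  have T: "\<T> = {cbox (\<chi> i. g i (k i)) (\<chi> i. g i (Suc (k i))) | k. \<forall>i. k i < N i}"
    using gN by (rule conjunct2)
  have mono: "g i j \<le> g i k" if "j \<le> k" "k \<le> N i" for i j k
    using that
  proof (induction k rule: dec_induct)
    case (step k)
    then show ?case using g[of k i] by simp
  qed simp
  obtain k l where k: "S = cbox (\<chi> i. g i (k i)) (\<chi> i. g i (Suc (k i)))" "\<forall>i. k i < N i"
    and l: "T = cbox (\<chi> i. g i (l i)) (\<chi> i. g i (Suc (l i)))" "\<forall>i. l i < N i"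
    using assms(2,3) unfolding T by blast
  have "k \<noteq> l" using assms(4) k(1) l(1) by blast
  then obtain i where "k i \<noteq> l i" by blast
  moreover have "x $ i = g i (max (k i) (l i))" if "x \<in> S \<inter> T" "k i \<noteq> l i" for x
  proof -
    have x: "g i (k i) \<le> x $ i" "x $ i \<le> g i (Suc (k i))" "g i (l i) \<le> x $ i" "x $ i \<le> g i (Suc (l i))"
      using that(1) by (auto simp: k l mem_box_cart)
    show ?thesis
    proof (cases "k i < l i")
      case True
      then have "g i (Suc (k i)) \<le> g i (l i)" using l(2) by (intro mono) (auto intro: less_imp_le)
      then show ?thesis using x True by (simp add: max_def)
    next
      case False
      then have "g i (Suc (l i)) \<le> g i (k i)" using that(2) k(2) by (intro mono) (auto intro: less_imp_le)
      then show ?thesis using x False by (simp add: max_def)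
    qed
  qed
  ultimately show ?thesis by blast
qed

section \<open>Jumps across ghost faces\<close>

context cut_mesh
begin

lemma ghost_face_cells:
  assumes "F \<in> ghost_faces \<Omega> \<T>"
  shows "fst (face_cells \<Omega> \<T> F) \<in> active_cells \<Omega> \<T>" "snd (face_cells \<Omega> \<T> F) \<in> active_cells \<Omega> \<T>"
    "fst (face_cells \<Omega> \<T> F) \<noteq> snd (face_cells \<Omega> \<T> F)"
    "F = fst (face_cells \<Omega> \<T> F) \<inter> snd (face_cells \<Omega> \<T> F)"
proof -
  let ?P = "\<lambda>(T1, T2). T1 \<in> cut_cells \<Omega> \<T> \<and> T2 \<in> active_cells \<Omega> \<T> \<and> T1 \<noteq> T2 \<and> F = T1 \<inter> T2"
  have "\<exists>z. ?P z" using assms by (auto simp: ghost_faces_def)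
  from someI_ex[OF this] have "?P (face_cells \<Omega> \<T> F)" unfolding face_cells_def .
  then show "fst (face_cells \<Omega> \<T> F) \<in> active_cells \<Omega> \<T>" "snd (face_cells \<Omega> \<T> F) \<in> active_cells \<Omega> \<T>"
    "fst (face_cells \<Omega> \<T> F) \<noteq> snd (face_cells \<Omega> \<T> F)"
    "F = fst (face_cells \<Omega> \<T> F) \<inter> snd (face_cells \<Omega> \<T> F)"
    by (auto simp: cut_cells_def case_prod_beta)
qed

lemma compact_ghost_face:
  assumes "F \<in> ghost_faces \<Omega> \<T>" shows "compact F"
  using ghost_face_cells[OF assms] solid_box_active solid_box_compact
  by (metis compact_Int)

lemma emeasure_ghost_face_finite:
  assumes "F \<in> ghost_faces \<Omega> \<T>" shows "emeasure surf F < top"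
proof -
  let ?S = "fst (face_cells \<Omega> \<T> F)" and ?T = "snd (face_cells \<Omega> \<T> F)"
  have "?S \<in> \<T>" "?T \<in> \<T>" "cartesian_mesh \<T>"
    using ghost_face_cells[OF assms] mesh by (auto simp: active_cells_def background_mesh_def)
  then obtain i a where "\<forall>x\<in>?S \<inter> ?T. x $ i = a"
    using cartesian_mesh_cells_meet_in_hyperplane ghost_face_cells(3)[OF assms] by blast
  then have "\<And>x. x \<in> F \<Longrightarrow> x $ i = a" using ghost_face_cells(4)[OF assms] by blast
  then show ?thesis
    using compact_ghost_face[OF assms]
    by (intro emeasure_surf_hyperplane_finite) (auto intro: borel_compact compact_imp_bounded)
qed

lemma normal_jump_add_scaleR:
  assumes "F \<in> ghost_faces \<Omega> \<T>" "u \<in> V_h \<Omega> \<T> p" "w \<in> V_h \<Omega> \<T> p" "x \<in> F"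
  shows "normal_jump \<Omega> \<T> F k (\<lambda>x. u x + t *\<^sub>R w x) x
       = normal_jump \<Omega> \<T> F k u x + t *\<^sub>R normal_jump \<Omega> \<T> F k w x"
proof -
  let ?S = "fst (face_cells \<Omega> \<T> F)" and ?T = "snd (face_cells \<Omega> \<T> F)" and ?n = "face_normal F"
  note cells = ghost_face_cells[OF assms(1)]
  have x: "x \<in> ?S" "x \<in> ?T" using cells(4) assms(4) by auto
  have lin: "(cell_dir_deriv T ?n ^^ k) (\<lambda>x. u x + t *\<^sub>R w x) x
      = (cell_dir_deriv T ?n ^^ k) u x + t *\<^sub>R (cell_dir_deriv T ?n ^^ k) w x"
    if T: "T \<in> active_cells \<Omega> \<T>" "x \<in> T" for T
  proof -
    obtain q r where "poly_on T q u" "poly_on T r w"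
      using V_h_poly_on[OF assms(2) T(1)] V_h_poly_on[OF assms(3) T(1)] by metis
    then show ?thesis by (rule cell_dir_deriv_funpow_add_scaleR[OF solid_box_active[OF T(1)] T(2)])
  qed
  show ?thesis
    unfolding normal_jump_def lin[OF cells(1) x(1)] lin[OF cells(2) x(2)]
    by (simp add: algebra_simps)
qed

lemma continuous_on_normal_jump:
  assumes "F \<in> ghost_faces \<Omega> \<T>" "w \<in> V_h \<Omega> \<T> p"
  shows "continuous_on F (normal_jump \<Omega> \<T> F k w)"
proof -
  let ?S = "fst (face_cells \<Omega> \<T> F)" and ?T = "snd (face_cells \<Omega> \<T> F)" and ?n = "face_normal F"
  note cells = ghost_face_cells[OF assms(1)]
  have cont: "continuous_on F ((cell_dir_deriv T ?n ^^ k) w)"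
    if T: "T \<in> active_cells \<Omega> \<T>" "F \<subseteq> T" for T
  proof -
    obtain q where "poly_on T q w" using V_h_poly_on[OF assms(2) T(1)] .
    then have q: "poly_on T ((dir_deriv ?n ^^ k) q) ((cell_dir_deriv T ?n ^^ k) w)"
      by (rule poly_on_cell_dir_deriv_funpow[OF solid_box_active[OF T(1)]])
    then have "continuous_on F ((dir_deriv ?n ^^ k) q)"
      by (intro continuous_on_polymonial_function) (simp add: poly_on_def)
    then show ?thesis
      by (rule continuous_on_eq) (use q T(2) in \<open>auto simp: poly_on_def\<close>)
  qed
  have "F \<subseteq> ?S" "F \<subseteq> ?T" using cells(4) by auto
  then have "continuous_on F (\<lambda>x. (cell_dir_deriv ?S ?n ^^ k) w x - (cell_dir_deriv ?T ?n ^^ k) w x)"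
    by (intro continuous_on_diff cont cells)
  then show ?thesis unfolding normal_jump_def[abs_def] .
qed

text \<open>Linearity of the jumps makes the ghost energy an exact quadratic in \<open>t\<close>.
  The splitting is legitimate because the jumps are continuous on a compact face of finite
  measure.\<close>

lemma ghost_face_form_expand:
  assumes F: "F \<in> ghost_faces \<Omega> \<T>" and u: "u \<in> V_h \<Omega> \<T> p" and w: "w \<in> V_h \<Omega> \<T> p"
  shows "ghost_face_form \<Omega> \<T> p F (\<lambda>x. u x + t *\<^sub>R w x) (\<lambda>x. u x + t *\<^sub>R w x)
    = ghost_face_form \<Omega> \<T> p F u u + 2 * t * ghost_face_form \<Omega> \<T> p F u w + t\<^sup>2 * ghost_face_form \<Omega> \<T> p F w w"
proof -
  have FB: "F \<in> sets surf" using compact_ghost_face[OF F] by (simp add: borel_compact)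
  have int: "set_integrable surf F (\<lambda>x. normal_jump \<Omega> \<T> F k v x \<bullet> normal_jump \<Omega> \<T> F k v' x)"
    if "v \<in> V_h \<Omega> \<T> p" "v' \<in> V_h \<Omega> \<T> p" for k v v'
  proof (rule set_integrable_continuous_comp[of F surf F _ "\<lambda>x. x"])
    show "continuous_on F (\<lambda>x. normal_jump \<Omega> \<T> F k v x \<bullet> normal_jump \<Omega> \<T> F k v' x)"
      using that by (intro continuous_on_inner) (rule continuous_on_normal_jump[OF F], assumption)+
    show "(\<lambda>x. x) \<in> borel_measurable (restrict_space surf F)"
      by (intro measurable_restrict_space1) (simp add: measurable_def)
  qed (use FB compact_ghost_face[OF F] emeasure_ghost_face_finite[OF F] in auto)
  have "(LINT x:F|surf. normal_jump \<Omega> \<T> F k (\<lambda>x. u x + t *\<^sub>R w x) x \<bullet> normal_jump \<Omega> \<T> F k (\<lambda>x. u x + t *\<^sub>R w x) x)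
    = (LINT x:F|surf. normal_jump \<Omega> \<T> F k u x \<bullet> normal_jump \<Omega> \<T> F k u x)
    + 2 * t * (LINT x:F|surf. normal_jump \<Omega> \<T> F k u x \<bullet> normal_jump \<Omega> \<T> F k w x)
    + t\<^sup>2 * (LINT x:F|surf. normal_jump \<Omega> \<T> F k w x \<bullet> normal_jump \<Omega> \<T> F k w x)" for k
  proof -
    let ?j = "normal_jump \<Omega> \<T> F k"
    have "(LINT x:F|surf. ?j (\<lambda>x. u x + t *\<^sub>R w x) x \<bullet> ?j (\<lambda>x. u x + t *\<^sub>R w x) x)
      = (LINT x:F|surf. ?j u x \<bullet> ?j u x + 2 * t * (?j u x \<bullet> ?j w x) + t\<^sup>2 * (?j w x \<bullet> ?j w x))"
      by (intro set_lebesgue_integral_cong FB)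
         (auto simp: normal_jump_add_scaleR[OF F u w] inner_add_left inner_add_right inner_commute power2_eq_square algebra_simps)
    also have "\<dots> = (LINT x:F|surf. ?j u x \<bullet> ?j u x) + (LINT x:F|surf. 2 * t * (?j u x \<bullet> ?j w x))
        + (LINT x:F|surf. t\<^sup>2 * (?j w x \<bullet> ?j w x))"
      by (subst set_integral_add(2), intro set_integral_add(1) int u w set_integrable_mult_right,
          intro int u w set_integrable_mult_right, subst set_integral_add(2))
         (intro int u w set_integrable_mult_right refl)+
    finally show ?thesis by simp
  qed
  then show ?thesis
    unfolding ghost_face_form_def
    by (simp add: distrib_left sum.distrib sum_distrib_left mult_ac)
qed

lemma ghost_form_expand:
  assumes u: "u \<in> V_h \<Omega> \<T> p" and w: "w \<in> V_h \<Omega> \<T> p"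
  shows "ghost_form \<Omega> \<T> p (\<lambda>x. u x + t *\<^sub>R w x) (\<lambda>x. u x + t *\<^sub>R w x)
    = ghost_form \<Omega> \<T> p u u + 2 * t * ghost_form \<Omega> \<T> p u w + t\<^sup>2 * ghost_form \<Omega> \<T> p w w"
  unfolding ghost_form_def
  by (simp add: ghost_face_form_expand[OF _ u w] sum.distrib sum_distrib_left cong: sum.cong)

lemma ghost_form_nonneg: "0 \<le> ghost_form \<Omega> \<T> p w w"
  unfolding ghost_form_def ghost_face_form_def
proof (intro sum_nonneg mult_nonneg_nonneg divide_nonneg_nonneg zero_le_power)
  fix F k assume F: "F \<in> ghost_faces \<Omega> \<T>"
  show "0 \<le> diameter F" using compact_ghost_face[OF F] compact_imp_bounded diameter_ge_0 by blast
  show "0 \<le> (LINT x:F|surf. normal_jump \<Omega> \<T> F k w x \<bullet> normal_jump \<Omega> \<T> F k w x)"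
    unfolding set_lebesgue_integral_def by (intro Bochner_Integration.integral_nonneg) simp
qed auto

lemma mesh_size_pos: "0 < mesh_size \<T>"
proof -
  obtain T where T: "T \<in> \<T>"
  proof -
    obtain x where "x \<in> \<Omega>" using domain unfolding lipschitz_domain_def by blast
    then show ?thesis using mesh that unfolding background_mesh_def by blast
  qed
  then have "solid_box T" using mesh cartesian_mesh_solid_box by (auto simp: background_mesh_def)
  then obtain a b where ab: "T = cbox a b" "\<forall>i. a $ i < b $ i" by (auto simp: solid_box_def)
  then have "a \<noteq> b" "a \<in> T" "b \<in> T" by (auto simp: mem_box_cart less_imp_le)
  then have "0 < dist a b" "dist a b \<le> diameter T"
    using diameter_bounded_bound[of T a b] ab(1) bounded_cbox by auto
  moreover have "diameter T \<le> mesh_size \<T>"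
    unfolding mesh_size_def using T finite_mesh by (intro Max_ge) auto
  ultimately show ?thesis by linarith
qed

section \<open>Vanishing gradients and positivity of the norm\<close>

lemma emeasure_lebesgue_domain_finite: "emeasure lebesgue \<Omega> < \<infinity>"
proof -
  have "\<Omega> \<in> lmeasurable" using domain by (auto simp: lipschitz_domain_def intro: lmeasurable_open)
  then show ?thesis using fmeasurableD2 by (metis infinity_ennreal_def less_top)
qed

text \<open>Leaving \<open>M\<close> open lets one statement serve both \<open>lebesgue\<close> on
  \<Omega> and \<open>surf\<close> on the frontier.\<close>

lemma borel_measurable_restrict_of_closure:
  fixes f :: "real ^ 'd \<Rightarrow> 'b::euclidean_space"
  assumes f: "(\<lambda>X. indicator (closure \<Omega>) X *\<^sub>R f X) \<in> borel_measurable borel"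
    and D: "D \<in> sets borel" "D \<subseteq> closure \<Omega>" and M: "sets borel \<subseteq> sets M" "space M = UNIV"
  shows "f \<in> borel_measurable (restrict_space M D)"
proof -
  have "(\<lambda>X. indicator D X *\<^sub>R (indicator (closure \<Omega>) X *\<^sub>R f X)) \<in> borel_measurable borel"
    using f D(1) by measurable
  moreover have "(\<lambda>X. indicator D X *\<^sub>R (indicator (closure \<Omega>) X *\<^sub>R f X)) = (\<lambda>X. indicator D X *\<^sub>R f X)"
    using D(2) by (intro ext) (auto split: split_indicator)
  ultimately have "(\<lambda>X. indicator D X *\<^sub>R f X) \<in> borel_measurable borel" by simp
  then have "(\<lambda>X. indicator D X *\<^sub>R f X) \<in> borel_measurable M"
    using M by (auto simp: measurable_def)
  then show ?thesis using D(1) M by (subst borel_measurable_restrict_space_iff) auto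
qed

text \<open>The integral sees the gradient only almost everywhere in \<Omega> and only through trace
  cells. As each cell carries one polynomial, a zero gradient on a nonempty open part of the cell is
  enough; continuity on the connected \<Omega> then identifies the constants.\<close>

lemma constant_of_gradient_zero:
  assumes w: "w \<in> V_h \<Omega> \<T> p"
    and zero: "(LINT X:\<Omega>|lebesgue. (norm (grad \<Omega> \<T> w X))\<^sup>2) = 0"
  obtains c where "\<And>X. X \<in> active_domain \<Omega> \<T> \<Longrightarrow> w X = c"
proof -
  let ?A = "active_cells \<Omega> \<T>"
  have \<Omega>: "open \<Omega>" "connected \<Omega>" "\<Omega> \<noteq> {}" using domain by (auto simp: lipschitz_domain_def)
  have sub: "\<Omega> \<subseteq> closure \<Omega>" by (rule closure_subset)
  obtain B where B: "\<And>X. X \<in> closure \<Omega> \<Longrightarrow> norm (grad \<Omega> \<T> w X) \<le> B" using grad_bounded[OF w] by metis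
  have "grad \<Omega> \<T> w \<in> borel_measurable (restrict_space lebesgue \<Omega>)"
    by (rule borel_measurable_restrict_of_closure[OF borel_measurable_grad[OF w]]) (use \<Omega> sub in auto)
  then have "set_integrable lebesgue \<Omega> (\<lambda>X. (norm (grad \<Omega> \<T> w X))\<^sup>2)"
    by (intro set_integrable_continuous_comp[of \<Omega> lebesgue "cball 0 B" "\<lambda>M. (norm M)\<^sup>2"])
       (use \<Omega> sub B emeasure_lebesgue_domain_finite in \<open>auto intro!: continuous_intros\<close>)
  then have "AE X in lebesgue. indicator \<Omega> X *\<^sub>R (norm (grad \<Omega> \<T> w X))\<^sup>2 = (0::real)"
    using zero integral_nonneg_eq_0_iff_AE[of lebesgue "\<lambda>X. indicator \<Omega> X *\<^sub>R (norm (grad \<Omega> \<T> w X))\<^sup>2"]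
    by (simp add: set_integrable_def set_lebesgue_integral_def)
  then obtain N1 where N1: "N1 \<in> null_sets lebesgue"
    "{X \<in> space lebesgue. \<not> (indicator \<Omega> X *\<^sub>R (norm (grad \<Omega> \<T> w X))\<^sup>2 = (0::real))} \<subseteq> N1"
    unfolding eventually_ae_filter by blast
  \<comment> \<open>Off the cell frontiers a point is interior to its trace cell, so the derivative
    within that cell is the full one and agrees with that of any cell around the point.\<close>
  define N where "N = N1 \<union> (\<Union>T\<in>?A. frontier T)"
  have "negligible (\<Union>T\<in>?A. frontier T)"
    using finite_active solid_box_active solid_box_convex
    by (intro negligible_Union) (auto intro: negligible_convex_frontier)
  then have N: "negligible N"
    unfolding N_def using N1(1) negligible_iff_null_sets by blast
  have const_cell: "\<exists>c. \<forall>X\<in>T. w X = c" if T: "T \<in> ?A" for T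
  proof -
    obtain q where q: "poly_on T q w" using V_h_poly_on[OF w T] .
    have sT: "solid_box T" by (rule solid_box_active[OF T])
    define G where "G = interior T \<inter> \<Omega>"
    have G: "open G" unfolding G_def using \<Omega> by auto
    \<comment> \<open>Activity yields only a common point, possibly on the boundary of
      \<open>T\<close>. As \<Omega> is open and the box is the closure of its interior, the interior
      meets \<Omega> too.\<close>
    have "T \<inter> \<Omega> \<noteq> {}" using T by (simp add: active_cells_def)
    then have "closure (interior T) \<inter> \<Omega> \<noteq> {}"
      using solid_box_subset_closure_interior[OF sT] by blast
    then have "G \<noteq> {}" unfolding G_def using open_Int_closure_eq_empty[OF \<Omega>(1), of "interior T"] by blast
    then obtain x0 where x0: "x0 \<in> G" by blast
    have outside: "dir_deriv h q X = 0" if X: "X \<in> G" "X \<notin> N" for X h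
    proof -
      have X\<Omega>: "X \<in> \<Omega>" "X \<in> interior T" using X by (auto simp: G_def)
      have Xc: "X \<in> closure \<Omega>" using X\<Omega>(1) sub by blast
      let ?T = "trace_cell \<Omega> \<T> X"
      have "X \<in> ?T" "X \<notin> frontier ?T"
        using trace_cell_props[OF Xc] X(2) by (auto simp: N_def)
      then have "X \<in> interior ?T" by (auto simp: frontier_def closure_def)
      then have "cell_grad T w X = grad \<Omega> \<T> w X"
        unfolding grad_def cell_grad_def by (metis X\<Omega>(2) at_within_interior)
      moreover have "grad \<Omega> \<T> w X = 0"
      proof (rule ccontr)
        assume "grad \<Omega> \<T> w X \<noteq> 0"
        then have "X \<in> {X \<in> space lebesgue. \<not> (indicator \<Omega> X *\<^sub>R (norm (grad \<Omega> \<T> w X))\<^sup>2 = (0::real))}"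
          using X\<Omega>(1) by simp
        then show False using N1(2) X(2) unfolding N_def by blast
      qed
      ultimately show ?thesis
        using dir_deriv_eq_0_of_cell_grad_eq_0[OF sT q subsetD[OF interior_subset X\<Omega>(2)]] by simp
    qed
    \<comment> \<open>From almost everywhere to everywhere: by continuity the points of
      \<open>G\<close> with nonzero derivative form an open set, and a nonempty open set is not
      negligible.\<close>
    have "dir_deriv h q X = 0" if "X \<in> G" for X h
    proof (rule ccontr)
      assume ne: "dir_deriv h q X \<noteq> 0"
      have "continuous_on UNIV (dir_deriv h q)"
        using q by (intro continuous_on_polymonial_function polynomial_function_dir_deriv) (simp add: poly_on_def)
      then have "open (dir_deriv h q -` (- {0}))"
        by (rule open_vimage[rotated]) auto
      then have "open (G \<inter> dir_deriv h q -` (- {0}))" using G by auto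
      moreover have "G \<inter> dir_deriv h q -` (- {0}) \<noteq> {}" using that ne by auto
      moreover have "G \<inter> dir_deriv h q -` (- {0}) \<subseteq> N" using outside by auto
      ultimately show False using open_not_negligible negligible_subset[OF N] by blast
    qed
    then have "q X = q x0" for X
      by (intro polynomial_function_constant_on_open[OF _ G x0]) (use q in \<open>auto simp: poly_on_def\<close>)
    then show ?thesis using q unfolding poly_on_def by metis
  qed
  then obtain c where c: "\<And>T X. T \<in> ?A \<Longrightarrow> X \<in> T \<Longrightarrow> w X = c T" by metis
  \<comment> \<open>A connected set of finitely many values is a singleton; this glues the cells
    without following chains of neighbours.\<close>
  have "w ` \<Omega> \<subseteq> c ` ?A" using c domain_subset_active by (fastforce simp: active_domain_def)
  then have "finite (w ` \<Omega>)" using finite_active finite_surj by blast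
  moreover have "continuous_on \<Omega> w" using V_h_continuous_on_closure[OF w] sub continuous_on_subset by blast
  then have "connected (w ` \<Omega>)" using \<Omega>(2) by (rule connected_continuous_image)
  ultimately obtain c0 where "w ` \<Omega> = {c0}" using connected_finite_iff_sing \<Omega>(3) by blast
  then have c0: "\<And>X. X \<in> \<Omega> \<Longrightarrow> w X = c0" by blast
  have "w X = c0" if X: "X \<in> active_domain \<Omega> \<T>" for X
  proof -
    obtain T where T: "T \<in> ?A" "X \<in> T" using X by (auto simp: active_domain_def)
    then obtain Y where "Y \<in> T" "Y \<in> \<Omega>" by (auto simp: active_cells_def)
    then show ?thesis using c[OF T(1)] c0 T(2) by metis
  qed
  then show thesis by (rule that)
qed

lemma triple_norm_pos:
  assumes w: "w \<in> V_h \<Omega> \<T> p" and ne: "\<exists>X\<in>active_domain \<Omega> \<T>. w X \<noteq> 0" and "0 < \<gamma>\<^sub>A"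
  shows "0 < (triple_norm \<Omega> \<T> p \<gamma>\<^sub>A w)\<^sup>2"
proof -
  let ?g = "LINT X:\<Omega>|lebesgue. (norm (grad \<Omega> \<T> w X))\<^sup>2"
  let ?b = "LINT X:frontier \<Omega>|surf. (norm ((mesh_size \<T> powr (- 1 / 2)) *\<^sub>R w X))\<^sup>2"
  have nn: "0 \<le> ?g" "0 \<le> ?b"
    unfolding set_lebesgue_integral_def by (intro Bochner_Integration.integral_nonneg; simp)+
  have gh: "0 \<le> \<gamma>\<^sub>A * ghost_form \<Omega> \<T> p w w" using assms(3) ghost_form_nonneg by simp
  have eq: "(triple_norm \<Omega> \<T> p \<gamma>\<^sub>A w)\<^sup>2 = ?g + ?b + \<gamma>\<^sub>A * ghost_form \<Omega> \<T> p w w"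
    unfolding triple_norm_def L2_norm_on_def using nn gh by simp
  have "?g \<noteq> 0 \<or> ?b \<noteq> 0"
  proof (rule ccontr)
    assume "\<not> ?thesis"
    then have g0: "?g = 0" and b0: "?b = 0" by auto
    obtain c where c: "\<And>X. X \<in> active_domain \<Omega> \<T> \<Longrightarrow> w X = c"
      using constant_of_gradient_zero[OF w g0] by metis
    then have "c \<noteq> 0" using ne by auto
    have fr: "frontier \<Omega> \<subseteq> active_domain \<Omega> \<T>" using closure_subset_active by (auto simp: frontier_def)
    have "?b = (LINT X:frontier \<Omega>|surf. (norm ((mesh_size \<T> powr (- 1 / 2)) *\<^sub>R c))\<^sup>2)"
      using c fr by (intro set_lebesgue_integral_cong) auto
    also have "\<dots> = measure surf (frontier \<Omega>) * (norm ((mesh_size \<T> powr (- 1 / 2)) *\<^sub>R c))\<^sup>2"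
      using emeasure_surf_frontier_finite[OF domain] by (subst set_integral_const) auto
    finally have "measure surf (frontier \<Omega>) = 0" using b0 \<open>c \<noteq> 0\<close> mesh_size_pos by simp
    moreover have "0 < emeasure surf (frontier \<Omega>)"
      using domain by (intro emeasure_surf_frontier_pos) (auto simp: lipschitz_domain_def)
    \<comment> \<open>\<open>measure\<close> would be 0 for infinite mass too, so the contradiction
      takes finiteness together with positivity.\<close>
    ultimately show False
      using emeasure_surf_frontier_finite[OF domain]
      by (simp add: emeasure_eq_ennreal_measure less_top)
  qed
  then show ?thesis using nn gh eq by linarith
qed

end

section \<open>The descent direction\<close>

context cut_mesh
begin

lemma bounded_deformation_tube:
  assumes u: "u \<in> V_h \<Omega> \<T> p" and w: "w \<in> V_h \<Omega> \<T> p"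
    and U: "open U" "attained \<Omega> \<T> u \<subseteq> U"
  obtains \<epsilon> K where "0 < \<epsilon>" "compact K" "K \<subseteq> U"
    "\<And>t X. \<bar>t\<bar> < \<epsilon> \<Longrightarrow> X \<in> closure \<Omega> \<Longrightarrow> defgrad \<Omega> \<T> u X + t *\<^sub>R grad \<Omega> \<T> w X \<in> K"
proof -
  obtain r where r: "r > 0" "(\<Union>F\<in>attained \<Omega> \<T> u. cball F r) \<subseteq> U"
    using compact_subset_open_imp_cball_epsilon_subset[OF compact_attained[OF u] U] by metis
  obtain B where B: "\<And>X. X \<in> closure \<Omega> \<Longrightarrow> norm (grad \<Omega> \<T> w X) \<le> B"
    using grad_bounded[OF w] by metis
  \<comment> \<open>For parameters below \<epsilon> the gradient moves by at most
    \<open>\<epsilon> * (\<bar>B\<bar> + 1) = r\<close>; the added 1 keeps the denominator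
    positive.\<close>
  define \<epsilon> where "\<epsilon> = r / (\<bar>B\<bar> + 1)"
  show thesis
  proof (rule that[of \<epsilon> "\<Union>F\<in>attained \<Omega> \<T> u. cball F r"])
    show "0 < \<epsilon>" using r(1) by (simp add: \<epsilon>_def)
    show "compact (\<Union>F\<in>attained \<Omega> \<T> u. cball F r)"
      by (rule compact_minkowski_sum_cball[OF compact_attained[OF u]])
    show "(\<Union>F\<in>attained \<Omega> \<T> u. cball F r) \<subseteq> U" by (rule r(2))
    fix t X assume t: "\<bar>t\<bar> < \<epsilon>" and X: "X \<in> closure \<Omega>"
    have "norm (t *\<^sub>R grad \<Omega> \<T> w X) \<le> \<epsilon> * (\<bar>B\<bar> + 1)"
      unfolding norm_scaleR using t B[OF X] by (intro mult_mono) auto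
    also have "\<dots> = r" by (simp add: \<epsilon>_def)
    finally have "defgrad \<Omega> \<T> u X + t *\<^sub>R grad \<Omega> \<T> w X \<in> cball (defgrad \<Omega> \<T> u X) r"
      by (simp add: dist_norm)
    then show "defgrad \<Omega> \<T> u X + t *\<^sub>R grad \<Omega> \<T> w X \<in> (\<Union>F\<in>attained \<Omega> \<T> u. cball F r)"
      using defgrad_attained[OF X] by blast
  qed
qed

lemma defgrad_add_scaleR:
  assumes "u \<in> V_h \<Omega> \<T> p" "w \<in> V_h \<Omega> \<T> p" "X \<in> closure \<Omega>"
  shows "defgrad \<Omega> \<T> (\<lambda>x. u x + t *\<^sub>R w x) X = defgrad \<Omega> \<T> u X + t *\<^sub>R grad \<Omega> \<T> w X"
  by (simp add: defgrad_def grad_add_scaleR[OF assms])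

text \<open>Only the bulk, traction and penalty terms are differentiated under the integral, each as
  a function of a tuple in a compact product. The load is affine and the ghost term quadratic in
  \<open>t\<close>, so these two are expanded instead.\<close>

lemma energy_gateaux_derivative:
  assumes u: "u \<in> V_h \<Omega> \<T> p" and w: "w \<in> V_h \<Omega> \<T> p"
    and elliptic: "uniformly_elliptic \<Omega> \<T> \<Psi> c\<^sub>L C\<^sub>L J\<^sub>0 u"
    and f: "set_integrable lebesgue \<Omega> f\<^sub>0"
  shows "has_gateaux_derivative (E_total \<Omega> \<T> p \<Psi> \<mu>\<^sub>e \<gamma>\<^sub>D \<gamma>\<^sub>A f\<^sub>0 u)
           (F_total \<Omega> \<T> p \<Psi> \<mu>\<^sub>e \<gamma>\<^sub>D \<gamma>\<^sub>A f\<^sub>0 u w) u w"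
proof -
  obtain U where U: "open U" "attained \<Omega> \<T> u \<subseteq> U" "Ck_on 3 U \<Psi>"
    using elliptic unfolding uniformly_elliptic_def by blast
  interpret smooth_energy U \<Psi> by standard (use U in auto)
  obtain \<epsilon> K where \<epsilon>: "0 < \<epsilon>" and K: "compact K" "K \<subseteq> U"
    and tube: "\<And>t X. \<bar>t\<bar> < \<epsilon> \<Longrightarrow> X \<in> closure \<Omega> \<Longrightarrow> defgrad \<Omega> \<T> u X + t *\<^sub>R grad \<Omega> \<T> w X \<in> K"
    using bounded_deformation_tube[OF u w U(1,2)] by metis
  obtain BG where BG: "\<And>X. X \<in> closure \<Omega> \<Longrightarrow> norm (grad \<Omega> \<T> w X) \<le> BG"
    using grad_bounded[OF w] by metis
  obtain Bu where Bu: "\<And>X. X \<in> closure \<Omega> \<Longrightarrow> norm (u X) \<le> Bu" using V_h_bounded[OF u] by metis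
  obtain Bw where Bw: "\<And>X. X \<in> closure \<Omega> \<Longrightarrow> norm (w X) \<le> Bw" using V_h_bounded[OF w] by metis
  let ?F = "defgrad \<Omega> \<T> u" and ?G = "grad \<Omega> \<T> w" and ?n = "outer_normal \<Omega>"
  have sub: "\<Omega> \<subseteq> closure \<Omega>" "frontier \<Omega> \<subseteq> closure \<Omega>"
    by (auto simp: frontier_def closure_subset[THEN subsetD])
  have \<Omega>: "\<Omega> \<in> sets borel" using domain by (auto simp: lipschitz_domain_def)
  have sum_bound: "norm (u X + t *\<^sub>R w X) \<le> Bu + \<epsilon> * Bw" if "\<bar>t\<bar> < \<epsilon>" "X \<in> closure \<Omega>" for t X
  proof -
    have "norm (t *\<^sub>R w X) \<le> \<epsilon> * Bw"
      unfolding norm_scaleR using that Bw by (intro mult_mono) auto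
    then show ?thesis using Bu[OF that(2)] norm_triangle_ineq[of "u X" "t *\<^sub>R w X"] by linarith
  qed
  have meas: "?F \<in> borel_measurable (restrict_space M D)" "?G \<in> borel_measurable (restrict_space M D)"
    "u \<in> borel_measurable (restrict_space M D)" "w \<in> borel_measurable (restrict_space M D)"
    "?n \<in> borel_measurable (restrict_space M D)"
    if "D \<in> sets borel" "D \<subseteq> closure \<Omega>" "sets borel \<subseteq> sets M" "space M = UNIV" for M and D :: "(real ^ 'd) set"
  proof -
    have "(\<lambda>X. indicator (closure \<Omega>) X *\<^sub>R ?n X) \<in> borel_measurable borel" by measurable
    then show "?G \<in> borel_measurable (restrict_space M D)"
      "u \<in> borel_measurable (restrict_space M D)" "w \<in> borel_measurable (restrict_space M D)"
      "?n \<in> borel_measurable (restrict_space M D)"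
      by (intro borel_measurable_restrict_of_closure that borel_measurable_grad[OF w]
          borel_measurable_V_h[OF u] borel_measurable_V_h[OF w]; assumption)+
    have "grad \<Omega> \<T> u \<in> borel_measurable (restrict_space M D)"
      by (intro borel_measurable_restrict_of_closure that borel_measurable_grad[OF u])
    then show "?F \<in> borel_measurable (restrict_space M D)"
      unfolding defgrad_def[abs_def] by measurable
  qed
  have meas_vol: "sets borel \<subseteq> sets (lebesgue :: (real ^ 'd) measure)" by auto
  have [measurable]: "?F \<in> borel_measurable (restrict_space lebesgue \<Omega>)" "?G \<in> borel_measurable (restrict_space lebesgue \<Omega>)"
    "u \<in> borel_measurable (restrict_space lebesgue \<Omega>)" "w \<in> borel_measurable (restrict_space lebesgue \<Omega>)"
    using meas[OF \<Omega> sub(1) meas_vol] by auto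
  have [measurable]: "?F \<in> borel_measurable (restrict_space surf (frontier \<Omega>))" "?G \<in> borel_measurable (restrict_space surf (frontier \<Omega>))"
    "u \<in> borel_measurable (restrict_space surf (frontier \<Omega>))" "w \<in> borel_measurable (restrict_space surf (frontier \<Omega>))"
    "?n \<in> borel_measurable (restrict_space surf (frontier \<Omega>))"
    using meas[of "frontier \<Omega>" surf] sub(2) by auto
  have fr: "frontier \<Omega> \<in> sets surf" "emeasure surf (frontier \<Omega>) < \<infinity>"
    using emeasure_surf_frontier_finite[OF domain] by auto
  have vol: "\<Omega> \<in> sets lebesgue" "emeasure lebesgue \<Omega> < \<infinity>"
    using \<Omega> emeasure_lebesgue_domain_finite by auto

  have D1: "((\<lambda>t. LINT X:\<Omega>|lebesgue. \<Psi> (?F X + t *\<^sub>R ?G X)) has_real_derivative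
      (LINT X:\<Omega>|lebesgue. ddot (stress \<Psi> (?F X)) (?G X))) (at 0)"
  proof -
    \<comment> \<open>The gradient of the direction does not move with \<open>t\<close>, yet belongs
      to the tuple because the derivative depends on it.\<close>
    let ?Q = "K \<times> cball 0 BG :: ((real ^ 'd ^ 'd) \<times> (real ^ 'd ^ 'd)) set"
    have "((\<lambda>t. LINT X:\<Omega>|lebesgue. (\<lambda>q. \<Psi> (fst q)) (?F X + t *\<^sub>R ?G X, ?G X)) has_real_derivative
      (LINT X:\<Omega>|lebesgue. (\<lambda>q. ddot (stress \<Psi> (fst q)) (snd q)) (?F X + 0 *\<^sub>R ?G X, ?G X))) (at 0)"
    proof (rule has_real_derivative_set_integral[OF vol \<epsilon>])
      show "compact ?Q" using K by (intro compact_Times) auto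
      show "continuous_on ?Q (\<lambda>q. \<Psi> (fst q))"
        "continuous_on ?Q (\<lambda>q. ddot (stress \<Psi> (fst q)) (snd q))"
        using K by (auto intro!: continuous_intros)
      show "(?F X + t *\<^sub>R ?G X, ?G X) \<in> ?Q" if "\<bar>t\<bar> < \<epsilon>" "X \<in> \<Omega>" for t X
        using that tube[of t X] BG[of X] sub(1) by auto
      show "((\<lambda>t. \<Psi> (fst (?F X + t *\<^sub>R ?G X, ?G X))) has_real_derivative
          ddot (stress \<Psi> (fst (?F X + t *\<^sub>R ?G X, ?G X))) (snd (?F X + t *\<^sub>R ?G X, ?G X))) (at t)"
        if "\<bar>t\<bar> < \<epsilon>" "X \<in> \<Omega>" for t X
        unfolding fst_conv snd_conv by (rule energy_derivative) (use that tube[of t X] sub(1) K(2) in auto)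
    qed measurable
    then show ?thesis by simp
  qed

  have traction: "((\<lambda>t. LINT X:frontier \<Omega>|surf. nBv (?n X) (stress \<Psi> (?F X + t *\<^sub>R ?G X)) (u X + t *\<^sub>R w X)) has_real_derivative
      (LINT X:frontier \<Omega>|surf. nBv (?n X) (elast_app \<Psi> (?F X) (?G X)) (u X) + nBv (?n X) (stress \<Psi> (?F X)) (w X))) (at 0)"
    (is "(?f has_real_derivative ?d) (at 0)")
    and traction_int: "set_integrable surf (frontier \<Omega>) (\<lambda>X. nBv (?n X) (elast_app \<Psi> (?F X) (?G X)) (u X))"
      "set_integrable surf (frontier \<Omega>) (\<lambda>X. nBv (?n X) (stress \<Psi> (?F X)) (w X))"
  proof -
    \<comment> \<open>Components: deformation gradient, normal, displacement, then gradient and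
      value of the direction; the last two enter only the derivative.\<close>
    let ?a = "\<lambda>t X. (?F X + t *\<^sub>R ?G X, ?n X, u X + t *\<^sub>R w X, ?G X, w X)"
    let ?Q = "K \<times> cball 0 1 \<times> cball 0 (Bu + \<epsilon> * Bw) \<times> cball 0 BG \<times> cball 0 Bw :: ((real ^ 'd ^ 'd) \<times> (real ^ 'd) \<times> (real ^ 'd) \<times> (real ^ 'd ^ 'd) \<times> (real ^ 'd)) set"
    let ?Th = "\<lambda>q :: (real ^ 'd ^ 'd) \<times> (real ^ 'd) \<times> (real ^ 'd) \<times> (real ^ 'd ^ 'd) \<times> (real ^ 'd).
      nBv (fst (snd q)) (stress \<Psi> (fst q)) (fst (snd (snd q)))"
    let ?T1 = "\<lambda>q :: (real ^ 'd ^ 'd) \<times> (real ^ 'd) \<times> (real ^ 'd) \<times> (real ^ 'd ^ 'd) \<times> (real ^ 'd).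
      nBv (fst (snd q)) (elast_app \<Psi> (fst q) (fst (snd (snd (snd q))))) (fst (snd (snd q)))"
    let ?T2 = "\<lambda>q :: (real ^ 'd ^ 'd) \<times> (real ^ 'd) \<times> (real ^ 'd) \<times> (real ^ 'd ^ 'd) \<times> (real ^ 'd).
      nBv (fst (snd q)) (stress \<Psi> (fst q)) (snd (snd (snd (snd q))))"
    have Q: "compact ?Q" using K by (intro compact_Times) auto
    have cont: "continuous_on ?Q ?Th" "continuous_on ?Q ?T1" "continuous_on ?Q ?T2"
      using K by (auto intro!: continuous_intros)
    have aQ: "?a t X \<in> ?Q" if "\<bar>t\<bar> < \<epsilon>" "X \<in> frontier \<Omega>" for t X
      using that tube[of t X] BG[of X] Bw[of X] sum_bound[of t X] norm_outer_normal_le[of \<Omega> X] sub(2) by auto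
    have am: "?a t \<in> borel_measurable (restrict_space surf (frontier \<Omega>))" for t by measurable
    have "((\<lambda>t. LINT X:frontier \<Omega>|surf. ?Th (?a t X)) has_real_derivative
      (LINT X:frontier \<Omega>|surf. (\<lambda>q. ?T1 q + ?T2 q) (?a 0 X))) (at 0)"
    proof (rule has_real_derivative_set_integral[OF fr \<epsilon> Q cont(1) _ am aQ])
      show "continuous_on ?Q (\<lambda>q. ?T1 q + ?T2 q)" by (intro continuous_on_add cont)
      show "((\<lambda>t. ?Th (?a t X)) has_real_derivative ?T1 (?a t X) + ?T2 (?a t X)) (at t)"
        if "\<bar>t\<bar> < \<epsilon>" "X \<in> frontier \<Omega>" for t X
        unfolding fst_conv snd_conv by (rule traction_work_derivative) (use that tube[of t X] sub(2) K(2) in auto)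
    qed
    then show "(?f has_real_derivative ?d) (at 0)" by simp
    show "set_integrable surf (frontier \<Omega>) (\<lambda>X. nBv (?n X) (elast_app \<Psi> (?F X) (?G X)) (u X))"
      "set_integrable surf (frontier \<Omega>) (\<lambda>X. nBv (?n X) (stress \<Psi> (?F X)) (w X))"
      using set_integrable_continuous_comp[OF fr Q cont(2) am[of 0] aQ] set_integrable_continuous_comp[OF fr Q cont(3) am[of 0] aQ] \<epsilon>
      by simp_all
  qed

  let ?\<eta> = "penalty_weight \<Omega> \<T> \<Psi> \<mu>\<^sub>e u" and ?h = "mesh_size \<T>"
  have D4: "((\<lambda>t. LINT X:frontier \<Omega>|surf. \<gamma>\<^sub>D * ?\<eta> X / (2 * ?h) * (norm (u X + t *\<^sub>R w X))\<^sup>2) has_real_derivative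
      (LINT X:frontier \<Omega>|surf. \<gamma>\<^sub>D * ?\<eta> X / ?h * (u X \<bullet> w X))) (at 0)"
  proof -
    \<comment> \<open>The weight is frozen at \<open>u\<close>, so the first component stays at
      \<open>?F X\<close>; it lies in \<open>K\<close> by the tube at parameter 0.\<close>
    let ?a = "\<lambda>t X. (?F X, u X + t *\<^sub>R w X, w X)"
    let ?Q = "K \<times> cball 0 (Bu + \<epsilon> * Bw) \<times> cball 0 Bw :: ((real ^ 'd ^ 'd) \<times> (real ^ 'd) \<times> (real ^ 'd)) set"
    let ?c = "\<lambda>q :: (real ^ 'd ^ 'd) \<times> (real ^ 'd) \<times> (real ^ 'd). \<gamma>\<^sub>D * max (2 * \<mu>\<^sub>e) (1 / 2 * elast_norm1 \<Psi> (fst q))"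
    have Q: "compact ?Q" using K by (intro compact_Times) auto
    have cc: "continuous_on ?Q ?c" using K by (auto intro!: continuous_intros)
    have "((\<lambda>t. LINT X:frontier \<Omega>|surf. (\<lambda>q. ?c q / (2 * ?h) * (norm (fst (snd q)))\<^sup>2) (?a t X)) has_real_derivative
      (LINT X:frontier \<Omega>|surf. (\<lambda>q. ?c q / ?h * (fst (snd q) \<bullet> snd (snd q))) (?a 0 X))) (at 0)"
    proof (rule has_real_derivative_set_integral[OF fr \<epsilon> Q])
      show "continuous_on ?Q (\<lambda>q. ?c q / (2 * ?h) * (norm (fst (snd q)))\<^sup>2)"
        "continuous_on ?Q (\<lambda>q. ?c q / ?h * (fst (snd q) \<bullet> snd (snd q)))"
        using mesh_size_pos K(2) by (auto intro!: continuous_intros)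
      show "?a t X \<in> ?Q" if "\<bar>t\<bar> < \<epsilon>" "X \<in> frontier \<Omega>" for t X
        using that tube[of 0 X] Bw[of X] sum_bound[of t X] sub(2) by auto
      show "((\<lambda>t. ?c (?a t X) / (2 * ?h) * (norm (fst (snd (?a t X))))\<^sup>2) has_real_derivative
          ?c (?a t X) / ?h * (fst (snd (?a t X)) \<bullet> snd (snd (?a t X)))) (at t)"
        if "\<bar>t\<bar> < \<epsilon>" "X \<in> frontier \<Omega>" for t X
      proof -
        have "((\<lambda>t. (norm (u X + t *\<^sub>R w X))\<^sup>2) has_real_derivative 2 * ((u X + t *\<^sub>R w X) \<bullet> w X)) (at t)"
        proof -
          have "(norm (u X + t *\<^sub>R w X))\<^sup>2 = u X \<bullet> u X + 2 * t * (u X \<bullet> w X) + t\<^sup>2 * (w X \<bullet> w X)" for t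
            unfolding power2_norm_eq_inner by (simp add: inner_add_left inner_add_right inner_commute power2_eq_square algebra_simps)
          moreover have "((\<lambda>t. u X \<bullet> u X + 2 * t * (u X \<bullet> w X) + t\<^sup>2 * (w X \<bullet> w X)) has_real_derivative
              2 * ((u X + t *\<^sub>R w X) \<bullet> w X)) (at t)"
            by (auto intro!: derivative_eq_intros simp: inner_add_left algebra_simps)
          ultimately show ?thesis by simp
        qed
        from DERIV_cmult[OF this, of "?c (?a t X) / (2 * ?h)"] show ?thesis by (simp add: mult.assoc)
      qed
    qed measurable
    then show ?thesis by (simp add: penalty_weight_def)
  qed

  \<comment> \<open>\<open>f\<^sub>0\<close> is merely integrable and has no compact range;
    boundedness of the discrete function gives an integrable majorant.\<close>
  have load_int: "set_integrable lebesgue \<Omega> (\<lambda>X. f\<^sub>0 X \<bullet> v X)" if v: "v \<in> V_h \<Omega> \<T> p" for v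
  proof -
    obtain B where B: "\<And>X. X \<in> closure \<Omega> \<Longrightarrow> norm (v X) \<le> B" using V_h_bounded[OF v] by metis
    have fm: "(\<lambda>X. indicator \<Omega> X *\<^sub>R f\<^sub>0 X) \<in> borel_measurable lebesgue"
      using f by (simp add: set_integrable_def borel_measurable_integrable)
    have vm: "(\<lambda>X. indicator (closure \<Omega>) X *\<^sub>R v X) \<in> borel_measurable lebesgue"
      using measurable_completion[of _ lborel] borel_measurable_V_h[OF v] by simp
    have eq: "(\<lambda>X. indicator \<Omega> X *\<^sub>R (f\<^sub>0 X \<bullet> v X)) = (\<lambda>X. (indicator \<Omega> X *\<^sub>R f\<^sub>0 X) \<bullet> (indicator (closure \<Omega>) X *\<^sub>R v X))"
      using sub(1) by (intro ext) (auto split: split_indicator)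
    show ?thesis
      unfolding set_integrable_def
    proof (rule Bochner_Integration.integrable_bound)
      show "integrable lebesgue (\<lambda>X. \<bar>B\<bar> *\<^sub>R (indicator \<Omega> X *\<^sub>R f\<^sub>0 X))"
        using f unfolding set_integrable_def by (rule integrable_scaleR_right)
      show "(\<lambda>X. indicator \<Omega> X *\<^sub>R (f\<^sub>0 X \<bullet> v X)) \<in> borel_measurable lebesgue"
        unfolding eq by (intro borel_measurable_inner fm vm)
      show "AE X in lebesgue. norm (indicator \<Omega> X *\<^sub>R (f\<^sub>0 X \<bullet> v X)) \<le> norm (\<bar>B\<bar> *\<^sub>R (indicator \<Omega> X *\<^sub>R f\<^sub>0 X))"
      proof (intro AE_I2)
        fix X
        have "\<bar>f\<^sub>0 X \<bullet> v X\<bar> \<le> norm (f\<^sub>0 X) * \<bar>B\<bar>" if "X \<in> \<Omega>"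
          using Cauchy_Schwarz_ineq2[of "f\<^sub>0 X" "v X"] B[of X] sub(1) that
          by (meson abs_ge_self mult_left_mono norm_ge_zero order_trans subsetD)
        then show "norm (indicator \<Omega> X *\<^sub>R (f\<^sub>0 X \<bullet> v X)) \<le> norm (\<bar>B\<bar> *\<^sub>R (indicator \<Omega> X *\<^sub>R f\<^sub>0 X))"
          by (auto split: split_indicator simp: mult.commute)
      qed
    qed
  qed
  have load: "(LINT X:\<Omega>|lebesgue. f\<^sub>0 X \<bullet> (u X + t *\<^sub>R w X))
      = (LINT X:\<Omega>|lebesgue. f\<^sub>0 X \<bullet> u X) + t * (LINT X:\<Omega>|lebesgue. f\<^sub>0 X \<bullet> w X)" for t
    using set_integral_add(2)[OF load_int[OF u] set_integrable_mult_right[OF load_int[OF w], of t]]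
    by (simp add: inner_add_right)

  let ?E = "\<lambda>t. (LINT X:\<Omega>|lebesgue. \<Psi> (?F X + t *\<^sub>R ?G X))
      - ((LINT X:\<Omega>|lebesgue. f\<^sub>0 X \<bullet> u X) + t * (LINT X:\<Omega>|lebesgue. f\<^sub>0 X \<bullet> w X))
      - (LINT X:frontier \<Omega>|surf. nBv (?n X) (stress \<Psi> (?F X + t *\<^sub>R ?G X)) (u X + t *\<^sub>R w X))
      + (LINT X:frontier \<Omega>|surf. \<gamma>\<^sub>D * ?\<eta> X / (2 * ?h) * (norm (u X + t *\<^sub>R w X))\<^sup>2)
      + \<gamma>\<^sub>A / 2 * (ghost_form \<Omega> \<T> p u u + 2 * t * ghost_form \<Omega> \<T> p u w + t\<^sup>2 * ghost_form \<Omega> \<T> p w w)"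
  have E: "E_total \<Omega> \<T> p \<Psi> \<mu>\<^sub>e \<gamma>\<^sub>D \<gamma>\<^sub>A f\<^sub>0 u (\<lambda>X. u X + t *\<^sub>R w X) = ?E t" for t
  proof -
    have "(LINT X:\<Omega>|lebesgue. \<Psi> (defgrad \<Omega> \<T> (\<lambda>X. u X + t *\<^sub>R w X) X)) = (LINT X:\<Omega>|lebesgue. \<Psi> (?F X + t *\<^sub>R ?G X))"
      using sub(1) vol(1) by (intro set_lebesgue_integral_cong) (auto simp: defgrad_add_scaleR[OF u w])
    moreover have "(LINT X:frontier \<Omega>|surf. nBv (?n X) (stress \<Psi> (defgrad \<Omega> \<T> (\<lambda>X. u X + t *\<^sub>R w X) X)) (u X + t *\<^sub>R w X))
        = (LINT X:frontier \<Omega>|surf. nBv (?n X) (stress \<Psi> (?F X + t *\<^sub>R ?G X)) (u X + t *\<^sub>R w X))"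
      using sub(2) fr(1) by (intro set_lebesgue_integral_cong) (auto simp: defgrad_add_scaleR[OF u w])
    ultimately show ?thesis
      unfolding E_total_def load ghost_form_expand[OF u w] by simp
  qed
  have lin: "((\<lambda>t. c + t * d) has_real_derivative d) (at 0)" for c d :: real
    by (auto intro!: derivative_eq_intros)
  have quad: "((\<lambda>t. \<gamma>\<^sub>A / 2 * (c + 2 * t * d + t\<^sup>2 * e)) has_real_derivative \<gamma>\<^sub>A * d) (at 0)" for c d e :: real
    by (auto intro!: derivative_eq_intros)
  have "(?E has_real_derivative
      (LINT X:\<Omega>|lebesgue. ddot (stress \<Psi> (?F X)) (?G X))
      - (LINT X:\<Omega>|lebesgue. f\<^sub>0 X \<bullet> w X)
      - (LINT X:frontier \<Omega>|surf. nBv (?n X) (elast_app \<Psi> (?F X) (?G X)) (u X) + nBv (?n X) (stress \<Psi> (?F X)) (w X))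
      + (LINT X:frontier \<Omega>|surf. \<gamma>\<^sub>D * ?\<eta> X / ?h * (u X \<bullet> w X))
      + \<gamma>\<^sub>A * ghost_form \<Omega> \<T> p u w) (at 0)"
    by (intro DERIV_add DERIV_diff D1 lin traction D4 quad)
  then show ?thesis
    \<comment> \<open>\<open>traction_int\<close> splits the derivative of the traction work into
      the two separate boundary integrals of the residual.\<close>
    unfolding has_gateaux_derivative_def E F_total_def set_integral_add(2)[OF traction_int]
    by (simp add: algebra_simps)
qed

end

theorem lemma2:
  fixes \<Omega> :: "(real ^ 'd) set" and \<T> :: "(real ^ 'd) set set" and p :: nat
    and \<Psi> :: "real ^ 'd ^ 'd \<Rightarrow> real"
    and f\<^sub>0 ub du :: "real ^ 'd \<Rightarrow> real ^ 'd"
    and \<kappa> \<mu>\<^sub>e E\<^sub>e \<alpha> \<gamma>\<^sub>A \<gamma>\<^sub>D c\<^sub>L C\<^sub>L J\<^sub>0 h\<^sub>0 \<gamma>\<^sub>0 c\<^sub>s :: real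
  assumes "lipschitz_domain \<Omega>"
    and "background_mesh \<kappa> \<Omega> \<T>"
    and "1 \<le> p"
    and "0 < \<mu>\<^sub>e" and "0 < E\<^sub>e" and "\<gamma>\<^sub>A = \<alpha> * E\<^sub>e" and "0 < \<gamma>\<^sub>A" and "0 < \<gamma>\<^sub>D"
    and "set_integrable lebesgue \<Omega> f\<^sub>0"
    and "coercivity_threshold \<kappa> \<Omega> p \<Psi> \<mu>\<^sub>e \<gamma>\<^sub>A c\<^sub>L C\<^sub>L J\<^sub>0 h\<^sub>0 \<gamma>\<^sub>0 c\<^sub>s"
    and "mesh_size \<T> \<le> h\<^sub>0"
    and "\<gamma>\<^sub>0 \<le> \<gamma>\<^sub>D"
    and "ub \<in> V_h \<Omega> \<T> p"
    and "uniformly_elliptic \<Omega> \<T> \<Psi> c\<^sub>L C\<^sub>L J\<^sub>0 ub"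
    and "du \<in> V_h \<Omega> \<T> p"
    and "\<exists>X\<in>active_domain \<Omega> \<T>. du X \<noteq> 0"
    and "\<forall>v\<in>V_h \<Omega> \<T> p.
           A_h \<Omega> \<T> p \<Psi> \<mu>\<^sub>e \<gamma>\<^sub>D \<gamma>\<^sub>A ub du v = - F_total \<Omega> \<T> p \<Psi> \<mu>\<^sub>e \<gamma>\<^sub>D \<gamma>\<^sub>A f\<^sub>0 ub v"
  shows "has_gateaux_derivative (E_total \<Omega> \<T> p \<Psi> \<mu>\<^sub>e \<gamma>\<^sub>D \<gamma>\<^sub>A f\<^sub>0 ub)
           (- A_h \<Omega> \<T> p \<Psi> \<mu>\<^sub>e \<gamma>\<^sub>D \<gamma>\<^sub>A ub du du) ub du
    \<and> - A_h \<Omega> \<T> p \<Psi> \<mu>\<^sub>e \<gamma>\<^sub>D \<gamma>\<^sub>A ub du du \<le> - c\<^sub>s * (triple_norm \<Omega> \<T> p \<gamma>\<^sub>A du)\<^sup>2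
    \<and> - c\<^sub>s * (triple_norm \<Omega> \<T> p \<gamma>\<^sub>A du)\<^sup>2 < 0
    \<and> (\<forall>\<^sub>F \<beta> in at_right 0.
           E_total \<Omega> \<T> p \<Psi> \<mu>\<^sub>e \<gamma>\<^sub>D \<gamma>\<^sub>A f\<^sub>0 ub (\<lambda>X. ub X + \<beta> *\<^sub>R du X)
             < E_total \<Omega> \<T> p \<Psi> \<mu>\<^sub>e \<gamma>\<^sub>D \<gamma>\<^sub>A f\<^sub>0 ub ub)"
proof -
  interpret cut_mesh \<kappa> \<Omega> \<T> using assms(1,2) by unfold_locales
  let ?E = "E_total \<Omega> \<T> p \<Psi> \<mu>\<^sub>e \<gamma>\<^sub>D \<gamma>\<^sub>A f\<^sub>0 ub" and ?A = "A_h \<Omega> \<T> p \<Psi> \<mu>\<^sub>e \<gamma>\<^sub>D \<gamma>\<^sub>A ub du du"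
  let ?N = "(triple_norm \<Omega> \<T> p \<gamma>\<^sub>A du)\<^sup>2"
  \<comment> \<open>The step itself is taken as the test function.\<close>
  have "F_total \<Omega> \<T> p \<Psi> \<mu>\<^sub>e \<gamma>\<^sub>D \<gamma>\<^sub>A f\<^sub>0 ub du = - ?A" using assms(15,17) by simp
  then have gateaux: "has_gateaux_derivative ?E (- ?A) ub du"
    using energy_gateaux_derivative[OF assms(13,15,14,9)] by metis
  have coercive: "c\<^sub>s * ?N \<le> ?A" and "0 < c\<^sub>s"
    using assms(2,10-15) unfolding coercivity_threshold_def by blast+
  then have neg: "- c\<^sub>s * ?N < 0"
    using triple_norm_pos[OF assms(15,16,7)] by simp
  have "((\<lambda>t. ?E (\<lambda>x. ub x + t *\<^sub>R du x)) has_real_derivative - ?A) (at 0)"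
    using gateaux by (simp add: has_gateaux_derivative_def)
  moreover have "- ?A < 0" using coercive neg by simp
  ultimately obtain d where d: "0 < d"
    "\<forall>h>0. h < d \<longrightarrow> ?E (\<lambda>x. ub x + (0 + h) *\<^sub>R du x) < ?E (\<lambda>x. ub x + 0 *\<^sub>R du x)"
    using DERIV_neg_dec_right by blast
  have "\<forall>\<^sub>F \<beta> in at_right 0. ?E (\<lambda>X. ub X + \<beta> *\<^sub>R du X) < ?E ub"
    unfolding eventually_at_right[OF zero_less_one] using d by (intro exI[of _ d]) simp
  then show ?thesis using gateaux coercive neg by simp
qed

end
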